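(* Assume that the topological complexity of $X$ equals the rational cohomological lower bound, $\mathrm{TC}(X)=\mathrm{nil}\big(\mathrm{Ker}\,(\Delta^*\colon H^*(X\times X;\mathbb{Q})\to H^*(X;\mathbb{Q}))\big)$, where $\Delta\colon X\to X\times X$ is the diagonal map. Then $\mathrm{TC}(p)=\mathrm{TC}(X)$ for every finite-sheeted covering projection $p\colon\widetilde X\to X$.
   Context: $X$ is a (pointed) CW-complex; all spaces (including $\widetilde X$) are path-connected metric absolute neighbourhood retracts. For an ideal $J$, $\mathrm{nil}(J)$ is the minimal integer $n$ such that every product of $n$ elements of $J$ is zero. Let $I=[0,1]$ and let $X^I$ be the space of continuous paths in $X$ with the compact-open topology. For a continuous surjection $p\colon E\to B$, the sectional number $\mathrm{sec}(p)$ is the minimal integer $n$ for which there is an increasing sequence of open subsets $\emptyset=U_0\subseteq U_1\subseteq\cdots\subseteq U_n=B$ such that for each $i=1,\dots,n$ there is a continuous map $s\colon U_i-U_{i-1}\to E$ with $p(s(b))=b$ for all $b$; if no such $n$ exists, $\mathrm{sec}(p)=\infty$. For a continuous surjection $f\colon X\to Y$ between path-connected spaces, $\mathrm{TC}(f)=\mathrm{sec}(\pi_f)$, where $\pi_f\colon X^I\to X\times Y$, $\pi_f(\alpha)=(\alpha(0),f(\alpha(1)))$; and $\mathrm{TC}(X)=\mathrm{TC}(\mathrm{id}_X)$. *)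

theory Defs
  imports "HOL-Analysis.Analysis" "HOL-Homology.Homology" "HOL-Algebra.QuotRing"
    "HOL-Library.Extended_Nat"
begin

section \<open>CW-complexes\<close>

definition unit_disc :: "nat \<Rightarrow> (nat \<Rightarrow> real) set" where
  "unit_disc n = {x \<in> topspace (Euclidean_space n). (\<Sum>i<n. (x i)\<^sup>2) \<le> 1}"

definition open_unit_disc :: "nat \<Rightarrow> (nat \<Rightarrow> real) set" where
  "open_unit_disc n = {x \<in> topspace (Euclidean_space n). (\<Sum>i<n. (x i)\<^sup>2) < 1}"

text \<open>A CW structure is given by its set of characteristic maps, each paired with the dimension
  of its cell. The conjuncts after the first two say: the open cells partition the space, the
  boundary of each cell lies in finitely many cells of lower dimension, and the space carries the
  weak topology.\<close>

definition CW_structure :: "'a topology \<Rightarrow> (nat \<times> ((nat \<Rightarrow> real) \<Rightarrow> 'a)) set \<Rightarrow> bool" where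
  "CW_structure X C \<longleftrightarrow>
     Hausdorff_space X \<and>
     (\<forall>(n, \<phi>) \<in> C.
        continuous_map (subtopology (Euclidean_space n) (unit_disc n)) X \<phi> \<and>
        homeomorphic_map (subtopology (Euclidean_space n) (open_unit_disc n))
                         (subtopology X (\<phi> ` open_unit_disc n)) \<phi>) \<and>
     (\<Union>(n, \<phi>) \<in> C. \<phi> ` open_unit_disc n) = topspace X \<and>
     pairwise (\<lambda>(m, \<phi>) (n, \<psi>). disjnt (\<phi> ` open_unit_disc m) (\<psi> ` open_unit_disc n)) C \<and>
     (\<forall>(n, \<phi>) \<in> C. \<exists>F \<subseteq> C. finite F \<and> (\<forall>(m, \<psi>) \<in> F. m < n) \<and>
        \<phi> ` (unit_disc n - open_unit_disc n) \<subseteq> (\<Union>(m, \<psi>) \<in> F. \<psi> ` open_unit_disc m)) \<and>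
     (\<forall>A \<subseteq> topspace X. (\<forall>(n, \<phi>) \<in> C. closedin X (A \<inter> \<phi> ` unit_disc n)) \<longrightarrow> closedin X A)"

definition CW_complex :: "'a topology \<Rightarrow> bool" where
  "CW_complex X \<longleftrightarrow> (\<exists>C. CW_structure X C)"


section \<open>Metric absolute neighbourhood retracts\<close>

text \<open>The library's \<^const>\<open>ANR\<close> is tailored to subsets of Euclidean spaces. Here the space is
  required to be a neighbourhood retract in every metrizable space that contains it as a closed
  subspace. HOL cannot quantify over metrizable spaces of arbitrary type; the type used below is
  large enough, because by Wojdyslawski's theorem a metrizable space with points in the type
  variable \<open>'a\<close> is homeomorphic to a closed subspace of a convex subset of the normed space of
  bounded functions \<open>'a \<Rightarrow> real\<close>, and (by Dugundji's extension theorem) it is an ANR for all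
  metrizable spaces as soon as it is a neighbourhood retract of that convex set.\<close>

definition metric_ANR :: "'a topology \<Rightarrow> bool" where
  "metric_ANR X \<longleftrightarrow>
     metrizable_space X \<and>
     (\<forall>(Y :: ('a \<Rightarrow> real) topology) A.
        metrizable_space Y \<and> closedin Y A \<and> X homeomorphic_space subtopology Y A \<longrightarrow>
        (\<exists>U. openin Y U \<and> A \<subseteq> U \<and> A retract_of_space (subtopology Y U)))"


section \<open>Sectional number and topological complexity\<close>

text \<open>Continuous maps are represented by functions that are \<^const>\<open>undefined\<close> outside the
  domain, so that distinct elements are distinct maps.\<close>

definition compact_open_topology :: "'a topology \<Rightarrow> 'b topology \<Rightarrow> ('a \<Rightarrow> 'b) topology" where
  "compact_open_topology X Y =
     topology_generated_by
       {{f \<in> extensional (topspace X). continuous_map X Y f \<and> f ` K \<subseteq> V} | K V.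
          compactin X K \<and> openin Y V}"

definition path_space :: "'a topology \<Rightarrow> (real \<Rightarrow> 'a) topology" where
  "path_space X = compact_open_topology (top_of_set {0..1}) X"

text \<open>The infimum over the empty set is \<open>\<infinity>\<close> in \<^typ>\<open>enat\<close>.\<close>

definition sec :: "'e topology \<Rightarrow> 'b topology \<Rightarrow> ('e \<Rightarrow> 'b) \<Rightarrow> enat" where
  "sec E B p =
     Inf {enat n | n. \<exists>U :: nat \<Rightarrow> 'b set.
            U 0 = {} \<and> U n = topspace B \<and>
            (\<forall>i\<le>n. openin B (U i)) \<and> (\<forall>i<n. U i \<subseteq> U (Suc i)) \<and>
            (\<forall>i\<in>{1..n}. \<exists>s. continuous_map (subtopology B (U i - U (i - 1))) E s \<and>
                            (\<forall>b \<in> U i - U (i - 1). p (s b) = b))}"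

definition TC_map :: "'a topology \<Rightarrow> 'b topology \<Rightarrow> ('a \<Rightarrow> 'b) \<Rightarrow> enat" where
  "TC_map X Y f = sec (path_space X) (prod_topology X Y) (\<lambda>\<alpha>. (\<alpha> 0, f (\<alpha> 1)))"

definition TC :: "'a topology \<Rightarrow> enat" where
  "TC X = TC_map X X id"


section \<open>The rational singular cohomology ring\<close>

text \<open>An element of the total cochain complex assigns to each degree \<open>n\<close> a rational function on
  the singular \<open>n\<close>-simplices, extended by zero to all other functions; only finitely many degrees
  are nonzero (direct sum of the cochain groups).\<close>

type_synonym 'a cochain = "nat \<Rightarrow> ((nat \<Rightarrow> real) \<Rightarrow> 'a) \<Rightarrow> rat"

definition cochains :: "'a topology \<Rightarrow> 'a cochain set" where
  "cochains X = {u. (\<forall>n \<sigma>. \<not> singular_simplex n X \<sigma> \<longrightarrow> u n \<sigma> = 0) \<and>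
                    finite {n. \<exists>\<sigma>. u n \<sigma> \<noteq> 0}}"

definition coboundary :: "'a topology \<Rightarrow> 'a cochain \<Rightarrow> 'a cochain" where
  "coboundary X u = (\<lambda>n \<sigma>.
     if n = 0 \<or> \<not> singular_simplex n X \<sigma> then 0
     else (\<Sum>k\<le>n. (-1) ^ k * u (n - 1) (singular_face n k \<sigma>)))"

definition cocycles :: "'a topology \<Rightarrow> 'a cochain set" where
  "cocycles X = {u \<in> cochains X. coboundary X u = (\<lambda>n \<sigma>. 0)}"

definition coboundaries :: "'a topology \<Rightarrow> 'a cochain set" where
  "coboundaries X = coboundary X ` cochains X"

definition front_face :: "nat \<Rightarrow> ((nat \<Rightarrow> real) \<Rightarrow> 'a) \<Rightarrow> (nat \<Rightarrow> real) \<Rightarrow> 'a" where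
  "front_face p \<sigma> = restrict \<sigma> (standard_simplex p)"

text \<open>The face on the last \<open>q + 1\<close> vertices of a \<open>(p + q)\<close>-simplex.\<close>

definition back_face :: "nat \<Rightarrow> nat \<Rightarrow> ((nat \<Rightarrow> real) \<Rightarrow> 'a) \<Rightarrow> (nat \<Rightarrow> real) \<Rightarrow> 'a" where
  "back_face p q \<sigma> =
     restrict (\<lambda>x. \<sigma> (\<lambda>i. if i < p then 0 else x (i - p))) (standard_simplex q)"

definition cup :: "'a topology \<Rightarrow> 'a cochain \<Rightarrow> 'a cochain \<Rightarrow> 'a cochain" where
  "cup X u v = (\<lambda>n \<sigma>.
     if singular_simplex n X \<sigma>
     then (\<Sum>p\<le>n. u p (front_face p \<sigma>) * v (n - p) (back_face p (n - p) \<sigma>)) else 0)"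

definition cocycle_ring :: "'a topology \<Rightarrow> 'a cochain ring" where
  "cocycle_ring X =
     \<lparr>carrier = cocycles X,
      mult = cup X,
      one = (\<lambda>n \<sigma>. if n = 0 \<and> singular_simplex 0 X \<sigma> then 1 else 0),
      zero = (\<lambda>n \<sigma>. 0),
      add = (\<lambda>u v n \<sigma>. u n \<sigma> + v n \<sigma>)\<rparr>"

definition rat_cohomology :: "'a topology \<Rightarrow> 'a cochain set ring" where
  "rat_cohomology X = cocycle_ring X Quot coboundaries X"

definition pullback :: "'a topology \<Rightarrow> ('a \<Rightarrow> 'b) \<Rightarrow> 'b cochain \<Rightarrow> 'a cochain" where
  "pullback X f u = (\<lambda>n \<sigma>. if singular_simplex n X \<sigma> then u n (simplex_map n f \<sigma>) else 0)"

text \<open>For a continuous map \<open>f\<close> from \<open>X\<close> to \<open>Y\<close>, all representatives of a class on \<open>Y\<close>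
  pull back to one and the same class on \<open>X\<close>, which \<^const>\<open>the_elem\<close> selects.\<close>

definition induced_hom ::
  "'a topology \<Rightarrow> ('a \<Rightarrow> 'b) \<Rightarrow> 'b cochain set \<Rightarrow> 'a cochain set" where
  "induced_hom X f c =
     the_elem ((\<lambda>u. coboundaries X +>\<^bsub>cocycle_ring X\<^esub> pullback X f u) ` c)"

text \<open>The empty product is \<open>\<one>\<close>, so in a nontrivial ring the zero ideal has index 1.\<close>

definition nil_index :: "('r, 'm) ring_scheme \<Rightarrow> 'r set \<Rightarrow> enat" where
  "nil_index R J =
     Inf {enat n | n. \<forall>xs. length xs = n \<and> set xs \<subseteq> J \<longrightarrow>
                        foldr (\<lambda>x y. x \<otimes>\<^bsub>R\<^esub> y) xs \<one>\<^bsub>R\<^esub> = \<zero>\<^bsub>R\<^esub>}"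

text \<open>The rational cohomological lower bound for the topological complexity.\<close>

definition diagonal_kernel :: "'a topology \<Rightarrow> ('a \<times> 'a) cochain set set" where
  "diagonal_kernel X =
     a_kernel (rat_cohomology (prod_topology X X)) (rat_cohomology X)
       (induced_hom X (\<lambda>x. (x, x)))"


section \<open>Finite-sheeted coverings\<close>

definition finite_sheeted_covering ::
  "'b::topological_space set \<Rightarrow> ('b \<Rightarrow> 'a::topological_space) \<Rightarrow> 'a set \<Rightarrow> bool" where
  "finite_sheeted_covering E p B \<longleftrightarrow>
     covering_space E p B \<and> (\<forall>b\<in>B. finite {e \<in> E. p e = b})"

end

theory Submission
  imports Defs "HOL-Library.Function_Algebras"
begin

text \<open>Lifting the paths given by a sectional filtration for \<open>X\<close> yields one for \<open>p\<close> of the same length,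
  so \<open>TC(p) \<le> TC(X)\<close>. Conversely, let \<open>Xt \<times> X\<close> be filtered by open sets \<open>U\<^sub>i\<close> with sections on
  \<open>U\<^sub>i - U\<^sub>i\<^sub>-\<^sub>1\<close>. A metrizable connected CW complex is locally finite and hence separable, and a
  separable metric ANR is a neighbourhood extensor for metric pairs, so there is an open
  \<open>W\<^sub>i \<supseteq> U\<^sub>i - U\<^sub>i\<^sub>-\<^sub>1\<close> on which \<open>p \<times> id\<close> is homotopic to a map into the diagonal. Thus the pullback along
  \<open>p \<times> id\<close> of a class in the kernel of \<open>\<Delta>\<^sup>*\<close> vanishes on \<open>W\<^sub>i\<close>, and the pullback of a product of
  \<open>n\<close> such classes vanishes. As \<open>p \<times> id\<close> is a finite covering, averaging over the lifts of a simplex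
  shows that the pullback is injective on rational cohomology, so the product itself vanishes.
  Hence \<open>TC(p)\<close> is at least the nilpotency index, which is \<open>TC(X)\<close> by assumption.\<close>


section \<open>The Leibniz rule for the cup product\<close>

text \<open>The sections live on sets that are only locally closed, whereas a product of classes is
  controlled by an open cover, because the subdivision of cycles needs open sets. Bridging this gap
  is the purpose of the ANR hypothesis. That hypothesis speaks only of spaces whose points are real
  functions on the point type of X, so the space into which X is embedded has to be built inside
  this type; separability makes a countable, hence metrizable, product of lines large enough.
  Cohomology is handled through its pairing with integral cycles. Over the field of rationals a
  cochain is a coboundary exactly when it vanishes on all cycles, so homotopy invariance and
  subdivision are quoted for singular homology. Relative groups are avoided as well: a class that
  vanishes on W is replaced by a representative that is literally zero on every simplex in W. The
  rationals enter a second time in the averaging, which divides by the number of lifts.\<close>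

lemma simplical_face_ident:
  assumes "x \<in> standard_simplex p" "p < k"
  shows "simplical_face k x = x"
  using assms by (auto simp: simplical_face_def standard_simplex_def fun_eq_iff)

text \<open>On the standard \<open>q\<close>-simplex this is the affine embedding onto the face of
  the standard \<open>(p + q)\<close>-simplex spanned by its last \<open>q + 1\<close>
  vertices.\<close>

definition simplex_shift :: "nat \<Rightarrow> (nat \<Rightarrow> real) \<Rightarrow> nat \<Rightarrow> real" where
  "simplex_shift p x = (\<lambda>i. if i < p then 0 else x (i - p))"

lemma simplex_shift_in_standard_simplex:
  assumes "x \<in> standard_simplex q"
  shows "simplex_shift p x \<in> standard_simplex (p + q)"
proof -
  have "(\<Sum>i\<le>p+q. simplex_shift p x i) = (\<Sum>i\<in>{p..p+q}. simplex_shift p x i)"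
    by (rule sum.mono_neutral_right) (auto simp: simplex_shift_def)
  also have "\<dots> = (\<Sum>i\<le>q. x i)"
    by (rule sum.reindex_bij_witness[of _ "\<lambda>i. i + p" "\<lambda>i. i - p"]) (auto simp: simplex_shift_def)
  finally show ?thesis
    using assms by (auto simp: standard_simplex_def simplex_shift_def)
qed

lemma continuous_map_simplex_shift:
  "continuous_map (subtopology (powertop_real UNIV) (standard_simplex q))
     (subtopology (powertop_real UNIV) (standard_simplex (p + q))) (simplex_shift p)"
proof (subst continuous_map_in_subtopology, intro conjI)
  show "continuous_map (subtopology (powertop_real UNIV) (standard_simplex q)) (powertop_real UNIV)
      (simplex_shift p)"
    unfolding continuous_map_componentwise_UNIV
  proof
    fix i
    show "continuous_map (subtopology (powertop_real UNIV) (standard_simplex q)) euclideanreal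
       (\<lambda>x. simplex_shift p x i)"
      unfolding simplex_shift_def
      by (cases "i < p")
        (auto intro!: continuous_map_from_subtopology continuous_map_product_projection)
  qed
  show "simplex_shift p \<in> topspace (subtopology (powertop_real UNIV) (standard_simplex q))
      \<rightarrow> standard_simplex (p + q)"
    by (auto simp: simplex_shift_in_standard_simplex)
qed

lemma back_face_eq:
  "back_face p q \<sigma> = restrict (\<lambda>x. \<sigma> (simplex_shift p x)) (standard_simplex q)"
  by (simp add: back_face_def simplex_shift_def)

lemma singular_simplex_front_face:
  assumes "singular_simplex n X \<sigma>" "p \<le> n"
  shows "singular_simplex p X (front_face p \<sigma>)"
  using assms standard_simplex_mono[OF assms(2)]
  by (auto simp: singular_simplex_def front_face_def intro: continuous_map_from_subtopology_mono)

lemma singular_simplex_back_face: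
  assumes "singular_simplex (p + q) X \<sigma>"
  shows "singular_simplex q X (back_face p q \<sigma>)"
proof -
  have "continuous_map (subtopology (powertop_real UNIV) (standard_simplex q)) X (\<sigma> \<circ> simplex_shift p)"
    using assms unfolding singular_simplex_def
    by (intro continuous_map_compose[OF continuous_map_simplex_shift]) auto
  then show ?thesis
    by (auto simp: singular_simplex_def back_face_eq o_def)
qed

text \<open>\<open>simplical_face k\<close> inserts a zero at position \<open>k\<close>. For
  \<open>k \<le> p\<close> this only lengthens the block of \<open>p\<close> leading zeros; the next
  lemma treats \<open>p \<le> k\<close>. The overlap \<open>k = p\<close> yields the zeroth face of
  a back face.\<close>

lemma simplical_face_shift_le:
  "k \<le> p \<Longrightarrow> simplical_face k (simplex_shift p x) = simplex_shift (Suc p) (x :: nat \<Rightarrow> real)"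
  by (auto simp: simplical_face_def simplex_shift_def fun_eq_iff)

lemma simplical_face_shift_ge:
  "p \<le> k \<Longrightarrow> simplical_face k (simplex_shift p x) = simplex_shift p (simplical_face (k - p) (x :: nat \<Rightarrow> real))"
  by (auto simp: simplical_face_def simplex_shift_def fun_eq_iff diff_right_commute)

lemma simplical_face_in_standard_simplex_Suc: "x \<in> standard_simplex n \<Longrightarrow> k \<le> Suc n \<Longrightarrow> simplical_face k x \<in> standard_simplex (Suc n)"
  using simplical_face_in_standard_simplex[of "Suc n" k x] by auto

lemma front_face_singular_face_le:
  assumes "k \<le> Suc p" "p \<le> n"
  shows "front_face p (singular_face (Suc n) k \<sigma>) = singular_face (Suc p) k (front_face (Suc p) \<sigma>)"
  using assms standard_simplex_mono[of p n]
  by (auto simp: front_face_def singular_face_def restrict_def fun_eq_iff simplical_face_in_standard_simplex_Suc)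

lemma front_face_singular_face_gt:
  assumes "p < k" "p \<le> n"
  shows "front_face p (singular_face (Suc n) k \<sigma>) = front_face p \<sigma>"
  using assms standard_simplex_mono[of p n]
  by (auto simp: front_face_def singular_face_def restrict_def fun_eq_iff simplical_face_ident)

text \<open>Together with \<open>singular_face_0_back_face\<close> this is the source of the
  cancellation in the Leibniz rule: dropping the last vertex of the front
  \<open>(p + 1)\<close>-face, or the first vertex of the back face starting at \<open>p\<close>,
  leads to the same pair of a front \<open>p\<close>-face and a back face starting at
  \<open>p + 1\<close>.\<close>

lemma singular_face_last_front_face:
  "singular_face (Suc p) (Suc p) (front_face (Suc p) \<sigma>) = front_face p \<sigma>"
  using standard_simplex_mono[of p "Suc p"]
  by (auto simp: front_face_def singular_face_def restrict_def fun_eq_iff simplical_face_ident)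

lemma back_face_singular_face_le:
  assumes "k \<le> p"
  shows "back_face p q (singular_face (Suc (p + q)) k \<sigma>) = back_face (Suc p) q \<sigma>"
  using assms
  by (auto simp: back_face_eq singular_face_def restrict_def fun_eq_iff simplical_face_shift_le
      simplex_shift_in_standard_simplex)

lemma back_face_singular_face_gt:
  assumes "p < k" "k \<le> Suc (p + q)"
  shows "back_face p q (singular_face (Suc (p + q)) k \<sigma>) = singular_face (Suc q) (k - p) (back_face p (Suc q) \<sigma>)"
  using assms
  by (auto simp: back_face_eq singular_face_def restrict_def fun_eq_iff simplical_face_shift_ge
      simplex_shift_in_standard_simplex simplical_face_in_standard_simplex_Suc)

lemma singular_face_0_back_face:
  "singular_face (Suc q) 0 (back_face p (Suc q) \<sigma>) = back_face (Suc p) q \<sigma>"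
proof -
  have eq: "simplex_shift p (simplical_face 0 x) = simplex_shift (Suc p) x" for x :: "nat \<Rightarrow> real"
    using simplical_face_shift_ge[of p p x] simplical_face_shift_le[of p p x] by simp
  show ?thesis
    by (auto simp: back_face_eq singular_face_def restrict_def fun_eq_iff simplical_face_in_standard_simplex_Suc eq)
qed

section \<open>Operations on inhomogeneous cochains and the coboundary\<close>

definition cochain_add :: "'a cochain \<Rightarrow> 'a cochain \<Rightarrow> 'a cochain" where
  "cochain_add u v = (\<lambda>n \<sigma>. u n \<sigma> + v n \<sigma>)"

definition cochain_uminus :: "'a cochain \<Rightarrow> 'a cochain" where
  "cochain_uminus u = (\<lambda>n \<sigma>. - u n \<sigma>)"

text \<open>The grading involution. Cochains are sums over several degrees, so the sign in the
  Leibniz rule cannot be a scalar factor and is carried by this operator.\<close>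

definition sign_twist :: "'a cochain \<Rightarrow> 'a cochain" where
  "sign_twist u = (\<lambda>n \<sigma>. (- 1) ^ n * u n \<sigma>)"

abbreviation cochain_zero :: "'a cochain" where
  "cochain_zero \<equiv> (\<lambda>n \<sigma>. 0)"

definition cochain_one :: "'a topology \<Rightarrow> 'a cochain" where
  "cochain_one X = (\<lambda>n \<sigma>. if n = 0 \<and> singular_simplex 0 X \<sigma> then 1 else 0)"

lemma coboundary_Suc:
  "singular_simplex (Suc n) X \<sigma> \<Longrightarrow>
     coboundary X u (Suc n) \<sigma> = (\<Sum>k\<le>Suc n. (-1) ^ k * u n (singular_face (Suc n) k \<sigma>))"
  by (simp add: coboundary_def)

lemma coboundary_eq_0: "n = 0 \<or> \<not> singular_simplex n X \<sigma> \<Longrightarrow> coboundary X u n \<sigma> = 0"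
  by (auto simp: coboundary_def)

lemma coboundary_add:
  "coboundary X (cochain_add u v) = cochain_add (coboundary X u) (coboundary X v)"
  by (auto simp: coboundary_def cochain_add_def fun_eq_iff distrib_left sum.distrib)

lemma coboundary_uminus: "coboundary X (cochain_uminus u) = cochain_uminus (coboundary X u)"
  by (auto simp: coboundary_def cochain_uminus_def fun_eq_iff sum_negf)

lemma coboundary_sign_twist:
  "coboundary X (sign_twist u) = cochain_uminus (sign_twist (coboundary X u))"
proof (intro ext)
  fix n \<sigma>
  show "coboundary X (sign_twist u) n \<sigma> = cochain_uminus (sign_twist (coboundary X u)) n \<sigma>"
    by (cases n) (auto simp: coboundary_def cochain_uminus_def sign_twist_def sum_distrib_left
        mult_ac sum_negf[symmetric] simp del: sum.atMost_Suc intro!: sum.cong)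
qed

lemma cup_add_left: "cup X (cochain_add u u') v = cochain_add (cup X u v) (cup X u' v)"
  by (auto simp: cup_def cochain_add_def fun_eq_iff distrib_right sum.distrib)

lemma cup_add_right: "cup X u (cochain_add v v') = cochain_add (cup X u v) (cup X u v')"
  by (auto simp: cup_def cochain_add_def fun_eq_iff distrib_left sum.distrib)

text \<open>For a fixed splitting degree \<open>p\<close>, a face map of index
  \<open>k \<le> p\<close> acts on the front part of the simplex and one of index
  \<open>k > p\<close> on the back part. The sum over all faces therefore splits into the two
  products on the right, up to two missing end terms that cancel.\<close>

theorem coboundary_cup:
  "coboundary X (cup X u v) =
     cochain_add (cup X (coboundary X u) v) (cup X (sign_twist u) (coboundary X v))"
proof (intro ext)
  fix m \<sigma>
  show "coboundary X (cup X u v) m \<sigma> =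
     cochain_add (cup X (coboundary X u) v) (cup X (sign_twist u) (coboundary X v)) m \<sigma>"
  proof (cases "m = 0 \<or> \<not> singular_simplex m X \<sigma>")
    case True
    then show ?thesis
      by (auto simp: coboundary_eq_0 cochain_add_def cup_def)
  next
    case False
    then obtain n where m: "m = Suc n" and s: "singular_simplex (Suc n) X \<sigma>"
      by (cases m) auto
    \<comment> \<open>\<open>U p k\<close> and \<open>V p j\<close> are the terms of the two
      products on the right. The faces of \<open>\<sigma>\<close> produce \<open>k \<le> p\<close>
      and \<open>j \<ge> 1\<close> only; the missing terms \<open>k = Suc p\<close> and
      \<open>j = 0\<close> both equal \<open>C p\<close> up to sign, and the signs are
      opposite.\<close>
    define U where "U = (\<lambda>p k. u p (singular_face (Suc p) k (front_face (Suc p) \<sigma>))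
        * v (n - p) (back_face (Suc p) (n - p) \<sigma>))"
    define V where "V = (\<lambda>p j. u p (front_face p \<sigma>)
        * v (n - p) (singular_face (Suc (n - p)) j (back_face p (Suc (n - p)) \<sigma>)))"
    define C where "C = (\<lambda>p. (-1)^p * (u p (front_face p \<sigma>) * v (n - p) (back_face (Suc p) (n - p) \<sigma>)))"
    have face: "singular_simplex n X (singular_face (Suc n) k \<sigma>)" if "k \<le> Suc n" for k
      using singular_simplex_singular_face[OF s, of k] that by simp
    have UC: "(-1) ^ Suc p * U p (Suc p) = - C p" for p
      by (simp add: U_def C_def singular_face_last_front_face)
    have VC: "V p 0 * (-1)^p = C p" for p
      by (simp add: V_def C_def singular_face_0_back_face mult_ac)
    have key: "(\<Sum>k\<le>Suc n. (-1) ^ k * (u p (front_face p (singular_face (Suc n) k \<sigma>)) *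
          v (n - p) (back_face p (n - p) (singular_face (Suc n) k \<sigma>))))
        = (\<Sum>k\<le>Suc p. (-1)^k * U p k) + (-1)^p * (\<Sum>j\<le>Suc (n - p). (-1)^j * V p j)"
      (is "?L = ?R") if p: "p \<le> n" for p
    proof -
      have n: "Suc n = Suc (p + (n - p))" using p by simp
      have "?L = (\<Sum>k\<in>{..p}. (-1) ^ k * U p k) + (\<Sum>k\<in>{Suc p..Suc n}. (-1)^k * V p (k - p))"
      proof -
        have un: "{..Suc n} = {..p} \<union> {Suc p..Suc n}" using p by auto
        have 1: "u p (front_face p (singular_face (Suc n) k \<sigma>)) *
          v (n - p) (back_face p (n - p) (singular_face (Suc n) k \<sigma>)) = U p k" if "k \<le> p" for k
          using that p front_face_singular_face_le[of k p n \<sigma>] back_face_singular_face_le[of k p "n - p" \<sigma>]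
          by (simp add: U_def)
        have 2: "u p (front_face p (singular_face (Suc n) k \<sigma>)) *
          v (n - p) (back_face p (n - p) (singular_face (Suc n) k \<sigma>)) = V p (k - p)"
          if "Suc p \<le> k" "k \<le> Suc n" for k
          using that p front_face_singular_face_gt[of p k n \<sigma>] back_face_singular_face_gt[of p k "n - p" \<sigma>]
          by (simp add: V_def)
        show ?thesis
          unfolding un by (subst sum.union_disjoint) (auto simp: 1 2)
      qed
      also have "(\<Sum>k\<in>{Suc p..Suc n}. (-1)^k * V p (k - p)) = (\<Sum>j\<in>{1..Suc (n - p)}. (-1)^(j + p) * V p j)"
        by (rule sum.reindex_bij_witness[of _ "\<lambda>j. j + p" "\<lambda>k. k - p"]) (use p in auto)
      also have "\<dots> = (-1)^p * (\<Sum>j\<in>{1..Suc (n - p)}. (-1)^j * V p j)"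
        unfolding sum_distrib_left by (rule sum.cong) (simp_all add: power_add)
      also have "(\<Sum>j\<in>{1..Suc (n - p)}. (-1)^j * V p j) = (\<Sum>j\<le>Suc (n - p). (-1)^j * V p j) - V p 0"
        by (simp add: atMost_atLeast0 sum.atLeast_Suc_atMost[of 0])
      also have "(\<Sum>k\<in>{..p}. (-1) ^ k * U p k) = (\<Sum>k\<le>Suc p. (-1)^k * U p k) - (-1)^Suc p * U p (Suc p)"
        by simp
      finally show ?thesis
        unfolding UC using VC[of p] by (simp add: algebra_simps)
    qed
    have "coboundary X (cup X u v) m \<sigma> = (\<Sum>k\<le>Suc n. \<Sum>p\<le>n. (-1) ^ k *
       (u p (front_face p (singular_face (Suc n) k \<sigma>)) * v (n - p) (back_face p (n - p) (singular_face (Suc n) k \<sigma>))))"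
      unfolding m coboundary_Suc[OF s]
      by (rule sum.cong) (simp_all add: cup_def face sum_distrib_left)
    also have "\<dots> = (\<Sum>p\<le>n. (\<Sum>k\<le>Suc p. (-1)^k * U p k) + (-1)^p * (\<Sum>j\<le>Suc (n - p). (-1)^j * V p j))"
            by (subst sum.swap, rule sum.cong[OF refl], simp only: key atMost_iff)
    also have "\<dots> = (\<Sum>p\<le>n. (\<Sum>k\<le>Suc p. (-1)^k * U p k)) + (\<Sum>p\<le>n. (-1)^p * (\<Sum>j\<le>Suc (n - p). (-1)^j * V p j))"
      by (simp only: sum.distrib)
    also have "(\<Sum>p\<le>n. (\<Sum>k\<le>Suc p. (-1)^k * U p k)) = cup X (coboundary X u) v m \<sigma>"
    proof -
      have "cup X (coboundary X u) v m \<sigma> = (\<Sum>p\<le>Suc n. coboundary X u p (front_face p \<sigma>) *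
          v (Suc n - p) (back_face p (Suc n - p) \<sigma>))"
        using s by (simp add: cup_def m)
      also have "\<dots> = (\<Sum>p\<le>n. coboundary X u (Suc p) (front_face (Suc p) \<sigma>) *
          v (n - p) (back_face (Suc p) (n - p) \<sigma>))"
        by (subst sum.atMost_Suc_shift) (simp add: coboundary_eq_0)
      also have "\<dots> = (\<Sum>p\<le>n. (\<Sum>k\<le>Suc p. (-1)^k * U p k))"
      proof (rule sum.cong)
        fix p assume "p \<in> {..n}"
        then have s': "singular_simplex (Suc p) X (front_face (Suc p) \<sigma>)"
          by (intro singular_simplex_front_face[OF s]) auto
        show "coboundary X u (Suc p) (front_face (Suc p) \<sigma>) * v (n - p) (back_face (Suc p) (n - p) \<sigma>)
           = (\<Sum>k\<le>Suc p. (-1)^k * U p k)"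
          unfolding coboundary_Suc[OF s'] U_def sum_distrib_right by (simp only: mult.assoc)
      qed simp
      finally show ?thesis by simp
    qed
    also have "(\<Sum>p\<le>n. (-1)^p * (\<Sum>j\<le>Suc (n - p). (-1)^j * V p j)) = cup X (sign_twist u) (coboundary X v) m \<sigma>"
    proof -
      have "cup X (sign_twist u) (coboundary X v) m \<sigma> = (\<Sum>p\<le>Suc n. (-1)^p * u p (front_face p \<sigma>) *
          coboundary X v (Suc n - p) (back_face p (Suc n - p) \<sigma>))"
        using s by (simp add: cup_def m sign_twist_def)
      also have "\<dots> = (\<Sum>p\<le>n. (-1)^p * u p (front_face p \<sigma>) *
          coboundary X v (Suc n - p) (back_face p (Suc n - p) \<sigma>))"
        by (simp add: coboundary_eq_0)
      also have "\<dots> = (\<Sum>p\<le>n. (-1)^p * (\<Sum>j\<le>Suc (n - p). (-1)^j * V p j))"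
      proof (rule sum.cong)
        fix p assume p: "p \<in> {..n}"
        then have s': "singular_simplex (Suc (n - p)) X (back_face p (Suc (n - p)) \<sigma>)"
          using s by (intro singular_simplex_back_face) auto
        have e: "Suc n - p = Suc (n - p)" using p by auto
        show "(-1)^p * u p (front_face p \<sigma>) * coboundary X v (Suc n - p) (back_face p (Suc n - p) \<sigma>)
           = (-1)^p * (\<Sum>j\<le>Suc (n - p). (-1)^j * V p j)"
          unfolding e coboundary_Suc[OF s'] V_def sum_distrib_left by (simp only: mult_ac)
      qed simp
      finally show ?thesis by simp
    qed
    finally show ?thesis
      by (simp add: cochain_add_def)
  qed
qed


section \<open>Duality between cohomology and cycles\<close>

text \<open>The Kronecker pairing of rational cochains with integral chains.\<close>

definition cochain_eval :: "'a cochain \<Rightarrow> nat \<Rightarrow> 'a chain \<Rightarrow> rat" where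
  "cochain_eval u n c = (\<Sum>\<sigma>\<in>Poly_Mapping.keys c. of_int (Poly_Mapping.lookup c \<sigma>) * u n \<sigma>)"

lemma cochain_eval_superset:
  assumes "finite A" "Poly_Mapping.keys c \<subseteq> A"
  shows "cochain_eval u n c = (\<Sum>\<sigma>\<in>A. of_int (Poly_Mapping.lookup c \<sigma>) * u n \<sigma>)"
  unfolding cochain_eval_def
  by (rule sum.mono_neutral_left) (use assms in \<open>auto simp: in_keys_iff\<close>)

lemma cochain_eval_0 [simp]: "cochain_eval u n 0 = 0"
  by (simp add: cochain_eval_def)

lemma cochain_eval_of [simp]: "cochain_eval u n (frag_of \<sigma>) = u n \<sigma>"
  by (simp add: cochain_eval_def)

lemma cochain_eval_diff:
  "cochain_eval u n (a - b) = cochain_eval u n a - cochain_eval u n b"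
proof -
  let ?K = "Poly_Mapping.keys a \<union> Poly_Mapping.keys b"
  have "Poly_Mapping.keys (a - b) \<subseteq> ?K"
    by (rule keys_diff)
  then show ?thesis
    by (simp add: cochain_eval_superset[of ?K] lookup_minus left_diff_distrib sum_subtractf)
qed

lemma cochain_eval_add:
  "cochain_eval u n (a + b) = cochain_eval u n a + cochain_eval u n b"
  using cochain_eval_diff[of u n a "0 - b"] cochain_eval_diff[of u n 0 b] by simp

lemma cochain_eval_cmul:
  "cochain_eval u n (frag_cmul k a) = of_int k * cochain_eval u n a"
proof -
  have "Poly_Mapping.keys (frag_cmul k a) \<subseteq> Poly_Mapping.keys a"
    by (rule keys_cmul)
  then show ?thesis
    by (simp add: cochain_eval_superset[of "Poly_Mapping.keys a"] sum_distrib_left mult_ac)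
qed

lemma cochain_eval_sum:
  "cochain_eval u n (\<Sum>i\<in>I. c i) = (\<Sum>i\<in>I. cochain_eval u n (c i))"
  by (induction I rule: infinite_finite_induct) (auto simp: cochain_eval_add)

lemma cochain_eval_coboundary:
  assumes "singular_chain (Suc n) X c"
  shows "cochain_eval (coboundary X u) (Suc n) c = cochain_eval u n (chain_boundary (Suc n) c)"
  using assms unfolding singular_chain_def
proof (induction c rule: frag_induction)
  case (one \<sigma>)
  then show ?case
    by (simp add: coboundary_Suc chain_boundary_of cochain_eval_sum cochain_eval_cmul
        del: sum.atMost_Suc)
qed (auto simp: chain_boundary_diff cochain_eval_diff)

lemma cochain_eval_pullback:
  assumes "singular_chain n X c"
  shows "cochain_eval (pullback X f u) n c = cochain_eval u n (chain_map n f c)"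
  using assms unfolding singular_chain_def
  by (induction c rule: frag_induction)
    (auto simp: pullback_def chain_map_diff cochain_eval_diff)

text \<open>Pairing with a single simplex moves both coboundaries to the chain side, where the
  boundary of a boundary is zero.\<close>

lemma coboundary_coboundary: "coboundary X (coboundary X u) = cochain_zero"
proof (intro ext)
  fix n \<sigma>
  show "coboundary X (coboundary X u) n \<sigma> = 0"
  proof (cases "\<exists>m. n = Suc (Suc m) \<and> singular_simplex n X \<sigma>")
    case True
    then obtain m where n: "n = Suc (Suc m)" and s: "singular_chain (Suc (Suc m)) X (frag_of \<sigma>)"
      by (auto simp: singular_chain_of)
    have "coboundary X (coboundary X u) n \<sigma>
        = cochain_eval (coboundary X (coboundary X u)) (Suc (Suc m)) (frag_of \<sigma>)"
      by (simp add: n)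
    also have "\<dots> = cochain_eval u m (chain_boundary (Suc m) (chain_boundary (Suc (Suc m)) (frag_of \<sigma>)))"
      using singular_chain_boundary[OF s] cochain_eval_coboundary[OF s, of "coboundary X u"]
        cochain_eval_coboundary[of m X "chain_boundary (Suc (Suc m)) (frag_of \<sigma>)" u]
      by (simp only: diff_Suc_Suc diff_zero diff_Suc_1)
    also have "\<dots> = 0"
      using chain_boundary_boundary_alt[OF s] by simp
    finally show ?thesis .
  next
    case False
    then show ?thesis
      by (cases n; cases "n - 1") (auto simp: coboundary_eq_0 coboundary_def)
  qed
qed

text \<open>With the empty subspace, relative cycles are absolute ones. Integral cycles suffice for
  rational cochains, because a rational cycle has an integral multiple.\<close>

definition vanishes_on_cycles :: "'a topology \<Rightarrow> 'a cochain \<Rightarrow> bool" where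
  "vanishes_on_cycles X u \<longleftrightarrow>
     (\<forall>n c. singular_relcycle n X {} c \<longrightarrow> cochain_eval u n c = 0)"

lemma vanishes_on_cycles_coboundary: "vanishes_on_cycles X (coboundary X v)"
  unfolding vanishes_on_cycles_def
proof (intro allI impI)
  fix n c assume c: "singular_relcycle n X {} c"
  show "cochain_eval (coboundary X v) n c = 0"
  proof (cases n)
    case 0
    then show ?thesis by (simp add: cochain_eval_def coboundary_eq_0)
  next
    case (Suc m)
    with c show ?thesis
      by (simp add: singular_cycle cochain_eval_coboundary)
  qed
qed

lemma cochain_eval_homologous:
  assumes "coboundary X u = cochain_zero" "homologous_rel n X {} c d"
  shows "cochain_eval u n c = cochain_eval u n d"
proof -
  obtain e where e: "singular_chain (Suc n) X e" "chain_boundary (Suc n) e = c - d"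
    using assms(2) by (auto simp: homologous_rel_def singular_boundary)
  have "cochain_eval u n (c - d) = 0"
    unfolding e(2)[symmetric] cochain_eval_coboundary[OF e(1), symmetric] assms(1)
    by (simp add: cochain_eval_def)
  then show ?thesis by (simp add: cochain_eval_diff)
qed

text \<open>Turns a rational linear relation between boundaries into an integral cycle, on which a
  cochain can be evaluated.\<close>

lemma clear_denominators:
  assumes "finite J"
  shows "\<exists>N m. N > 0 \<and> (\<forall>i\<in>J. of_int N * c i = (of_int (m i) :: rat))"
  using assms
proof induction
  case (insert j J)
  then obtain N m where N: "N > 0" "\<forall>i\<in>J. of_int N * c i = (of_int (m i) :: rat)"
    by blast
  obtain a d where ad: "quotient_of (c j) = (a, d)" by fastforce
  then have d: "d > 0" "c j = of_int a / of_int d"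
    using quotient_of_denom_pos quotient_of_div by blast+
  show ?case
  proof (intro exI conjI ballI)
    show "d * N > 0" using d N by simp
    fix i assume i: "i \<in> insert j J"
    show "of_int (d * N) * c i = of_int (if i = j then N * a else d * m i)"
      using i N(2) d by (auto simp: mult.assoc)
  qed
qed (auto intro: exI[of _ 1])

text \<open>Prescribed values on a family of vectors extend to a linear functional as soon as they
  respect every finite linear relation of the family. A basis of the span is chosen among the
  \<open>b i\<close>; the values at the remaining \<open>b i\<close> are then forced by the
  relations, which also covers a family with repetitions.\<close>

lemma rat_functional_exists:
  fixes b :: "'i \<Rightarrow> 's \<Rightarrow> rat" and r :: "'i \<Rightarrow> rat"
  assumes rel: "\<And>J c. finite J \<Longrightarrow> J \<subseteq> I \<Longrightarrow> (\<forall>\<tau>. (\<Sum>i\<in>J. c i * b i \<tau>) = 0) \<Longrightarrow> (\<Sum>i\<in>J. c i * r i) = 0"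
  obtains T where "\<And>f g. T (\<lambda>\<tau>. f \<tau> + g \<tau>) = T f + T g" "\<And>a f. T (\<lambda>\<tau>. a * f \<tau>) = a * T f"
    "\<And>i. i \<in> I \<Longrightarrow> T (b i) = r i"
proof -
  let ?s = "\<lambda>(a::rat) (f::'s \<Rightarrow> rat) \<tau>. a * f \<tau>"
  interpret vector_space_pair ?s "(*) :: rat \<Rightarrow> rat \<Rightarrow> rat"
    by unfold_locales (auto simp: fun_eq_iff algebra_simps)
  obtain B where B: "B \<subseteq> b ` I" "vs1.independent B" "b ` I \<subseteq> vs1.span B"
    using vs1.maximal_independent_subset by blast
  have "\<forall>x\<in>B. \<exists>i. i \<in> I \<and> b i = x" using B(1) by auto
  then obtain h where h: "\<And>x. x \<in> B \<Longrightarrow> h x \<in> I" "\<And>x. x \<in> B \<Longrightarrow> b (h x) = x"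
    by metis
  obtain T where T: "Vector_Spaces.linear ?s (*) T" "\<And>x. x \<in> B \<Longrightarrow> T x = r (h x)"
    using linear_independent_extend[OF B(2), of "\<lambda>x. r (h x)"] by blast
  interpret T: Vector_Spaces.linear ?s "(*)" T by (rule T(1))
  have "T (b i) = r i" if i: "i \<in> I" for i
  proof -
    have "b i \<in> vs1.span B" using B(3) i by auto
    then obtain t q where t: "finite t" "t \<subseteq> B" "b i = (\<Sum>x\<in>t. ?s (q x) x)"
      unfolding vs1.span_explicit by auto
    have inj: "inj_on h t"
      using h(2) t(2) by (metis inj_onI subsetD)
    have Tbi: "T (b i) = (\<Sum>x\<in>t. q x * r (h x))"
      unfolding t(3) T.sum T.scale using T(2) t(2) by (intro sum.cong) auto
    show ?thesis
    proof (cases "i \<in> h ` t")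
      case True
      then show ?thesis using T(2) h(2) t(2) by auto
    next
      case False
      \<comment> \<open>The relation expresses \<open>b i\<close> through the basis vectors in
        \<open>t\<close>, with coefficient \<open>-1\<close> at \<open>i\<close>. If
        \<open>i\<close> were one of the chosen indices \<open>h x\<close>, it would need two
        coefficients at once; that case was settled separately.\<close>
      define c where "c = (\<lambda>j. if j = i then -1 else q (b j))"
      have ev: "b i \<tau> = (\<Sum>x\<in>t. q x * x \<tau>)" for \<tau>
      proof -
        have "(\<Sum>x\<in>t. ?s (q x) x) \<tau> = (\<Sum>x\<in>t. q x * x \<tau>)"
          using t(1) by induction (simp_all add: zero_fun_def plus_fun_def)
        then show ?thesis using t(3) by simp
      qed
      have sums: "(\<Sum>j\<in>insert i (h ` t). c j * F j) = - F i + (\<Sum>x\<in>t. q x * F (h x))" for F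
      proof -
        have "(\<Sum>j\<in>h ` t. c j * F j) = (\<Sum>x\<in>t. c (h x) * F (h x))"
          by (simp add: sum.reindex[OF inj])
        also have "\<dots> = (\<Sum>x\<in>t. q x * F (h x))"
          using False h(2) t(2) by (intro sum.cong) (auto simp: c_def)
        finally show ?thesis
          using False t(1) by (simp add: c_def)
      qed
      have "(\<Sum>j\<in>insert i (h ` t). c j * r j) = 0"
      proof (rule rel)
        show "\<forall>\<tau>. (\<Sum>j\<in>insert i (h ` t). c j * b j \<tau>) = 0"
        proof
          fix \<tau>
          have "(\<Sum>x\<in>t. q x * b (h x) \<tau>) = (\<Sum>x\<in>t. q x * x \<tau>)"
            using h(2) t(2) by (intro sum.cong) auto
          then show "(\<Sum>j\<in>insert i (h ` t). c j * b j \<tau>) = 0"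
            unfolding sums[of "\<lambda>j. b j \<tau>"] ev by simp
        qed
      qed (use t h i in auto)
      then show ?thesis
        unfolding sums Tbi by simp
    qed
  qed
  moreover have "T (\<lambda>\<tau>. f \<tau> + g \<tau>) = T f + T g" for f g
    using T.add[of f g] by (simp add: plus_fun_def)
  moreover have "T (\<lambda>\<tau>. a * f \<tau>) = a * T f" for a f
    using T.scale[of a f] by simp
  ultimately show ?thesis using that by blast
qed

text \<open>Sending the boundary of a chain to the value of \<open>u\<close> on that chain is well
  defined on boundaries, because \<open>u\<close> vanishes on cycles. Linear algebra over the
  rationals extends this functional beyond the boundaries, and its values on single simplices form
  the primitive.\<close>

lemma cochain_primitive_in_degree:
  fixes u :: "'a cochain"
  assumes u: "vanishes_on_cycles X u"
  obtains w where "\<And>\<sigma>. singular_simplex (Suc n) X \<sigma> \<Longrightarrow>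
     u (Suc n) \<sigma> = (\<Sum>k\<le>Suc n. (-1) ^ k * w (singular_face (Suc n) k \<sigma>))"
proof -
  define b where "b = (\<lambda>(\<sigma> :: (nat \<Rightarrow> real) \<Rightarrow> 'a) \<tau>. rat_of_int (Poly_Mapping.lookup (chain_boundary (Suc n) (frag_of \<sigma>)) \<tau>))"
  have "\<exists>T. (\<forall>f g. T (\<lambda>\<tau>. f \<tau> + g \<tau>) = T f + T g) \<and> (\<forall>a f. T (\<lambda>\<tau>. a * f \<tau>) = a * T f) \<and>
    (\<forall>\<sigma>\<in>Collect (singular_simplex (Suc n) X). T (b \<sigma>) = u (Suc n) \<sigma>)"
  proof (rule rat_functional_exists[of "Collect (singular_simplex (Suc n) X)" b "u (Suc n)"])
    fix J :: "((nat \<Rightarrow> real) \<Rightarrow> 'a) set" and c :: "_ \<Rightarrow> rat"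
    assume J: "finite J" "J \<subseteq> Collect (singular_simplex (Suc n) X)"
      and c: "\<forall>\<tau>. (\<Sum>i\<in>J. c i * b i \<tau>) = 0"
    obtain N m where N: "N > 0" "\<forall>i\<in>J. of_int N * c i = of_int (m i)"
      using clear_denominators[OF J(1)] by blast
    \<comment> \<open>The relation multiplied by the common denominator \<open>N\<close>, read as an
      integral chain; the relation says exactly that its boundary is zero.\<close>
    define z where "z = (\<Sum>\<sigma>\<in>J. frag_cmul (m \<sigma>) (frag_of \<sigma>))"
    have "singular_chain (Suc n) X z"
      unfolding z_def using J(2)
      by (intro singular_chain_sum singular_chain_cmul) (auto simp: singular_chain_of)
    moreover have "chain_boundary (Suc n) z = 0"
    proof (rule poly_mapping_eqI)
      fix \<tau>
      have "rat_of_int (Poly_Mapping.lookup (chain_boundary (Suc n) z) \<tau>) = (\<Sum>\<sigma>\<in>J. of_int (m \<sigma>) * b \<sigma> \<tau>)"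
        unfolding z_def chain_boundary_sum using J(1)
        by (simp add: lookup_sum chain_boundary_cmul b_def)
      also have "\<dots> = (\<Sum>\<sigma>\<in>J. of_int N * (c \<sigma> * b \<sigma> \<tau>))"
        using N(2) by (intro sum.cong) (simp_all flip: mult.assoc)
      also have "\<dots> = 0"
        using c by (simp flip: sum_distrib_left)
      finally show "Poly_Mapping.lookup (chain_boundary (Suc n) z) \<tau> = Poly_Mapping.lookup 0 \<tau>"
        by simp
    qed
    ultimately have "cochain_eval u (Suc n) z = 0"
      using u unfolding vanishes_on_cycles_def by (simp add: singular_cycle)
    then have "(\<Sum>\<sigma>\<in>J. of_int (m \<sigma>) * u (Suc n) \<sigma>) = 0"
      by (simp add: z_def cochain_eval_sum cochain_eval_cmul)
    moreover have "(\<Sum>\<sigma>\<in>J. of_int (m \<sigma>) * u (Suc n) \<sigma>) = of_int N * (\<Sum>\<sigma>\<in>J. c \<sigma> * u (Suc n) \<sigma>)"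
      unfolding sum_distrib_left
      using N(2) by (intro sum.cong) (simp_all flip: mult.assoc)
    ultimately show "(\<Sum>\<sigma>\<in>J. c \<sigma> * u (Suc n) \<sigma>) = 0"
      using N(1) by simp
  qed blast
  then obtain T where T: "\<And>f g. T (\<lambda>\<tau>. f \<tau> + g \<tau>) = T f + T g" "\<And>a f. T (\<lambda>\<tau>. a * f \<tau>) = a * T f"
    "\<And>\<sigma>. singular_simplex (Suc n) X \<sigma> \<Longrightarrow> T (b \<sigma>) = u (Suc n) \<sigma>"
    by blast
  have T_sum: "T (\<lambda>\<tau>. \<Sum>k\<in>K. a k * f k \<tau>) = (\<Sum>k\<in>K. a k * T (f k))" if "finite K" for K :: "nat set" and a f
    using that
  proof induction
    case empty
    then show ?case using T(2)[of 0 "\<lambda>_. 0"] by simp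
  qed (simp add: T(1,2))
  \<comment> \<open>The witness for \<open>w\<close> is fixed by the last line of this block:
    \<open>T\<close> applied to the indicator function of a simplex. Expanding
    \<open>b \<sigma>\<close> in indicator functions gives the alternating sum.\<close>
  show ?thesis
  proof
    fix \<sigma> assume s: "singular_simplex (Suc n) X \<sigma>"
    have "b \<sigma> = (\<lambda>\<tau>. \<Sum>k\<le>Suc n. (-1) ^ k * (if singular_face (Suc n) k \<sigma> = \<tau> then 1 else 0))"
      unfolding b_def chain_boundary_of by (auto simp: lookup_sum lookup_single when_def fun_eq_iff of_int_sum
          simp del: sum.atMost_Suc intro!: sum.cong)
    then show "u (Suc n) \<sigma> = (\<Sum>k\<le>Suc n. (-1) ^ k *
        (\<lambda>\<tau>'. T (\<lambda>\<tau>. if \<tau>' = \<tau> then 1 else 0)) (singular_face (Suc n) k \<sigma>))"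
      using T(3)[OF s] by (simp only: T_sum finite_atMost)
  qed
qed


text \<open>The universal coefficient theorem over the rationals, where no Ext term occurs: the
  primitives of the single degrees are assembled into one cochain.\<close>

theorem coboundaries_iff_vanishes_on_cycles:
  assumes "u \<in> cochains X"
  shows "u \<in> coboundaries X \<longleftrightarrow> vanishes_on_cycles X u"
proof
  assume "u \<in> coboundaries X"
  then show "vanishes_on_cycles X u"
    by (auto simp: coboundaries_def vanishes_on_cycles_coboundary)
next
  assume u: "vanishes_on_cycles X u"
  have "\<forall>n. \<exists>w. \<forall>\<sigma>. singular_simplex (Suc n) X \<sigma> \<longrightarrow>
     u (Suc n) \<sigma> = (\<Sum>k\<le>Suc n. (-1) ^ k * w (singular_face (Suc n) k \<sigma>))"
    using cochain_primitive_in_degree[OF u] by metis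
  then obtain w where w: "\<And>n \<sigma>. singular_simplex (Suc n) X \<sigma> \<Longrightarrow>
     u (Suc n) \<sigma> = (\<Sum>k\<le>Suc n. (-1) ^ k * w n (singular_face (Suc n) k \<sigma>))"
    by metis
  \<comment> \<open>Primitives are used only below degrees in which \<open>u\<close> is nonzero;
    otherwise \<open>v\<close> might have infinitely many nonzero degrees and fail to be a
    cochain.\<close>
  define v where "v = (\<lambda>n \<sigma>. if singular_simplex n X \<sigma> \<and> (\<exists>\<tau>. u (Suc n) \<tau> \<noteq> 0) then w n \<sigma> else 0)"
  have fin: "finite {n. \<exists>\<sigma>. u n \<sigma> \<noteq> 0}" and u0: "\<And>n \<sigma>. \<not> singular_simplex n X \<sigma> \<Longrightarrow> u n \<sigma> = 0"
    using assms by (auto simp: cochains_def)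
  have "finite (Suc -` {n. \<exists>\<sigma>. u n \<sigma> \<noteq> 0})"
    by (rule finite_vimageI[OF fin]) simp
  then have "finite {n. \<exists>\<sigma>. v n \<sigma> \<noteq> 0}"
    by (rule rev_finite_subset) (auto simp: v_def)
  then have v: "v \<in> cochains X"
    by (auto simp: cochains_def v_def)
  have "coboundary X v = u"
  proof (intro ext)
    fix n \<sigma>
    show "coboundary X v n \<sigma> = u n \<sigma>"
    proof (cases "singular_simplex n X \<sigma>")
      case False
      then show ?thesis by (simp add: coboundary_eq_0 u0)
    next
      case s: True
      show ?thesis
      proof (cases n)
        case 0
        \<comment> \<open>Every 0-simplex is a cycle, so \<open>u\<close> has no part in degree 0,
          in accordance with the value 0 of a coboundary there.\<close>
        then have "singular_relcycle n X {} (frag_of \<sigma>)"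
          using s by (simp add: singular_cycle singular_chain_of chain_boundary_def)
        then have "u n \<sigma> = 0"
          using u unfolding vanishes_on_cycles_def by fastforce
        then show ?thesis using 0 by (simp add: coboundary_eq_0)
      next
        case (Suc m)
        then have s': "singular_simplex (Suc m) X \<sigma>" using s by simp
        show ?thesis
        proof (cases "\<exists>\<tau>. u (Suc m) \<tau> \<noteq> 0")
          case True
          have "singular_simplex m X (singular_face (Suc m) k \<sigma>)" if "k \<le> Suc m" for k
            using singular_simplex_singular_face[OF s', of k] that by simp
          then show ?thesis
            unfolding Suc coboundary_Suc[OF s'] w[OF s'] using True
            by (intro sum.cong) (auto simp: v_def)
        next
          case False
          then show ?thesis
            unfolding Suc coboundary_Suc[OF s'] by (simp add: v_def)
        qed
      qed
    qed
  qed
  with v show "u \<in> coboundaries X"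
    by (auto simp: coboundaries_def)
qed


section \<open>Products of classes vanishing on open sets\<close>

lemma coboundary_in_cochains:
  assumes "u \<in> cochains X"
  shows "coboundary X u \<in> cochains X"
proof -
  have "{n. \<exists>\<sigma>. coboundary X u n \<sigma> \<noteq> 0} \<subseteq> Suc ` {n. \<exists>\<sigma>. u n \<sigma> \<noteq> 0}"
  proof clarify
    fix n \<sigma> assume ne: "coboundary X u n \<sigma> \<noteq> 0"
    then obtain m where n: "n = Suc m" "singular_simplex (Suc m) X \<sigma>"
      by (cases n) (auto simp: coboundary_def split: if_splits)
    have "\<exists>\<sigma>. u m \<sigma> \<noteq> 0"
    proof (rule ccontr)
      assume "\<nexists>\<sigma>. u m \<sigma> \<noteq> 0"
      then show False
        using ne unfolding n(1) coboundary_Suc[OF n(2)] by simp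
    qed
    then show "n \<in> Suc ` {n. \<exists>\<sigma>. u n \<sigma> \<noteq> 0}" using n by auto
  qed
  then have "finite {n. \<exists>\<sigma>. coboundary X u n \<sigma> \<noteq> 0}"
    by (rule finite_subset) (use assms in \<open>auto simp: cochains_def\<close>)
  then show ?thesis
    by (auto simp: cochains_def coboundary_eq_0)
qed

lemma cochain_add_in_cochains:
  assumes "u \<in> cochains X" "v \<in> cochains X"
  shows "cochain_add u v \<in> cochains X"
proof -
  have "finite ({n. \<exists>\<sigma>. u n \<sigma> \<noteq> 0} \<union> {n. \<exists>\<sigma>. v n \<sigma> \<noteq> 0})"
    using assms by (auto simp: cochains_def)
  then have "finite {n. \<exists>\<sigma>. cochain_add u v n \<sigma> \<noteq> 0}"
    by (rule rev_finite_subset) (auto simp: cochain_add_def)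
  then show ?thesis
    using assms by (auto simp: cochains_def cochain_add_def)
qed

lemma cochain_uminus_in_cochains: "u \<in> cochains X \<Longrightarrow> cochain_uminus u \<in> cochains X"
  by (auto simp: cochains_def cochain_uminus_def)

lemma sign_twist_in_cochains: "u \<in> cochains X \<Longrightarrow> sign_twist u \<in> cochains X"
  by (auto simp: cochains_def sign_twist_def)

lemma cup_in_cochains:
  assumes "u \<in> cochains X" "v \<in> cochains X"
  shows "cup X u v \<in> cochains X"
proof -
  let ?S = "\<lambda>u :: 'a cochain. {n. \<exists>\<sigma>. u n \<sigma> \<noteq> 0}"
  have "{n. \<exists>\<sigma>. cup X u v n \<sigma> \<noteq> 0} \<subseteq> (\<lambda>(a, b). a + b) ` (?S u \<times> ?S v)"
  proof clarify
    fix n \<sigma> assume "cup X u v n \<sigma> \<noteq> 0"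
    then have "(\<Sum>p\<le>n. u p (front_face p \<sigma>) * v (n - p) (back_face p (n - p) \<sigma>)) \<noteq> 0"
      by (auto simp: cup_def split: if_splits)
    then obtain p where "p \<le> n" "u p (front_face p \<sigma>) * v (n - p) (back_face p (n - p) \<sigma>) \<noteq> 0"
      by (force elim: sum.not_neutral_contains_not_neutral)
    then show "n \<in> (\<lambda>(a, b). a + b) ` (?S u \<times> ?S v)"
      by (intro image_eqI[of _ _ "(p, n - p)"]) auto
  qed
  moreover have "finite (?S u \<times> ?S v)"
    using assms by (auto simp: cochains_def)
  ultimately have "finite {n. \<exists>\<sigma>. cup X u v n \<sigma> \<noteq> 0}"
    by (meson finite_imageI finite_subset)
  then show ?thesis
    unfolding cochains_def by (simp add: cup_def)
qed

lemma coboundary_zero: "coboundary X cochain_zero = cochain_zero"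
  by (auto simp: coboundary_def fun_eq_iff)

lemma zero_in_coboundaries: "cochain_zero \<in> coboundaries X"
  unfolding coboundaries_def
  by (rule image_eqI[of _ _ cochain_zero]) (auto simp: coboundary_zero cochains_def)

lemma coboundaries_add: "c \<in> coboundaries X \<Longrightarrow> d \<in> coboundaries X \<Longrightarrow> cochain_add c d \<in> coboundaries X"
  by (auto simp: coboundaries_def coboundary_add[symmetric] cochain_add_in_cochains)

lemma coboundaries_uminus: "c \<in> coboundaries X \<Longrightarrow> cochain_uminus c \<in> coboundaries X"
  by (auto simp: coboundaries_def coboundary_uminus[symmetric] cochain_uminus_in_cochains)

lemma cocycles_add: "c \<in> cocycles X \<Longrightarrow> d \<in> cocycles X \<Longrightarrow> cochain_add c d \<in> cocycles X"
  by (auto simp: cocycles_def coboundary_add cochain_add_in_cochains) (simp add: cochain_add_def)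

lemma coboundaries_subset_cocycles: "coboundaries X \<subseteq> cocycles X"
  by (auto simp: coboundaries_def cocycles_def coboundary_in_cochains coboundary_coboundary)

lemma cup_zero [simp]: "cup X cochain_zero v = cochain_zero" "cup X u cochain_zero = cochain_zero"
  by (auto simp: cup_def fun_eq_iff)

lemma cochain_add_zero [simp]: "cochain_add u cochain_zero = u" "cochain_add cochain_zero u = u"
  by (auto simp: cochain_add_def)

lemma cup_in_cocycles: "u \<in> cocycles X \<Longrightarrow> v \<in> cocycles X \<Longrightarrow> cup X u v \<in> cocycles X"
  by (auto simp: cocycles_def cup_in_cochains coboundary_cup)

lemma cup_coboundaries_left:
  assumes "d \<in> coboundaries X" "v \<in> cocycles X"
  shows "cup X d v \<in> coboundaries X"
proof -
  obtain w where w: "w \<in> cochains X" "d = coboundary X w"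
    using assms(1) by (auto simp: coboundaries_def)
  have "cup X d v = coboundary X (cup X w v)"
    using assms(2) by (simp add: coboundary_cup w cocycles_def)
  then show ?thesis
    using assms(2) w(1) by (auto simp: coboundaries_def cocycles_def cup_in_cochains)
qed

text \<open>Twisting \<open>u\<close> beforehand absorbs the sign of the Leibniz rule, since
  \<open>sign_twist\<close> is an involution that preserves cocycles.\<close>

lemma cup_coboundaries_right:
  assumes "u \<in> cocycles X" "d \<in> coboundaries X"
  shows "cup X u d \<in> coboundaries X"
proof -
  obtain w where w: "w \<in> cochains X" "d = coboundary X w"
    using assms(2) by (auto simp: coboundaries_def)
  have "sign_twist (sign_twist u) = u"
    by (auto simp: sign_twist_def fun_eq_iff simp flip: mult.assoc power_add mult_2)
  moreover have "coboundary X (sign_twist u) = cochain_zero"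
    using assms(1) unfolding coboundary_sign_twist cocycles_def
    by (auto simp: sign_twist_def cochain_uminus_def)
  ultimately have "cup X u d = coboundary X (cup X (sign_twist u) w)"
    by (simp add: coboundary_cup w)
  then show ?thesis
    using assms(1) w(1) by (auto simp: coboundaries_def cocycles_def cup_in_cochains sign_twist_in_cochains)
qed

lemma cochain_one_in_cocycles: "cochain_one X \<in> cocycles X"
proof -
  have "coboundary X (cochain_one X) n \<sigma> = 0" for n \<sigma>
  proof (cases "n = 1 \<and> singular_simplex n X \<sigma>")
    case True
    then have n: "n = Suc 0" and s: "singular_simplex (Suc 0) X \<sigma>" by auto
    have "singular_simplex 0 X (singular_face (Suc 0) k \<sigma>)" if "k \<le> Suc 0" for k
      using singular_simplex_singular_face[OF s, of k] that by simp
    then show ?thesis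
      unfolding n coboundary_Suc[OF s] by (simp add: cochain_one_def)
  next
    case False
    then show ?thesis
      by (cases "n = Suc 0") (auto simp: coboundary_def cochain_one_def)
  qed
  then show ?thesis
    by (auto simp: cocycles_def cochains_def cochain_one_def fun_eq_iff)
qed

text \<open>The order of the summands is that of an element of the coset of \<open>b\<close>, so
  that \<open>coset_coboundaries\<close> follows by unfolding.\<close>

definition cohomologous :: "'a topology \<Rightarrow> 'a cochain \<Rightarrow> 'a cochain \<Rightarrow> bool" where
  "cohomologous X a b \<longleftrightarrow> (\<exists>d \<in> coboundaries X. a = cochain_add d b)"

lemma cohomologous_refl [simp]: "cohomologous X a a"
  unfolding cohomologous_def
  by (rule bexI[of _ cochain_zero]) (simp_all add: zero_in_coboundaries)

lemma cohomologous_sym: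
  assumes "cohomologous X a b" shows "cohomologous X b a"
proof -
  obtain d where d: "d \<in> coboundaries X" "a = cochain_add d b"
    using assms by (auto simp: cohomologous_def)
  then have "b = cochain_add (cochain_uminus d) a"
    by (auto simp: cochain_add_def cochain_uminus_def)
  then show ?thesis
    using coboundaries_uminus[OF d(1)] by (auto simp: cohomologous_def)
qed

lemma cohomologous_trans:
  assumes "cohomologous X a b" "cohomologous X b c" shows "cohomologous X a c"
proof -
  obtain d e where d: "d \<in> coboundaries X" "a = cochain_add d b"
    and e: "e \<in> coboundaries X" "b = cochain_add e c"
    using assms by (auto simp: cohomologous_def)
  then have "a = cochain_add (cochain_add d e) c"
    by (auto simp: cochain_add_def add.assoc)
  then show ?thesis
    using coboundaries_add[OF d(1) e(1)] by (auto simp: cohomologous_def)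
qed

lemma cohomologous_in_coboundaries:
  "cohomologous X a b \<Longrightarrow> b \<in> coboundaries X \<Longrightarrow> a \<in> coboundaries X"
  by (auto simp: cohomologous_def coboundaries_add)

lemma cohomologous_zero_iff: "cohomologous X a cochain_zero \<longleftrightarrow> a \<in> coboundaries X"
  by (auto simp: cohomologous_def)

lemma cohomologous_in_cocycles:
  "cohomologous X a b \<Longrightarrow> b \<in> cocycles X \<Longrightarrow> a \<in> cocycles X"
  using coboundaries_subset_cocycles by (auto simp: cohomologous_def intro!: cocycles_add)

lemma cohomologous_cup:
  assumes "cohomologous X a a'" "cohomologous X b b'" "a' \<in> cocycles X" "b' \<in> cocycles X"
  shows "cohomologous X (cup X a b) (cup X a' b')"
proof -
  obtain d e where d: "d \<in> coboundaries X" "a = cochain_add d a'"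
    and e: "e \<in> coboundaries X" "b = cochain_add e b'"
    using assms by (auto simp: cohomologous_def)
  have "b \<in> cocycles X" using assms cohomologous_in_cocycles by blast
  then have "cohomologous X (cup X a b) (cup X a' b)"
    using cup_coboundaries_left[OF d(1)] by (auto simp: cohomologous_def d(2) cup_add_left)
  moreover have "cohomologous X (cup X a' b) (cup X a' b')"
    using cup_coboundaries_right[OF assms(3) e(1)] by (auto simp: cohomologous_def e(2) cup_add_right)
  ultimately show ?thesis by (rule cohomologous_trans)
qed

lemma foldr_cup_in_cocycles:
  "set zs \<subseteq> cocycles X \<Longrightarrow> foldr (cup X) zs (cochain_one X) \<in> cocycles X"
  by (induction zs) (auto simp: cochain_one_in_cocycles cup_in_cocycles)

text \<open>The correcting coboundary is that of a primitive of \<open>z\<close> on \<open>W\<close>, extended by zero to the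
  simplices that leave \<open>W\<close>.\<close>

lemma cohomologous_vanishing_on_subspace:
  assumes z: "z \<in> cocycles X" and van: "vanishes_on_cycles (subtopology X W) z"
  obtains y where "cohomologous X y z"
    "\<And>n \<sigma>. singular_simplex n (subtopology X W) \<sigma> \<Longrightarrow> y n \<sigma> = 0"
proof -
  let ?W = "subtopology X W"
  define r where "r = (\<lambda>n \<sigma>. if singular_simplex n ?W \<sigma> then z n \<sigma> else 0)"
  have "finite {n. \<exists>\<sigma>. z n \<sigma> \<noteq> 0}"
    using z by (auto simp: cocycles_def cochains_def)
  then have "finite {n. \<exists>\<sigma>. r n \<sigma> \<noteq> 0}"
    by (rule rev_finite_subset) (auto simp: r_def)
  then have r: "r \<in> cochains ?W"
    by (auto simp: cochains_def r_def)
  have "vanishes_on_cycles ?W r"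
    unfolding vanishes_on_cycles_def
  proof (intro allI impI)
    fix n c assume c: "singular_relcycle n ?W {} c"
    then have "singular_chain n ?W c" by (simp add: singular_relcycle)
    then have "cochain_eval r n c = cochain_eval z n c"
      unfolding cochain_eval_def r_def singular_chain_def by (intro sum.cong) auto
    then show "cochain_eval r n c = 0"
      using van c by (auto simp: vanishes_on_cycles_def)
  qed
  then obtain v where v: "v \<in> cochains ?W" "r = coboundary ?W v"
    using coboundaries_iff_vanishes_on_cycles[OF r] by (auto simp: coboundaries_def)
  \<comment> \<open>Cochains are total functions that are zero off the simplices of their space, so
    \<open>v\<close> itself is its extension by zero to \<open>X\<close>.\<close>
  have vX: "v \<in> cochains X"
    using v(1) by (auto simp: cochains_def singular_simplex_subtopology)
  show ?thesis
  proof
    have "cochain_uminus (coboundary X v) \<in> coboundaries X"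
      using vX by (intro coboundaries_uminus) (auto simp: coboundaries_def)
    then show "cohomologous X (cochain_add (cochain_uminus (coboundary X v)) z) z"
      by (auto simp: cohomologous_def)
    fix n \<sigma> assume s: "singular_simplex n ?W \<sigma>"
    then have "coboundary X v n \<sigma> = coboundary ?W v n \<sigma>"
      by (auto simp: coboundary_def singular_simplex_subtopology)
    also have "\<dots> = z n \<sigma>"
      using s by (simp flip: v(2)) (simp add: r_def)
    finally show "cochain_add (cochain_uminus (coboundary X v)) z n \<sigma> = 0"
      by (simp add: cochain_add_def cochain_uminus_def)
  qed
qed

text \<open>Front and back faces of a simplex in \<open>W\<close> stay in \<open>W\<close>, so every
  summand has a zero factor.\<close>

lemma cup_vanishing_on_subspace:
  assumes "(\<forall>n \<sigma>. singular_simplex n (subtopology X W) \<sigma> \<longrightarrow> a n \<sigma> = 0) \<or>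
      (\<forall>n \<sigma>. singular_simplex n (subtopology X W) \<sigma> \<longrightarrow> b n \<sigma> = 0)"
    and s: "singular_simplex n (subtopology X W) \<sigma>"
  shows "cup X a b n \<sigma> = 0"
proof -
  have "a p (front_face p \<sigma>) * b (n - p) (back_face p (n - p) \<sigma>) = 0" if "p \<le> n" for p
    using assms(1) singular_simplex_front_face[OF s that] singular_simplex_back_face[of p "n - p"] s that
    by auto
  then show ?thesis by (auto simp: cup_def intro!: sum.neutral)
qed

text \<open>Replaces the product of relative classes. The representative \<open>y\<close> is zero on
  simplices that lie inside a single member of \<open>Ws\<close>; nothing is claimed for simplices
  that cross several members.\<close>

lemma foldr_cup_vanishing:
  assumes "list_all2 (\<lambda>z W. z \<in> cocycles X \<and> vanishes_on_cycles (subtopology X W) z) zs Ws"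
  shows "\<exists>y. cohomologous X y (foldr (cup X) zs (cochain_one X)) \<and>
     (\<forall>W\<in>set Ws. \<forall>n \<sigma>. singular_simplex n (subtopology X W) \<sigma> \<longrightarrow> y n \<sigma> = 0)"
  using assms
proof (induction rule: list_all2_induct)
  case Nil
  show ?case by (auto intro: cohomologous_refl)
next
  case (Cons z zs W Ws)
  obtain y where y: "cohomologous X y (foldr (cup X) zs (cochain_one X))"
    "\<forall>W\<in>set Ws. \<forall>n \<sigma>. singular_simplex n (subtopology X W) \<sigma> \<longrightarrow> y n \<sigma> = 0"
    using Cons.IH by blast
  obtain x where x: "cohomologous X x z"
    "\<And>n \<sigma>. singular_simplex n (subtopology X W) \<sigma> \<Longrightarrow> x n \<sigma> = 0"
    using cohomologous_vanishing_on_subspace Cons.hyps(1) by blast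
  have "set zs \<subseteq> cocycles X"
    using Cons.hyps(2) by (auto simp: list_all2_conv_all_nth in_set_conv_nth)
  then have "cohomologous X (cup X x y) (cup X z (foldr (cup X) zs (cochain_one X)))"
    using x y Cons.hyps(1) by (intro cohomologous_cup foldr_cup_in_cocycles) auto
  moreover have "cup X x y n \<sigma> = 0"
    if "V \<in> set (W # Ws)" "singular_simplex n (subtopology X V) \<sigma>" for V n \<sigma>
    using that x(2) y(2) by (intro cup_vanishing_on_subspace[of X V]) auto
  ultimately show ?case by auto
qed

text \<open>Every cycle is homologous to one made of simplices that are small with respect to the
  cover. The representative \<open>y\<close> is zero on each of those, and being a cocycle it takes
  equal values on homologous cycles, so it vanishes on all cycles.\<close>

theorem cup_product_in_coboundaries:
  assumes zs: "list_all2 (\<lambda>z W. z \<in> cocycles X \<and> vanishes_on_cycles (subtopology X W) z) zs Ws"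
    and op: "\<And>W. W \<in> set Ws \<Longrightarrow> openin X W" and cov: "topspace X \<subseteq> \<Union>(set Ws)"
  shows "foldr (cup X) zs (cochain_one X) \<in> coboundaries X"
proof -
  let ?z = "foldr (cup X) zs (cochain_one X)"
  obtain y where y: "cohomologous X y ?z"
    "\<And>W n \<sigma>. W \<in> set Ws \<Longrightarrow> singular_simplex n (subtopology X W) \<sigma> \<Longrightarrow> y n \<sigma> = 0"
    using foldr_cup_vanishing[OF zs] by blast
  have "set zs \<subseteq> cocycles X"
    using zs by (auto simp: list_all2_conv_all_nth in_set_conv_nth)
  then have cy: "y \<in> cocycles X"
    using y(1) foldr_cup_in_cocycles cohomologous_in_cocycles by blast
  have "vanishes_on_cycles X y"
    unfolding vanishes_on_cycles_def
  proof (intro allI impI)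
    fix n c assume c: "singular_relcycle n X {} c"
    obtain c' where c': "singular_relcycle n X {} c'" "homologous_rel n X {} c c'"
      "\<And>f. f \<in> Poly_Mapping.keys c' \<Longrightarrow> \<exists>V \<in> set Ws. f \<in> (standard_simplex n) \<rightarrow> V"
      using small_homologous_rel_relcycle_exists[OF op cov c] by metis
    have "singular_chain n X c'" using c'(1) by (simp add: singular_relcycle)
    then have "y n f = 0" if "f \<in> Poly_Mapping.keys c'" for f
      using c'(3)[OF that] y(2) that by (force simp: singular_chain_def singular_simplex_subtopology)
    then have "cochain_eval y n c' = 0"
      by (simp add: cochain_eval_def)
    then show "cochain_eval y n c = 0"
      using cochain_eval_homologous[OF _ c'(2)] cy by (simp add: cocycles_def)
  qed
  then have "y \<in> coboundaries X"
    using cy coboundaries_iff_vanishes_on_cycles by (auto simp: cocycles_def)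
  then show ?thesis
    using y(1) cohomologous_sym cohomologous_in_coboundaries by blast
qed

section \<open>From cosets in the cohomology ring to cochains\<close>

lemma coset_coboundaries:
  "coboundaries X +>\<^bsub>cocycle_ring X\<^esub> z = {a. cohomologous X a z}"
  by (auto simp: a_r_coset_def' cocycle_ring_def cohomologous_def cochain_add_def)

lemma coset_coboundaries_eq:
  assumes "cohomologous X a b"
  shows "coboundaries X +>\<^bsub>cocycle_ring X\<^esub> a = coboundaries X +>\<^bsub>cocycle_ring X\<^esub> b"
  unfolding coset_coboundaries using assms cohomologous_sym cohomologous_trans by blast

text \<open>The product in the quotient ring is a union of cosets over all pairs of representatives.
  All these cosets coincide, and the index sets are nonempty by reflexivity, so the union
  collapses.\<close>

lemma mult_rat_cohomology:
  assumes "a \<in> cocycles X" "b \<in> cocycles X"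
  shows "(coboundaries X +>\<^bsub>cocycle_ring X\<^esub> a) \<otimes>\<^bsub>rat_cohomology X\<^esub> (coboundaries X +>\<^bsub>cocycle_ring X\<^esub> b)
     = coboundaries X +>\<^bsub>cocycle_ring X\<^esub> (cup X a b)"
proof -
  have "(coboundaries X +>\<^bsub>cocycle_ring X\<^esub> a) \<otimes>\<^bsub>rat_cohomology X\<^esub> (coboundaries X +>\<^bsub>cocycle_ring X\<^esub> b)
     = (\<Union>x\<in>{x. cohomologous X x a}. \<Union>y\<in>{y. cohomologous X y b}.
          coboundaries X +>\<^bsub>cocycle_ring X\<^esub> (cup X x y))"
    unfolding rat_cohomology_def FactRing_def
    by (simp add: rcoset_mult_def coset_coboundaries) (simp add: cocycle_ring_def)
  also have "\<dots> = (\<Union>x\<in>{x. cohomologous X x a}. \<Union>y\<in>{y. cohomologous X y b}.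
          coboundaries X +>\<^bsub>cocycle_ring X\<^esub> (cup X a b))"
    using assms by (intro SUP_cong refl coset_coboundaries_eq cohomologous_cup) auto
  also have "\<dots> = coboundaries X +>\<^bsub>cocycle_ring X\<^esub> (cup X a b)"
    using cohomologous_refl by blast
  finally show ?thesis .
qed

lemma foldr_mult_rat_cohomology:
  assumes "set zs \<subseteq> cocycles X"
  shows "foldr (\<lambda>x y. x \<otimes>\<^bsub>rat_cohomology X\<^esub> y)
      (map (\<lambda>z. coboundaries X +>\<^bsub>cocycle_ring X\<^esub> z) zs) \<one>\<^bsub>rat_cohomology X\<^esub>
    = coboundaries X +>\<^bsub>cocycle_ring X\<^esub> (foldr (cup X) zs (cochain_one X))"
  using assms
proof (induction zs)
  case Nil
  then show ?case
    by (simp add: rat_cohomology_def FactRing_def) (simp add: cocycle_ring_def cochain_one_def)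
next
  case (Cons z zs)
  then show ?case
    by (simp add: mult_rat_cohomology foldr_cup_in_cocycles)
qed

section \<open>Pullback of cochains along continuous maps\<close>

lemma pullback_coboundary:
  assumes f: "continuous_map X Y f"
  shows "pullback X f (coboundary Y u) = coboundary X (pullback X f u)"
proof (intro ext)
  fix n \<sigma>
  show "pullback X f (coboundary Y u) n \<sigma> = coboundary X (pullback X f u) n \<sigma>"
  proof (cases "\<exists>m. n = Suc m \<and> singular_simplex (Suc m) X \<sigma>")
    case True
    then obtain m where n: "n = Suc m" and s: "singular_simplex (Suc m) X \<sigma>" by blast
    have s': "singular_simplex (Suc m) Y (simplex_map (Suc m) f \<sigma>)"
      using singular_simplex_simplex_map[OF s f] .
    have "singular_simplex m X (singular_face (Suc m) k \<sigma>)" if "k \<le> Suc m" for k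
      using singular_simplex_singular_face[OF s, of k] that by simp
    moreover have "singular_face (Suc m) k (simplex_map (Suc m) f \<sigma>) = simplex_map m f (singular_face (Suc m) k \<sigma>)"
      if "k \<le> Suc m" for k
      using that by (auto simp: singular_face_def simplex_map_def fun_eq_iff restrict_def simplical_face_in_standard_simplex_Suc)
    ultimately show ?thesis
      unfolding n coboundary_Suc[OF s] using s s'
      by (simp add: pullback_def coboundary_Suc del: sum.atMost_Suc)
  next
    case False
    then show ?thesis
      by (cases n) (auto simp: pullback_def coboundary_eq_0)
  qed
qed

lemma pullback_in_cochains:
  assumes "u \<in> cochains Y"
  shows "pullback X f u \<in> cochains X"
proof -
  have "finite {n. \<exists>\<sigma>. u n \<sigma> \<noteq> 0}"
    using assms by (auto simp: cochains_def)
  then have "finite {n. \<exists>\<sigma>. pullback X f u n \<sigma> \<noteq> 0}"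
    by (rule rev_finite_subset) (auto simp: pullback_def split: if_splits)
  then show ?thesis by (auto simp: cochains_def pullback_def)
qed

lemma pullback_zero: "pullback X f cochain_zero = cochain_zero"
  by (auto simp: pullback_def fun_eq_iff)

lemma pullback_in_cocycles:
  assumes "continuous_map X Y f" "u \<in> cocycles Y"
  shows "pullback X f u \<in> cocycles X"
  using assms by (auto simp: cocycles_def pullback_in_cochains pullback_zero simp flip: pullback_coboundary)

lemma pullback_in_coboundaries:
  assumes "continuous_map X Y f" "u \<in> coboundaries Y"
  shows "pullback X f u \<in> coboundaries X"
  using assms by (auto simp: coboundaries_def pullback_coboundary pullback_in_cochains)

lemma pullback_add: "pullback X f (cochain_add u v) = cochain_add (pullback X f u) (pullback X f v)"
  by (auto simp: pullback_def cochain_add_def fun_eq_iff)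

lemma cohomologous_pullback:
  assumes "continuous_map X Y f" "cohomologous Y u v"
  shows "cohomologous X (pullback X f u) (pullback X f v)"
  using assms pullback_in_coboundaries[OF assms(1)] by (auto simp: cohomologous_def pullback_add)

lemma front_face_simplex_map: "p \<le> n \<Longrightarrow> front_face p (simplex_map n f \<sigma>) = simplex_map p f (front_face p \<sigma>)"
  using standard_simplex_mono[of p n] by (auto simp: front_face_def simplex_map_def fun_eq_iff restrict_def)

lemma back_face_simplex_map: "back_face p q (simplex_map (p + q) f \<sigma>) = simplex_map q f (back_face p q \<sigma>)"
  by (auto simp: back_face_eq simplex_map_def fun_eq_iff restrict_def simplex_shift_in_standard_simplex)

lemma pullback_cup:
  assumes f: "continuous_map X Y f"
  shows "pullback X f (cup Y u v) = cup X (pullback X f u) (pullback X f v)"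
proof (intro ext)
  fix n \<sigma>
  show "pullback X f (cup Y u v) n \<sigma> = cup X (pullback X f u) (pullback X f v) n \<sigma>"
  proof (cases "singular_simplex n X \<sigma>")
    case s: True
    have "u p (front_face p (simplex_map n f \<sigma>)) * v (n - p) (back_face p (n - p) (simplex_map n f \<sigma>))
        = pullback X f u p (front_face p \<sigma>) * pullback X f v (n - p) (back_face p (n - p) \<sigma>)"
      if "p \<le> n" for p
      using that front_face_simplex_map[OF that, of f \<sigma>] back_face_simplex_map[of p "n - p" f \<sigma>]
        singular_simplex_front_face[OF s that] singular_simplex_back_face[of p "n - p" X \<sigma>] s
      by (simp add: pullback_def)
    then show ?thesis
      using s singular_simplex_simplex_map[OF s f] by (simp add: pullback_def cup_def)
  qed (simp add: pullback_def cup_def)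
qed

lemma pullback_foldr_cup:
  assumes f: "continuous_map X Y f"
  shows "pullback X f (foldr (cup Y) zs (cochain_one Y)) = foldr (cup X) (map (pullback X f) zs) (cochain_one X)"
proof (induction zs)
  case Nil
  show ?case
    using singular_simplex_simplex_map[OF _ f] by (auto simp: pullback_def cochain_one_def fun_eq_iff)
qed (simp add: pullback_cup[OF f])

lemma diagonal_kernelE:
  assumes "x \<in> diagonal_kernel X"
  obtains z where "z \<in> cocycles (prod_topology X X)"
    "x = coboundaries (prod_topology X X) +>\<^bsub>cocycle_ring (prod_topology X X)\<^esub> z"
    "pullback X (\<lambda>x. (x, x)) z \<in> coboundaries X"
proof -
  let ?D = "\<lambda>x :: 'a. (x, x)" and ?P = "prod_topology X X"
  have D: "continuous_map X ?P ?D"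
    by (simp add: continuous_map_paired)
  have "x \<in> a_rcosets\<^bsub>cocycle_ring ?P\<^esub> coboundaries ?P" and hx: "induced_hom X ?D x = coboundaries X"
    using assms by (auto simp: diagonal_kernel_def a_kernel_def kernel_def rat_cohomology_def FactRing_def)
  then obtain z where z: "z \<in> cocycles ?P" "x = coboundaries ?P +>\<^bsub>cocycle_ring ?P\<^esub> z"
    by (auto simp: A_RCOSETS_def' cocycle_ring_def)
  \<comment> \<open>The image is a singleton, so \<open>the_elem\<close> in
    \<open>induced_hom\<close> returns an honest class and membership in the kernel can be read off
    from the one representative \<open>z\<close>.\<close>
  have "(\<lambda>u. coboundaries X +>\<^bsub>cocycle_ring X\<^esub> pullback X ?D u) ` x
      = {coboundaries X +>\<^bsub>cocycle_ring X\<^esub> pullback X ?D z}"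
    unfolding z(2) coset_coboundaries[of ?P]
    using cohomologous_refl[of ?P z] coset_coboundaries_eq[OF cohomologous_pullback[OF D]] by blast
  then have "coboundaries X = coboundaries X +>\<^bsub>cocycle_ring X\<^esub> pullback X ?D z"
    using hx by (simp add: induced_hom_def)
  moreover have "pullback X ?D z \<in> coboundaries X +>\<^bsub>cocycle_ring X\<^esub> pullback X ?D z"
    unfolding coset_coboundaries by simp
  ultimately show ?thesis
    using that[OF z] by simp
qed

text \<open>Moves the bound to the level of cochains: choosing a cocycle in each class turns a zero
  product in the ring into a product of cocycles that is a coboundary.\<close>

lemma nil_index_diagonal_kernel_le:
  assumes prod: "\<And>zs. length zs = n \<Longrightarrow> set zs \<subseteq> {z \<in> cocycles (prod_topology X X).
      pullback X (\<lambda>x. (x, x)) z \<in> coboundaries X} \<Longrightarrow>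
    foldr (cup (prod_topology X X)) zs (cochain_one (prod_topology X X)) \<in> coboundaries (prod_topology X X)"
  shows "nil_index (rat_cohomology (prod_topology X X)) (diagonal_kernel X) \<le> enat n"
proof -
  let ?P = "prod_topology X X"
  have "foldr (\<lambda>x y. x \<otimes>\<^bsub>rat_cohomology ?P\<^esub> y) xs \<one>\<^bsub>rat_cohomology ?P\<^esub> = \<zero>\<^bsub>rat_cohomology ?P\<^esub>"
    if xs: "length xs = n" "set xs \<subseteq> diagonal_kernel X" for xs
  proof -
    have "\<forall>x\<in>set xs. \<exists>z. z \<in> cocycles ?P \<and> pullback X (\<lambda>x. (x, x)) z \<in> coboundaries X \<and>
        x = coboundaries ?P +>\<^bsub>cocycle_ring ?P\<^esub> z"
    proof
      fix x assume "x \<in> set xs"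
      then have "x \<in> diagonal_kernel X" using xs(2) by blast
      then obtain z where "z \<in> cocycles ?P" "x = coboundaries ?P +>\<^bsub>cocycle_ring ?P\<^esub> z"
        "pullback X (\<lambda>x. (x, x)) z \<in> coboundaries X"
        by (rule diagonal_kernelE)
      then show "\<exists>z. z \<in> cocycles ?P \<and> pullback X (\<lambda>x. (x, x)) z \<in> coboundaries X \<and>
        x = coboundaries ?P +>\<^bsub>cocycle_ring ?P\<^esub> z" by blast
    qed
    from bchoice[OF this] obtain h where h: "\<And>x. x \<in> set xs \<Longrightarrow> h x \<in> cocycles ?P"
      "\<And>x. x \<in> set xs \<Longrightarrow> pullback X (\<lambda>x. (x, x)) (h x) \<in> coboundaries X"
      "\<And>x. x \<in> set xs \<Longrightarrow> x = coboundaries ?P +>\<^bsub>cocycle_ring ?P\<^esub> h x"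
      by blast
    let ?z = "foldr (cup ?P) (map h xs) (cochain_one ?P)"
    have "map (\<lambda>z. coboundaries ?P +>\<^bsub>cocycle_ring ?P\<^esub> z) (map h xs) = xs"
      unfolding map_map by (rule map_idI) (simp flip: h(3))
    then have "foldr (\<lambda>x y. x \<otimes>\<^bsub>rat_cohomology ?P\<^esub> y) xs \<one>\<^bsub>rat_cohomology ?P\<^esub>
       = coboundaries ?P +>\<^bsub>cocycle_ring ?P\<^esub> ?z"
      using foldr_mult_rat_cohomology[of "map h xs" ?P] h(1) by (simp add: image_subset_iff)
    also have "?z \<in> coboundaries ?P"
      by (rule prod) (use xs h in auto)
    then have "coboundaries ?P +>\<^bsub>cocycle_ring ?P\<^esub> ?z = coboundaries ?P +>\<^bsub>cocycle_ring ?P\<^esub> cochain_zero"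
      by (intro coset_coboundaries_eq) (simp add: cohomologous_zero_iff)
    also have "\<dots> = coboundaries ?P"
      by (simp add: coset_coboundaries cohomologous_zero_iff)
    also have "\<dots> = \<zero>\<^bsub>rat_cohomology ?P\<^esub>"
      by (simp add: rat_cohomology_def FactRing_def)
    finally show ?thesis .
  qed
  then show ?thesis
    unfolding nil_index_def by (intro Inf_lower) blast
qed


section \<open>Homotopy lifting\<close>

lemma covering_space_evenly:
  assumes "covering_space E p S" "x \<in> S"
  obtains T v where "openin (top_of_set S) T" "x \<in> T" "\<Union>v = E \<inter> p -` T"
    "\<And>u. u \<in> v \<Longrightarrow> openin (top_of_set E) u" "pairwise disjnt v"
    "\<And>u. u \<in> v \<Longrightarrow> \<exists>q. homeomorphism u T p q"
proof -
  from assms have "\<forall>x\<in>S. \<exists>T. x \<in> T \<and> openin (top_of_set S) T \<and>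
      (\<exists>v. \<Union>v = E \<inter> p -` T \<and> (\<forall>u\<in>v. openin (top_of_set E) u) \<and> pairwise disjnt v \<and>
        (\<forall>u\<in>v. \<exists>q. homeomorphism u T p q))"
    unfolding covering_space_def by (elim conjE)
  from bspec[OF this assms(2)] obtain T v where "openin (top_of_set S) T" "x \<in> T"
    "\<Union>v = E \<inter> p -` T" "\<forall>u\<in>v. openin (top_of_set E) u" "pairwise disjnt v"
    "\<forall>u\<in>v. \<exists>q. homeomorphism u T p q"
    by (elim exE conjE)
  then show ?thesis
    using that[of T v] by simp
qed

text \<open>Agreement of two lifts is locally constant. Near \<open>y\<close> they stay in sheets
  \<open>u\<close> and \<open>u'\<close>; agreement at one point of \<open>N\<close> forces
  \<open>u = u'\<close> by disjointness, and then injectivity of \<open>p\<close> on the sheet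
  forces agreement throughout \<open>N\<close>.\<close>

lemma covering_lift_unique:
  fixes p :: "'b::topological_space \<Rightarrow> 'a::topological_space" and k l :: "'c::topological_space \<Rightarrow> 'b"
  assumes cov: "covering_space E p S" and T: "connected T" "a \<in> T" "x \<in> T"
    and k: "continuous_on T k" "k \<in> T \<rightarrow> E" and l: "continuous_on T l" "l \<in> T \<rightarrow> E"
    and eq: "\<And>y. y \<in> T \<Longrightarrow> p (k y) = p (l y)" and "k a = l a"
  shows "k x = l x"
proof (rule connected_induction_simple[OF T(1), where P = "\<lambda>y. k y = l y"])
  fix y assume y: "y \<in> T"
  then have "p (k y) \<in> S"
    using k(2) cov by (auto simp: covering_space_def)
  from covering_space_evenly[OF cov this] obtain W v where W:
    "openin (top_of_set S) W" "p (k y) \<in> W" "\<Union>v = E \<inter> p -` W"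
    "\<And>u. u \<in> v \<Longrightarrow> openin (top_of_set E) u" "pairwise disjnt v"
    "\<And>u. u \<in> v \<Longrightarrow> \<exists>q. homeomorphism u W p q" by metis
  have "k y \<in> \<Union>v" "l y \<in> \<Union>v"
    using W(2,3) k(2) l(2) y eq[OF y] by auto
  then obtain u u' where u: "u \<in> v" "k y \<in> u" "u' \<in> v" "l y \<in> u'" by blast
  define N where "N = (T \<inter> k -` u) \<inter> (T \<inter> l -` u')"
  have "openin (top_of_set T) N"
    unfolding N_def using k l W(4) u by (intro openin_Int continuous_openin_preimage[of _ _ E]) auto
  moreover have "y \<in> N" using y u by (auto simp: N_def)
  moreover have "k b = l b" if "c \<in> N" "b \<in> N" "k c = l c" for b c
  proof -
    have "u = u'"
      using that W(5) u by (auto simp: N_def pairwise_def disjnt_def)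
    moreover obtain q where "homeomorphism u W p q" using W(6) u by blast
    ultimately show ?thesis
      using that eq[of b] unfolding N_def homeomorphism_def by (metis IntE vimageE)
  qed
  ultimately show "\<exists>N. openin (top_of_set T) N \<and> y \<in> N \<and> (\<forall>b\<in>N. \<forall>c\<in>N. k b = l b \<longrightarrow> k c = l c)"
    by blast
qed (use assms in auto)

text \<open>The time interval is treated by bisection: over a short interval and a small
  neighbourhood of \<open>y0\<close> the homotopy stays in one evenly covered set, where a sheet
  inverse lifts it, and lifts over adjacent intervals are concatenated.\<close>

lemma covering_lift_homotopy_local:
  fixes p :: "'b::topological_space \<Rightarrow> 'a::topological_space" and h :: "real \<times> 'c::topological_space \<Rightarrow> 'a"
  assumes cov: "covering_space E p S"
    and h: "continuous_on ({0..1} \<times> U) h" "h \<in> {0..1} \<times> U \<rightarrow> S"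
    and f: "continuous_on U f" "f \<in> U \<rightarrow> E" "\<And>y. y \<in> U \<Longrightarrow> h (0, y) = p (f y)"
    and y0: "y0 \<in> U"
  obtains V K where "openin (top_of_set U) V" "y0 \<in> V" "continuous_on ({0..1} \<times> V) K"
    "K \<in> {0..1} \<times> V \<rightarrow> E" "\<And>y. y \<in> V \<Longrightarrow> K (0, y) = f y" "\<And>z. z \<in> {0..1} \<times> V \<Longrightarrow> p (K z) = h z"
proof -
  define Q where "Q = (\<lambda>a b V f V' K. openin (top_of_set U) V' \<and> y0 \<in> V' \<and> V' \<subseteq> V \<and>
     continuous_on ({a..b} \<times> V') K \<and> K \<in> {a..b} \<times> V' \<rightarrow> E \<and> (\<forall>y\<in>V'. K (a, y) = f y) \<and>
     (\<forall>z\<in>{a..b} \<times> V'. p (K z) = h z))"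
  \<comment> \<open>Quantifying over all neighbourhoods and all initial lifts makes the property
    transitive: the lift over the second interval starts at the end of the first lift, over an
    already smaller neighbourhood.\<close>
  define P where "P = (\<lambda>a b. 0 \<le> a \<and> a \<le> b \<and> b \<le> (1::real) \<longrightarrow>
     (\<forall>V f. openin (top_of_set U) V \<and> y0 \<in> V \<and> continuous_on V f \<and> f \<in> V \<rightarrow> E \<and>
        (\<forall>y\<in>V. p (f y) = h (a, y)) \<longrightarrow> (\<exists>V' K. Q a b V f V' K)))"
  have "P 0 1"
  proof (rule Bolzano)
    fix a b c :: real
    assume trans: "P a b" "P b c" "a \<le> b" "b \<le> c"
    show "P a c"
      unfolding P_def
    proof (intro impI allI)
      fix V f
      assume abc: "0 \<le> a \<and> a \<le> c \<and> c \<le> (1::real)"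
        and V: "openin (top_of_set U) V \<and> y0 \<in> V \<and> continuous_on V f \<and> f \<in> V \<rightarrow> E \<and>
          (\<forall>y\<in>V. p (f y) = h (a, y))"
      obtain V1 K1 where 1: "Q a b V f V1 K1"
        using trans(1,3,4) abc V unfolding P_def by (meson order_trans)
      have "continuous_on V1 (\<lambda>y. K1 (b, y))"
        using 1 trans(3) unfolding Q_def
        by (auto intro!: continuous_on_compose2[of "{a..b} \<times> V1" K1] continuous_intros)
      moreover have "(\<lambda>y. K1 (b, y)) \<in> V1 \<rightarrow> E" "\<forall>y\<in>V1. p (K1 (b, y)) = h (b, y)"
        using 1 trans(3) unfolding Q_def by auto
      moreover have "openin (top_of_set U) V1" "y0 \<in> V1"
        using 1 unfolding Q_def by auto
      moreover have "0 \<le> b" "b \<le> c" "c \<le> 1"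
        using trans(3,4) abc by auto
      ultimately obtain V2 K2 where 2: "Q b c V1 (\<lambda>y. K1 (b, y)) V2 K2"
        using trans(2) unfolding P_def by meson
      define K where "K = (\<lambda>z. if fst z \<le> b then K1 z else K2 z)"
      have "Q a c V f V2 K"
        unfolding Q_def
      proof (intro conjI)
        have "continuous_on ({a..b} \<times> V2 \<union> {b..c} \<times> V2) K"
          unfolding K_def
        proof (rule continuous_on_cases_local)
          have "{a..b} \<times> V2 = ({a..b} \<times> V2 \<union> {b..c} \<times> V2) \<inter> ({..b} \<times> UNIV)"
            using trans(3,4) by auto
          then show "closedin (top_of_set ({a..b} \<times> V2 \<union> {b..c} \<times> V2)) ({a..b} \<times> V2)"
            by (metis closedin_closed_Int closed_Times closed_UNIV closed_atMost)
          have "{b..c} \<times> V2 = ({a..b} \<times> V2 \<union> {b..c} \<times> V2) \<inter> ({b..} \<times> UNIV)"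
            using trans(3,4) by auto
          then show "closedin (top_of_set ({a..b} \<times> V2 \<union> {b..c} \<times> V2)) ({b..c} \<times> V2)"
            by (metis closedin_closed_Int closed_Times closed_UNIV closed_atLeast)
          show "continuous_on ({a..b} \<times> V2) K1"
            using 1 2 unfolding Q_def by (meson Sigma_mono continuous_on_subset order_refl)
          show "continuous_on ({b..c} \<times> V2) K2"
            using 2 unfolding Q_def by blast
          show "K1 x = K2 x" if "x \<in> {a..b} \<times> V2 \<and> \<not> fst x \<le> b \<or> x \<in> {b..c} \<times> V2 \<and> fst x \<le> b" for x
            using that 2 trans(4) unfolding Q_def by (cases x) (auto dest!: antisym)
        qed
        moreover have "{a..b} \<times> V2 \<union> {b..c} \<times> V2 = {a..c} \<times> V2"
          using trans(3,4) by auto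
        ultimately show "continuous_on ({a..c} \<times> V2) K" by simp
        have sub: "V2 \<subseteq> V1" using 2 unfolding Q_def by blast
        show "K \<in> {a..c} \<times> V2 \<rightarrow> E"
          using 1 2 sub unfolding Q_def K_def by fastforce
        show "\<forall>y\<in>V2. K (a, y) = f y"
          using 1 sub trans(3) unfolding Q_def K_def by auto
        show "\<forall>z\<in>{a..c} \<times> V2. p (K z) = h z"
          using 1 2 sub unfolding Q_def K_def by fastforce
      qed (use 1 2 in \<open>auto simp: Q_def\<close>)
      then show "\<exists>V' K. Q a c V f V' K" by blast
    qed
  next
    fix x :: real
    assume local: "0 \<le> x" "x \<le> 1"
    then have hx: "h (x, y0) \<in> S" using h(2) y0 by auto
    from covering_space_evenly[OF cov hx] obtain T v where T:
      "openin (top_of_set S) T" "h (x, y0) \<in> T" "\<Union>v = E \<inter> p -` T"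
      "\<And>u. u \<in> v \<Longrightarrow> openin (top_of_set E) u"
      "\<And>u. u \<in> v \<Longrightarrow> \<exists>q. homeomorphism u T p q" by metis
    have "openin (top_of_set ({0..1} \<times> U)) (({0..1} \<times> U) \<inter> h -` T)"
      by (rule continuous_openin_preimage[OF h T(1)])
    then obtain G where G: "open G" "({0..1} \<times> U) \<inter> h -` T = ({0..1} \<times> U) \<inter> G"
      by (auto simp: openin_open)
    then have "(x, y0) \<in> G" using local y0 T(2) by auto
    then obtain A B where AB: "open A" "open B" "x \<in> A" "y0 \<in> B" "A \<times> B \<subseteq> G"
      using open_prod_elim[OF G(1)] by (metis mem_Sigma_iff)
    obtain d where d: "d > 0" "ball x d \<subseteq> A" using AB(1,3) open_contains_ball by blast
    have hT: "h (t, y) \<in> T" if "t \<in> {0..1}" "dist x t < d" "y \<in> U" "y \<in> B" for t y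
    proof -
      have "(t, y) \<in> A \<times> B" using that d(2) by auto
      then show ?thesis using AB(5) G(2) that by blast
    qed
    show "\<exists>d>0. \<forall>a b. a \<le> x \<and> x \<le> b \<and> b - a < d \<longrightarrow> P a b"
    proof (intro exI[of _ d] conjI d allI impI)
      fix a b assume ab: "a \<le> x \<and> x \<le> b \<and> b - a < d"
      show "P a b"
        unfolding P_def
      proof (intro impI allI)
        fix V f
        assume ab01: "0 \<le> a \<and> a \<le> b \<and> b \<le> (1::real)"
          and V: "openin (top_of_set U) V \<and> y0 \<in> V \<and> continuous_on V f \<and> f \<in> V \<rightarrow> E \<and>
            (\<forall>y\<in>V. p (f y) = h (a, y))"
        have VU: "V \<subseteq> U" using V openin_imp_subset by blast
        have near: "h (t, y) \<in> T" if "t \<in> {a..b}" "y \<in> V" "y \<in> B" for t y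
          using that ab ab01 VU by (intro hT) (auto simp: dist_real_def)
        have "f y0 \<in> \<Union>v"
          using T(3) near[of a y0] V AB(4) ab01 by auto
        then obtain u where u: "u \<in> v" "f y0 \<in> u" by blast
        obtain q where q: "homeomorphism u T p q" using T(5) u by blast
        \<comment> \<open>The first factor keeps the initial lift inside the single sheet
          \<open>u\<close>, so that \<open>q\<close> composed with \<open>h\<close> really starts at
          \<open>f\<close>; the second keeps \<open>h\<close> inside the evenly covered set
          \<open>T\<close>.\<close>
        define V' where "V' = (V \<inter> f -` u) \<inter> (U \<inter> B)"
        have "openin (top_of_set V) (V \<inter> f -` u)"
          using V T(4)[OF u(1)] by (intro continuous_openin_preimage[of _ _ E]) auto
        then have "openin (top_of_set U) V'"
          unfolding V'_def using V AB(2)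
          by (intro openin_Int[OF _ openin_open_Int]) (auto dest: openin_trans)
        moreover have "y0 \<in> V'" using V u y0 AB by (auto simp: V'_def)
        moreover have "continuous_on ({a..b} \<times> V') (\<lambda>z. q (h z))"
        proof (rule continuous_on_compose2[of T q])
          show "continuous_on T q" using q by (simp add: homeomorphism_def)
          show "continuous_on ({a..b} \<times> V') h"
            using ab01 by (intro continuous_on_subset[OF h(1)]) (auto simp: V'_def)
          show "h ` ({a..b} \<times> V') \<subseteq> T" using near by (auto simp: V'_def)
        qed
        moreover have "(\<lambda>z. q (h z)) \<in> {a..b} \<times> V' \<rightarrow> E"
        proof
          fix z assume "z \<in> {a..b} \<times> V'"
          then have "h z \<in> T" using near by (auto simp: V'_def)
          then have "q (h z) \<in> u" using q by (auto simp: homeomorphism_def)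
          then show "q (h z) \<in> E" using T(3) u by auto
        qed
        moreover have "\<forall>y\<in>V'. q (h (a, y)) = f y"
        proof
          fix y assume "y \<in> V'"
          then have "f y \<in> u" "h (a, y) = p (f y)" using V by (auto simp: V'_def)
          then show "q (h (a, y)) = f y" using q by (simp add: homeomorphism_def)
        qed
        moreover have "\<forall>z\<in>{a..b} \<times> V'. p (q (h z)) = h z"
          using q near by (auto simp: V'_def homeomorphism_def)
        ultimately have "Q a b V f V' (\<lambda>z. q (h z))"
          unfolding Q_def by (auto simp: V'_def)
        then show "\<exists>V' K. Q a b V f V' K" by blast
      qed
    qed
  qed simp
  then obtain V' K where "Q 0 1 U f V' K"
    using f y0 unfolding P_def by (metis openin_subtopology_self order_refl zero_le_one)
  then show ?thesis
    using that unfolding Q_def by blast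
qed

text \<open>The local lifts glue because over each fixed \<open>y'\<close> they lift the same path
  with the same start, so uniqueness of path lifting makes them equal.\<close>

theorem covering_lift_homotopy:
  fixes p :: "'b::topological_space \<Rightarrow> 'a::topological_space" and h :: "real \<times> 'c::topological_space \<Rightarrow> 'a"
  assumes cov: "covering_space E p S"
    and h: "continuous_on ({0..1} \<times> U) h" "h \<in> {0..1} \<times> U \<rightarrow> S"
    and f: "continuous_on U f" "f \<in> U \<rightarrow> E" "\<And>y. y \<in> U \<Longrightarrow> h (0, y) = p (f y)"
  obtains k where "continuous_on ({0..1} \<times> U) k" "k \<in> {0..1} \<times> U \<rightarrow> E"
    "\<And>y. y \<in> U \<Longrightarrow> k (0, y) = f y" "\<And>z. z \<in> {0..1} \<times> U \<Longrightarrow> p (k z) = h z"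
proof -
  define G where "G = (\<lambda>y0 V K. openin (top_of_set U) V \<and> y0 \<in> V \<and> continuous_on ({0..1} \<times> V) K \<and>
    K \<in> {0..1} \<times> V \<rightarrow> E \<and> (\<forall>y\<in>V. K (0, y) = f y) \<and> (\<forall>z\<in>{0..1} \<times> V. p (K z) = h z))"
  have "\<forall>y0\<in>U. \<exists>V K. G y0 V K"
    using covering_lift_homotopy_local[OF assms] unfolding G_def by metis
  then obtain V K where VK: "\<And>y. y \<in> U \<Longrightarrow> G y (V y) (K y)"
    by metis
  then have V: "\<And>y. y \<in> U \<Longrightarrow> openin (top_of_set U) (V y)" "\<And>y. y \<in> U \<Longrightarrow> y \<in> V y"
    and K: "\<And>y. y \<in> U \<Longrightarrow> continuous_on ({0..1} \<times> V y) (K y)"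
    "\<And>y. y \<in> U \<Longrightarrow> K y \<in> {0..1} \<times> V y \<rightarrow> E"
    "\<And>y y'. y \<in> U \<Longrightarrow> y' \<in> V y \<Longrightarrow> K y (0, y') = f y'"
    "\<And>y z. y \<in> U \<Longrightarrow> z \<in> {0..1} \<times> V y \<Longrightarrow> p (K y z) = h z"
    unfolding G_def by blast+
  have VU: "V y \<subseteq> U" if "y \<in> U" for y using V(1)[OF that] openin_imp_subset by blast
  \<comment> \<open>At each point the local lift belonging to its own second coordinate is used;
    \<open>agree\<close> shows that near \<open>y\<close> this coincides with the single continuous
    map \<open>K y\<close>.\<close>
  define k where "k = (\<lambda>z. K (snd z) z)"
  have agree: "K y (t, y') = K y' (t, y')" if y: "y \<in> U" "y' \<in> V y" and t: "t \<in> {0..1}" for y y' t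
  proof (rule covering_lift_unique[OF cov, of "{0..1}" 0 t "\<lambda>t. K y (t, y')" "\<lambda>t. K y' (t, y')"])
    have y': "y' \<in> U" "y' \<in> V y'" using VU V(2) y by auto
    show "continuous_on {0..1} (\<lambda>t. K y (t, y'))" "continuous_on {0..1} (\<lambda>t. K y' (t, y'))"
      using y y' by (auto intro!: continuous_on_compose2[OF K(1)] continuous_intros)
    show "(\<lambda>t. K y (t, y')) \<in> {0..1} \<rightarrow> E" "(\<lambda>t. K y' (t, y')) \<in> {0..1} \<rightarrow> E"
      using y y' K(2) by fastforce+
    show "p (K y (t, y')) = p (K y' (t, y'))" if "t \<in> {0..1}" for t
      using that y y' K(4) by simp
    show "K y (0, y') = K y' (0, y')" using y y' K(3) by simp
  qed (use t in auto)
  have "continuous_map (top_of_set ({0..1} \<times> U)) euclidean k"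
  proof (rule pasting_lemma[where I = U and T = "\<lambda>y. {0..1} \<times> V y" and f = K])
    show "openin (top_of_set ({0..1} \<times> U)) ({0..1} \<times> V y)" if "y \<in> U" for y
      using V(1)[OF that] by (intro openin_Times) auto
    show "continuous_map (subtopology (top_of_set ({0..1} \<times> U)) ({0..1} \<times> V y)) euclidean (K y)" if "y \<in> U" for y
    proof -
      have "({0..1} \<times> U) \<inter> ({0..1} \<times> V y) = {0..1::real} \<times> V y" using VU[OF that] by auto
      then show ?thesis using K(1)[OF that] by (simp add: subtopology_subtopology)
    qed
    show "K i x = K j x"
      if "i \<in> U" "j \<in> U" "x \<in> topspace (top_of_set ({0..1} \<times> U)) \<inter> {0..1} \<times> V i \<inter> {0..1} \<times> V j" for i j x
      using that agree by (cases x) auto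
    show "\<exists>j. j \<in> U \<and> x \<in> {0..1} \<times> V j \<and> k x = K j x" if "x \<in> topspace (top_of_set ({0..1} \<times> U))" for x
      using that V(2) by (cases x) (auto simp: k_def)
  qed
  then have "continuous_on ({0..1} \<times> U) k" by simp
  moreover have "k \<in> {0..1} \<times> U \<rightarrow> E"
    using K(2) V(2) by (force simp: k_def)
  ultimately show ?thesis
    using that K(3,4) V(2) by (auto simp: k_def)
qed

text \<open>The sheets over \<open>T \<times> Y\<close> are the products of the sheets over
  \<open>T\<close> with \<open>Y\<close>. This makes the comparison map onto the square of the base
  a covering.\<close>

lemma covering_space_times:
  fixes p :: "'b::topological_space \<Rightarrow> 'a::topological_space" and Y :: "'c::topological_space set"
  assumes cov: "covering_space E p S"
  shows "covering_space (E \<times> Y) (map_prod p id) (S \<times> Y)"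
  unfolding covering_space_def
proof (intro conjI ballI)
  have p: "continuous_on E p" "p ` E = S" using cov by (auto simp: covering_space_def)
  show "continuous_on (E \<times> Y) (map_prod p id)"
    unfolding map_prod_def case_prod_beta id_def
    by (intro continuous_intros continuous_on_compose2[OF p(1)]) auto
  show "map_prod p id ` (E \<times> Y) = S \<times> Y"
    using p(2) by (simp add: map_prod_image)
  fix z assume "z \<in> S \<times> Y"
  then have "fst z \<in> S" by auto
  from covering_space_evenly[OF cov this] obtain T v where T:
    "openin (top_of_set S) T" "fst z \<in> T" "\<Union>v = E \<inter> p -` T"
    "\<And>u. u \<in> v \<Longrightarrow> openin (top_of_set E) u" "pairwise disjnt v"
    "\<And>u. u \<in> v \<Longrightarrow> \<exists>q. homeomorphism u T p q" by metis
  show "\<exists>W. z \<in> W \<and> openin (top_of_set (S \<times> Y)) W \<and>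
      (\<exists>v. \<Union>v = E \<times> Y \<inter> map_prod p id -` W \<and> (\<forall>u\<in>v. openin (top_of_set (E \<times> Y)) u) \<and>
        pairwise disjnt v \<and> (\<forall>u\<in>v. \<exists>q. homeomorphism u W (map_prod p id) q))"
  proof (intro exI[of _ "T \<times> Y"] exI[of _ "(\<lambda>u. u \<times> Y) ` v"] conjI ballI)
    show "z \<in> T \<times> Y" using T(2) \<open>z \<in> S \<times> Y\<close> by (cases z) auto
    show "openin (top_of_set (S \<times> Y)) (T \<times> Y)" using T(1) by (intro openin_Times) auto
    have "\<Union> ((\<lambda>u. u \<times> Y) ` v) = \<Union>v \<times> Y" by blast
    then show "\<Union> ((\<lambda>u. u \<times> Y) ` v) = E \<times> Y \<inter> map_prod p id -` (T \<times> Y)"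
      unfolding T(3) by auto
    show "pairwise disjnt ((\<lambda>u. u \<times> Y) ` v)"
      using T(5) by (auto simp: pairwise_def disjnt_def)
    fix w assume "w \<in> (\<lambda>u. u \<times> Y) ` v"
    then obtain u where u: "u \<in> v" "w = u \<times> Y" by blast
    show "openin (top_of_set (E \<times> Y)) w"
      unfolding u(2) using T(4)[OF u(1)] by (intro openin_Times) auto
    obtain q where q: "homeomorphism u T p q" using T(6) u by blast
    have "homeomorphism (u \<times> Y) (T \<times> Y) (map_prod p id) (map_prod q id)"
      unfolding homeomorphism_def
    proof (intro conjI)
      show "continuous_on (u \<times> Y) (map_prod p id)" "continuous_on (T \<times> Y) (map_prod q id)"
        unfolding map_prod_def case_prod_beta id_def using q
        by (auto intro!: continuous_intros continuous_on_compose2[of u p] continuous_on_compose2[of T q] simp: homeomorphism_def)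
    qed (use q in \<open>auto simp: homeomorphism_def map_prod_image\<close>)
    then show "\<exists>q. homeomorphism w (T \<times> Y) (map_prod p id) q" using u by blast
  qed
qed


section \<open>Transfer\<close>

lemma standard_simplex_topology:
  "subtopology (powertop_real UNIV) (standard_simplex n) = top_of_set (standard_simplex n)"
  by (simp add: euclidean_product_topology)

lemma singular_simplex_top_of_set:
  "singular_simplex n (top_of_set S) \<sigma> \<longleftrightarrow>
     continuous_on (standard_simplex n) \<sigma> \<and> \<sigma> \<in> standard_simplex n \<rightarrow> S \<and> \<sigma> \<in> extensional (standard_simplex n)"
  unfolding singular_simplex_def standard_simplex_topology
  by (auto simp: continuous_map_in_subtopology)

lemma connected_standard_simplex: "connected (standard_simplex n)"
  using connectedin_standard_simplex[of n] by (simp add: euclidean_product_topology)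

section \<open>Lifts of singular simplices\<close>

definition simplex_lifts ::
  "'b::topological_space set \<Rightarrow> ('b \<Rightarrow> 'a::topological_space) \<Rightarrow> nat \<Rightarrow> ((nat \<Rightarrow> real) \<Rightarrow> 'a) \<Rightarrow> ((nat \<Rightarrow> real) \<Rightarrow> 'b) set" where
  "simplex_lifts E p n \<sigma> = {\<tau>. singular_simplex n (top_of_set E) \<tau> \<and> simplex_map n p \<tau> = \<sigma>}"

lemma simplex_lifts_proj: "\<tau> \<in> simplex_lifts E p n \<sigma> \<Longrightarrow> x \<in> standard_simplex n \<Longrightarrow> p (\<tau> x) = \<sigma> x"
  by (auto simp: simplex_lifts_def simplex_map_def)

text \<open>A simplex contracts to its point \<open>x0\<close>, so \<open>\<sigma>\<close> is the
  end of a homotopy that starts at a constant map. Lifting this homotopy from the constant map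
  \<open>e\<close> gives a lift of \<open>\<sigma>\<close>.\<close>

lemma covering_lift_simplex:
  fixes p :: "'b::topological_space \<Rightarrow> 'a::topological_space"
  assumes cov: "covering_space E p S" and s: "singular_simplex n (top_of_set S) \<sigma>"
    and x0: "x0 \<in> standard_simplex n" and e: "e \<in> E" "p e = \<sigma> x0"
  obtains \<tau> where "\<tau> \<in> simplex_lifts E p n \<sigma>" "\<tau> x0 = e"
proof -
  let ?D = "standard_simplex n"
  have \<sigma>: "continuous_on ?D \<sigma>" "\<sigma> \<in> ?D \<rightarrow> S" "\<sigma> \<in> extensional ?D"
    using s by (auto simp: singular_simplex_top_of_set)
  \<comment> \<open>The straight-line contraction: constantly \<open>x0\<close> at time 0 and the
    identity at time 1.\<close>
  define g where "g = (\<lambda>(z :: real \<times> (nat \<Rightarrow> real)) i. (1 - fst z) * x0 i + fst z * snd z i)"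
  have gD: "g z \<in> ?D" if "z \<in> {0..1} \<times> ?D" for z
    using that convex_standard_simplex[OF x0, of "snd z" "fst z"] by (auto simp: g_def)
  have sndi: "continuous_on ({0..1::real} \<times> ?D) (\<lambda>z. snd z i)" for i
    by (rule continuous_on_product_then_coordinatewise) (intro continuous_intros)
  have "continuous_on ({0..1} \<times> ?D) g"
    unfolding g_def
    by (rule continuous_on_coordinatewise_then_product) (intro continuous_intros sndi)
  then have h: "continuous_on ({0..1} \<times> ?D) (\<lambda>z. \<sigma> (g z))"
    using gD by (intro continuous_on_compose2[OF \<sigma>(1)]) auto
  have hS: "(\<lambda>z. \<sigma> (g z)) \<in> {0..1} \<times> ?D \<rightarrow> S" using gD \<sigma>(2) by blast
  obtain k where k: "continuous_on ({0..1} \<times> ?D) k" "k \<in> {0..1} \<times> ?D \<rightarrow> E"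
    "\<And>y. y \<in> ?D \<Longrightarrow> k (0, y) = e" "\<And>z. z \<in> {0..1} \<times> ?D \<Longrightarrow> p (k z) = \<sigma> (g z)"
    using covering_lift_homotopy[OF cov h hS, of "\<lambda>_. e"] e by (auto simp: g_def)
  define \<tau> where "\<tau> = restrict (\<lambda>y. k (1, y)) ?D"
  have "continuous_on ?D (\<lambda>y. k (1, y))"
    by (auto intro!: continuous_on_compose2[OF k(1)] continuous_intros)
  then have "continuous_on ?D \<tau>"
    by (rule continuous_on_eq) (simp add: \<tau>_def)
  then have "singular_simplex n (top_of_set E) \<tau>"
    using k(2) by (auto simp: singular_simplex_top_of_set \<tau>_def)
  moreover have "simplex_map n p \<tau> = \<sigma>"
    using k(4) \<sigma>(3) by (auto simp: simplex_map_def \<tau>_def g_def restrict_def fun_eq_iff extensional_def)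
  moreover have "\<tau> x0 = e"
  proof -
    \<comment> \<open>The contraction does not move \<open>x0\<close>, so the lifted path over it is
      a lift of a constant path and stays at \<open>e\<close>.\<close>
    have gx0: "g (t, x0) = x0" for t by (auto simp: g_def fun_eq_iff algebra_simps)
    have "k (1, x0) = e"
    proof (rule covering_lift_unique[OF cov, of "{0..1}" 0 1 "\<lambda>t. k (t, x0)" "\<lambda>_. e"])
      show "continuous_on {0..1} (\<lambda>t. k (t, x0))"
        using x0 by (auto intro!: continuous_on_compose2[OF k(1)] continuous_intros)
    qed (use x0 e k gx0 in auto)
    then show ?thesis using x0 by (simp add: \<tau>_def)
  qed
  ultimately show ?thesis using that by (auto simp: simplex_lifts_def)
qed

text \<open>A lift is determined by its value at one point, as the simplex is connected, and every
  point of the fibre is such a value. In particular the lifts can be counted by a fibre.\<close>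

lemma bij_betw_simplex_lifts:
  fixes p :: "'b::topological_space \<Rightarrow> 'a::topological_space"
  assumes cov: "covering_space E p S" and s: "singular_simplex n (top_of_set S) \<sigma>"
    and x0: "x0 \<in> standard_simplex n"
  shows "bij_betw (\<lambda>\<tau>. \<tau> x0) (simplex_lifts E p n \<sigma>) {e \<in> E. p e = \<sigma> x0}"
  unfolding bij_betw_def
proof (intro conjI inj_onI subset_antisym)
  fix \<tau> \<tau>' assume \<tau>: "\<tau> \<in> simplex_lifts E p n \<sigma>" "\<tau>' \<in> simplex_lifts E p n \<sigma>" "\<tau> x0 = \<tau>' x0"
  have "\<tau> x = \<tau>' x" if "x \<in> standard_simplex n" for x
  proof (rule covering_lift_unique[OF cov connected_standard_simplex x0 that])
    show "p (\<tau> y) = p (\<tau>' y)" if "y \<in> standard_simplex n" for y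
      using simplex_lifts_proj[OF \<tau>(1) that] simplex_lifts_proj[OF \<tau>(2) that] by simp
  qed (use \<tau> in \<open>auto simp: simplex_lifts_def singular_simplex_top_of_set\<close>)
  then show "\<tau> = \<tau>'"
    using \<tau>(1,2) by (auto simp: simplex_lifts_def singular_simplex_top_of_set intro: extensionalityI)
next
  show "(\<lambda>\<tau>. \<tau> x0) ` simplex_lifts E p n \<sigma> \<subseteq> {e \<in> E. p e = \<sigma> x0}"
    using x0 by (auto simp: simplex_lifts_def singular_simplex_top_of_set simplex_map_def)
  show "{e \<in> E. p e = \<sigma> x0} \<subseteq> (\<lambda>\<tau>. \<tau> x0) ` simplex_lifts E p n \<sigma>"
    using covering_lift_simplex[OF cov s x0] by (smt (verit) image_iff mem_Collect_eq subsetI)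
qed

text \<open>A point \<open>y\<close> of the small simplex and its image \<open>?x\<close> in the
  large one see the same fibre. Evaluation there is bijective on both sets of lifts and compatible
  with the face map, which is therefore bijective too.\<close>

lemma bij_betw_face_simplex_lifts:
  fixes p :: "'b::topological_space \<Rightarrow> 'a::topological_space"
  assumes cov: "covering_space E p S" and s: "singular_simplex (Suc n) (top_of_set S) \<sigma>" and k: "k \<le> Suc n"
  shows "bij_betw (singular_face (Suc n) k) (simplex_lifts E p (Suc n) \<sigma>) (simplex_lifts E p n (singular_face (Suc n) k \<sigma>))"
proof -
  obtain y where y: "y \<in> standard_simplex n" using nonempty_standard_simplex by blast
  let ?x = "simplical_face k y"
  have x: "?x \<in> standard_simplex (Suc n)" using simplical_face_in_standard_simplex_Suc[OF y k] .
  have sf: "singular_simplex n (top_of_set S) (singular_face (Suc n) k \<sigma>)"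
    using singular_simplex_singular_face[OF s, of k] k by simp
  have ev: "singular_face (Suc n) k \<tau> y = \<tau> ?x" for \<tau> :: "(nat \<Rightarrow> real) \<Rightarrow> 'c"
    using y by (simp add: singular_face_def)
  have b1: "bij_betw (\<lambda>\<tau>. \<tau> ?x) (simplex_lifts E p (Suc n) \<sigma>) {e \<in> E. p e = \<sigma> ?x}"
    by (rule bij_betw_simplex_lifts[OF cov s x])
  have b2: "bij_betw (\<lambda>\<tau>. \<tau> y) (simplex_lifts E p n (singular_face (Suc n) k \<sigma>)) {e \<in> E. p e = \<sigma> ?x}"
    using bij_betw_simplex_lifts[OF cov sf y] by (simp add: singular_face_def y)
  have maps: "singular_face (Suc n) k ` simplex_lifts E p (Suc n) \<sigma> \<subseteq> simplex_lifts E p n (singular_face (Suc n) k \<sigma>)"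
  proof
    fix \<rho> assume "\<rho> \<in> singular_face (Suc n) k ` simplex_lifts E p (Suc n) \<sigma>"
    then obtain \<tau> where \<tau>: "singular_simplex (Suc n) (top_of_set E) \<tau>" "simplex_map (Suc n) p \<tau> = \<sigma>"
      "\<rho> = singular_face (Suc n) k \<tau>" by (auto simp: simplex_lifts_def)
    have "simplex_map n p (singular_face (Suc n) k \<tau>) = singular_face (Suc n) k \<sigma>"
      unfolding \<tau>(2)[symmetric] using k
      by (auto simp: singular_face_def simplex_map_def fun_eq_iff restrict_def simplical_face_in_standard_simplex_Suc)
    then show "\<rho> \<in> simplex_lifts E p n (singular_face (Suc n) k \<sigma>)"
      using singular_simplex_singular_face[OF \<tau>(1), of k] k \<tau>(3) by (simp add: simplex_lifts_def)
  qed
  have "bij_betw (\<lambda>\<tau>. singular_face (Suc n) k \<tau> y) (simplex_lifts E p (Suc n) \<sigma>) {e \<in> E. p e = \<sigma> ?x}"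
    using b1 unfolding ev .
  then have b3: "bij_betw ((\<lambda>\<tau>. \<tau> y) \<circ> singular_face (Suc n) k) (simplex_lifts E p (Suc n) \<sigma>) {e \<in> E. p e = \<sigma> ?x}"
    by (simp add: o_def)
  show ?thesis
    using bij_betw_comp_iff2[OF b2 maps] b3 by blast
qed

text \<open>An average rather than the usual sum over lifts, so that it is a left inverse of the
  pullback and not merely a multiple of one.\<close>

definition transfer ::
  "'b::topological_space set \<Rightarrow> 'a::topological_space set \<Rightarrow> ('b \<Rightarrow> 'a) \<Rightarrow> 'b cochain \<Rightarrow> 'a cochain" where
  "transfer E S p v = (\<lambda>n \<sigma>. if singular_simplex n (top_of_set S) \<sigma>
     then (\<Sum>\<tau>\<in>simplex_lifts E p n \<sigma>. v n \<tau>) / of_nat (card (simplex_lifts E p n \<sigma>)) else 0)"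

lemma transfer_in_cochains:
  assumes "v \<in> cochains (top_of_set E)"
  shows "transfer E S p v \<in> cochains (top_of_set S)"
proof -
  have "{n. \<exists>\<sigma>. transfer E S p v n \<sigma> \<noteq> 0} \<subseteq> {n. \<exists>\<sigma>. v n \<sigma> \<noteq> 0}"
  proof clarify
    fix n \<sigma> assume "transfer E S p v n \<sigma> \<noteq> 0"
    then have "(\<Sum>\<tau>\<in>simplex_lifts E p n \<sigma>. v n \<tau>) \<noteq> 0"
      by (auto simp: transfer_def split: if_splits)
    then show "\<exists>\<sigma>. v n \<sigma> \<noteq> 0"
      by (force elim: sum.not_neutral_contains_not_neutral)
  qed
  then have "finite {n. \<exists>\<sigma>. transfer E S p v n \<sigma> \<noteq> 0}"
    by (rule finite_subset) (use assms in \<open>auto simp: cochains_def\<close>)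
  then show ?thesis
    unfolding cochains_def by (simp add: transfer_def)
qed

text \<open>Taking a face is a bijection between the lifts of \<open>\<sigma>\<close> and the lifts
  of its face, so the averages over both have the same denominator and the faces can be taken
  upstairs.\<close>

lemma coboundary_transfer:
  fixes p :: "'b::topological_space \<Rightarrow> 'a::topological_space"
  assumes cov: "covering_space E p S"
  shows "coboundary (top_of_set S) (transfer E S p v) = transfer E S p (coboundary (top_of_set E) v)"
proof (intro ext)
  fix n \<sigma>
  show "coboundary (top_of_set S) (transfer E S p v) n \<sigma> = transfer E S p (coboundary (top_of_set E) v) n \<sigma>"
  proof (cases "n = 0 \<or> \<not> singular_simplex n (top_of_set S) \<sigma>")
    case True
    then show ?thesis
      by (auto simp: coboundary_eq_0 transfer_def)
  next
    case False
    then obtain m where n: "n = Suc m" and s: "singular_simplex (Suc m) (top_of_set S) \<sigma>"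
      by (cases n) auto
    let ?L = "simplex_lifts E p (Suc m) \<sigma>"
    have "transfer E S p v m (singular_face (Suc m) k \<sigma>)
        = (\<Sum>\<tau>\<in>?L. v m (singular_face (Suc m) k \<tau>)) / of_nat (card ?L)" if k: "k \<le> Suc m" for k
    proof -
      note b = bij_betw_face_simplex_lifts[OF cov s k]
      have "singular_simplex m (top_of_set S) (singular_face (Suc m) k \<sigma>)"
        using singular_simplex_singular_face[OF s, of k] k by simp
      then show ?thesis
        unfolding transfer_def using sum.reindex_bij_betw[OF b, of "v m"] bij_betw_same_card[OF b] by simp
    qed
    then have "coboundary (top_of_set S) (transfer E S p v) n \<sigma>
       = (\<Sum>k\<le>Suc m. (-1)^k * ((\<Sum>\<tau>\<in>?L. v m (singular_face (Suc m) k \<tau>)) / of_nat (card ?L)))"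
      unfolding n coboundary_Suc[OF s] by (intro sum.cong) auto
    also have "\<dots> = (\<Sum>k\<le>Suc m. \<Sum>\<tau>\<in>?L. (-1)^k * v m (singular_face (Suc m) k \<tau>)) / of_nat (card ?L)"
      by (simp only: sum_divide_distrib sum_distrib_left times_divide_eq_right)
    also have "(\<Sum>k\<le>Suc m. \<Sum>\<tau>\<in>?L. (-1)^k * v m (singular_face (Suc m) k \<tau>))
       = (\<Sum>\<tau>\<in>?L. \<Sum>k\<le>Suc m. (-1)^k * v m (singular_face (Suc m) k \<tau>))"
      by (rule sum.swap)
    also have "\<dots> = (\<Sum>\<tau>\<in>?L. coboundary (top_of_set E) v (Suc m) \<tau>)"
      by (rule sum.cong) (simp_all add: simplex_lifts_def coboundary_Suc del: sum.atMost_Suc)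
    finally show ?thesis
      using s by (simp add: transfer_def n)
  qed
qed

lemma transfer_pullback:
  fixes p :: "'b::topological_space \<Rightarrow> 'a::topological_space"
  assumes cov: "covering_space E p S" and fin: "\<And>b. b \<in> S \<Longrightarrow> finite {e \<in> E. p e = b}"
    and u: "u \<in> cochains (top_of_set S)"
  shows "transfer E S p (pullback (top_of_set E) p u) = u"
proof (intro ext)
  fix n \<sigma>
  show "transfer E S p (pullback (top_of_set E) p u) n \<sigma> = u n \<sigma>"
  proof (cases "singular_simplex n (top_of_set S) \<sigma>")
    case s: True
    let ?L = "simplex_lifts E p n \<sigma>"
    obtain x where x: "x \<in> standard_simplex n" using nonempty_standard_simplex by blast
    then have \<sigma>x: "\<sigma> x \<in> S" using s by (auto simp: singular_simplex_top_of_set)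
    then obtain e where "e \<in> E" "p e = \<sigma> x" using cov by (auto simp: covering_space_def)
    then have "{e \<in> E. p e = \<sigma> x} \<noteq> {}" by blast
    \<comment> \<open>The lifts correspond to the fibre over \<open>\<sigma> x\<close>, which is
      nonempty because \<open>p\<close> is onto and finite by hypothesis, so the division is
      genuine.\<close>
    then have "card ?L \<noteq> 0"
      using bij_betw_same_card[OF bij_betw_simplex_lifts[OF cov s x]] fin[OF \<sigma>x] by simp
    moreover have "(\<Sum>\<tau>\<in>?L. pullback (top_of_set E) p u n \<tau>) = of_nat (card ?L) * u n \<sigma>"
      by (simp add: pullback_def simplex_lifts_def)
    ultimately show ?thesis
      using s by (simp add: transfer_def)
  next
    case False
    then show ?thesis using u by (simp add: transfer_def cochains_def)
  qed
qed

text \<open>Averaging a primitive of the pullback gives a primitive of \<open>u\<close>, since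
  averaging commutes with the coboundary and undoes the pullback.\<close>

theorem coboundaries_if_pullback_coboundaries:
  fixes p :: "'b::topological_space \<Rightarrow> 'a::topological_space"
  assumes cov: "covering_space E p S" and fin: "\<And>b. b \<in> S \<Longrightarrow> finite {e \<in> E. p e = b}"
    and u: "u \<in> cochains (top_of_set S)"
    and pu: "pullback (top_of_set E) p u \<in> coboundaries (top_of_set E)"
  shows "u \<in> coboundaries (top_of_set S)"
proof -
  obtain v where v: "v \<in> cochains (top_of_set E)" "pullback (top_of_set E) p u = coboundary (top_of_set E) v"
    using pu by (auto simp: coboundaries_def)
  have "u = coboundary (top_of_set S) (transfer E S p v)"
    using transfer_pullback[OF cov fin u] coboundary_transfer[OF cov] v(2) by metis
  then show ?thesis
    using transfer_in_cochains[OF v(1)] by (auto simp: coboundaries_def)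
qed


section \<open>Separability of metrizable CW complexes\<close>

text \<open>Inside the countable power of the real line the disc is a closed subset of the cube with
  sides \<open>{-1..1}\<close>, which is compact as a product of compact intervals.\<close>

lemma compact_unit_disc: "compactin (Euclidean_space n) (unit_disc n)"
proof -
  let ?P = "powertop_real UNIV"
  have "closedin ?P (unit_disc n)"
  proof -
    have eq: "unit_disc n = (\<Inter>i \<in> {n..}. {x. x \<in> topspace ?P \<and> x i \<in> {0}}) \<inter>
        {x \<in> topspace ?P. (\<Sum>i<n. (x i)\<^sup>2) \<in> {..1}}"
      by (auto simp: unit_disc_def topspace_Euclidean_space)
    show ?thesis
      unfolding eq
      by (rule closedin_Int closedin_Inter continuous_map_sum continuous_map_real_pow
             continuous_map_product_projection closedin_continuous_map_preimage | force | clarify)+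
  qed
  moreover have "unit_disc n \<subseteq> UNIV \<rightarrow>\<^sub>E {-1..1}"
  proof
    fix x assume x: "x \<in> unit_disc n"
    have "\<bar>x i\<bar> \<le> 1" for i
    proof (cases "i < n")
      case True
      then have "(x i)\<^sup>2 \<le> (\<Sum>i<n. (x i)\<^sup>2)"
        by (intro member_le_sum) auto
      then have "(x i)\<^sup>2 \<le> 1" using x by (auto simp: unit_disc_def)
      then show ?thesis by (simp add: abs_square_le_1)
    next
      case False
      then show ?thesis using x by (auto simp: unit_disc_def topspace_Euclidean_space)
    qed
    then show "x \<in> UNIV \<rightarrow>\<^sub>E {-1..1}" by (auto simp: abs_le_iff minus_le_iff)
  qed
  moreover have "compactin ?P (UNIV \<rightarrow>\<^sub>E {-1..1})"
    by (simp add: compactin_PiE)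
  ultimately have "compactin ?P (unit_disc n)"
    using closed_compactin by blast
  then show ?thesis
    by (auto simp: Euclidean_space_def compactin_subtopology unit_disc_def)
qed

text \<open>If infinitely many cells accumulate at \<open>x\<close>, one point from each of a sequence of distinct
  cells converging to \<open>x\<close> gives a set that meets every closed cell in a finite set, hence is
  closed in the weak topology.\<close>

lemma CW_locally_finite:
  fixes X :: "'a::metric_space set"
  assumes C: "CW_structure (top_of_set X) C" and x: "x \<in> X"
  obtains N where "openin (top_of_set X) N" "x \<in> N"
    "finite {c \<in> C. snd c ` open_unit_disc (fst c) \<inter> N \<noteq> {}}"
proof (rule ccontr)
  let ?o = "\<lambda>c. snd c ` open_unit_disc (fst c)" and ?k = "\<lambda>c. snd c ` unit_disc (fst c)"
  note thesisI = that
  assume "\<not> thesis"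
  then have inf: "infinite {c \<in> C. ?o c \<inter> N \<noteq> {}}" if "openin (top_of_set X) N" "x \<in> N" for N
    using that thesisI by blast
  have cov: "(\<Union>c\<in>C. ?o c) = X" and
    disj: "\<And>c d. c \<in> C \<Longrightarrow> d \<in> C \<Longrightarrow> c \<noteq> d \<Longrightarrow> ?o c \<inter> ?o d = {}" and
    bd: "\<And>c. c \<in> C \<Longrightarrow> \<exists>F\<subseteq>C. finite F \<and> snd c ` (unit_disc (fst c) - open_unit_disc (fst c)) \<subseteq> (\<Union>d\<in>F. ?o d)" and
    weak: "\<And>A. A \<subseteq> X \<Longrightarrow> (\<And>c. c \<in> C \<Longrightarrow> closedin (top_of_set X) (A \<inter> ?k c)) \<Longrightarrow> closedin (top_of_set X) A"
  proof -
    note CW = C[unfolded CW_structure_def case_prod_beta topspace_euclidean_subtopology,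
        THEN conjunct2, THEN conjunct2]
    note CW = CW[THEN conjunct1] CW[THEN conjunct2, THEN conjunct1]
      CW[THEN conjunct2, THEN conjunct2, THEN conjunct1]
      CW[THEN conjunct2, THEN conjunct2, THEN conjunct2]
    show "(\<Union>c\<in>C. ?o c) = X" by (rule CW(1))
    show "?o c \<inter> ?o d = {}" if "c \<in> C" "d \<in> C" "c \<noteq> d" for c d
      using pairwiseD[OF CW(2) that] by (simp add: disjnt_def)
    show "\<exists>F\<subseteq>C. finite F \<and> snd c ` (unit_disc (fst c) - open_unit_disc (fst c)) \<subseteq> (\<Union>d\<in>F. ?o d)"
      if "c \<in> C" for c
      using bspec[OF CW(3) that] by blast
    show "closedin (top_of_set X) A"
      if "A \<subseteq> X" "\<And>c. c \<in> C \<Longrightarrow> closedin (top_of_set X) (A \<inter> ?k c)" for A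
      using CW(4) that by blast
  qed
  obtain c0 where c0: "c0 \<in> C" "x \<in> ?o c0" using cov x by blast
  \<comment> \<open>Excluding the cell \<open>c0\<close> that contains \<open>x\<close> prepares the
    contradiction: a closed \<open>range a\<close> would contain its limit \<open>x\<close>, placing
    \<open>x\<close> in a chosen cell other than \<open>c0\<close>.\<close>
  define P where "P = (\<lambda>(f :: nat \<Rightarrow> nat \<times> ((nat \<Rightarrow> real) \<Rightarrow> 'a)) m c. c \<in> C \<and> c \<noteq> c0 \<and> (\<forall>i<m. c \<noteq> f i) \<and>
     ?o c \<inter> (X \<inter> ball x (inverse (Suc m))) \<noteq> {})"
  have "\<exists>f. \<forall>m. P f m (f m)"
  proof (rule dependent_wellorder_choice)
    fix m and f :: "nat \<Rightarrow> nat \<times> ((nat \<Rightarrow> real) \<Rightarrow> 'a)"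
    have "infinite {c \<in> C. ?o c \<inter> (X \<inter> ball x (inverse (Suc m))) \<noteq> {}}"
      by (rule inf) (use x in \<open>auto intro: openin_open_Int\<close>)
    then have "infinite ({c \<in> C. ?o c \<inter> (X \<inter> ball x (inverse (Suc m))) \<noteq> {}} - (insert c0 (f ` {..<m})))"
      by (intro Diff_infinite_finite) auto
    from infinite_imp_nonempty[OF this]
    obtain c where c: "c \<in> C" "?o c \<inter> (X \<inter> ball x (inverse (Suc m))) \<noteq> {}" "c \<notin> insert c0 (f ` {..<m})"
      by blast
    then have "\<forall>i<m. c \<noteq> f i" by blast
    with c have "P f m c" unfolding P_def by blast
    then show "\<exists>c. P f m c" by blast
  qed (simp add: P_def)
  then obtain f where f: "\<And>m. P f m (f m)" by blast
  have fC: "f m \<in> C" "f m \<noteq> c0" for m using f[of m] by (auto simp: P_def)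
  have inj: "f i \<noteq> f j" if "i \<noteq> j" for i j
    using f[of i] f[of j] that by (cases i j rule: linorder_cases) (auto simp: P_def)
  have "\<forall>m. \<exists>a. a \<in> ?o (f m) \<and> a \<in> X \<and> a \<in> ball x (inverse (Suc m))"
  proof
    fix m
    show "\<exists>a. a \<in> ?o (f m) \<and> a \<in> X \<and> a \<in> ball x (inverse (Suc m))"
      using f[of m] unfolding P_def by blast
  qed
  then obtain a where a: "\<And>m. a m \<in> ?o (f m)" "\<And>m. a m \<in> X" "\<And>m. a m \<in> ball x (inverse (Suc m))"
    by metis
  have fin: "finite (range a \<inter> ?o d)" if d: "d \<in> C" for d
  proof -
    have "range a \<inter> ?o d \<subseteq> a ` {m. f m = d}"
    proof
      fix z assume z: "z \<in> range a \<inter> ?o d"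
      then obtain m where m: "z = a m" by blast
      then have "?o (f m) \<inter> ?o d \<noteq> {}" using a(1)[of m] z by blast
      then have "f m = d" using disj[OF fC(1)[of m] d] by argo
      then show "z \<in> a ` {m. f m = d}" using m by simp
    qed
    moreover have "finite {m. f m = d}"
    proof -
      have "{m. f m = d} \<subseteq> {LEAST m. f m = d}" using inj by (smt (verit, best) LeastI mem_Collect_eq singletonI subsetI)
      then show ?thesis using finite_subset by blast
    qed
    ultimately show ?thesis by (meson finite_imageI finite_subset)
  qed
  have "closedin (top_of_set X) (range a)"
  proof (rule weak)
    fix c assume c: "c \<in> C"
    obtain F where F: "F \<subseteq> C" "finite F" "snd c ` (unit_disc (fst c) - open_unit_disc (fst c)) \<subseteq> (\<Union>d\<in>F. ?o d)"
      using bd[OF c] by blast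
    have "range a \<inter> ?k c \<subseteq> (\<Union>d\<in>insert c F. range a \<inter> ?o d)" using F(3) by auto
    moreover have "finite (\<Union>d\<in>insert c F. range a \<inter> ?o d)"
    proof (rule finite_UN_I)
      show "finite (insert c F)" using F(2) by simp
      show "finite (range a \<inter> ?o d)" if "d \<in> insert c F" for d
        by (rule fin) (use that F(1) c in auto)
    qed
    ultimately have "finite (range a \<inter> ?k c)" using finite_subset by blast
    then have "closed (range a \<inter> ?k c)" by (rule finite_imp_closed)
    then show "closedin (top_of_set X) (range a \<inter> ?k c)"
      using a(2) by (auto intro!: closed_subset)
  qed (use a in auto)
  moreover have "a \<longlonglongrightarrow> x"
  proof (rule metric_tendsto_imp_tendsto[OF LIMSEQ_inverse_real_of_nat])
    show "\<forall>\<^sub>F m in sequentially. dist (a m) x \<le> dist (inverse (real (Suc m))) 0"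
      using a(3) by (intro always_eventually) (auto simp: dist_commute less_imp_le)
  qed
  ultimately have "x \<in> range a"
    using x unfolding closedin_closed by (metis IntE IntI closed_sequentially rangeI)
  then obtain m where "x = a m" by blast
  then have "?o (f m) \<inter> ?o c0 \<noteq> {}" using a(1)[of m] c0 by blast
  then show False using disj[OF fC(1)[of m] c0(1) fC(2)[of m]] by simp
qed

text \<open>The dense set is the union of finite nets of mesh \<open>1 / (m + 1)\<close>.\<close>

lemma compact_metric_separable:
  fixes K :: "'a::metric_space set"
  assumes "compact K"
  obtains S where "countable S" "S \<subseteq> K" "K \<subseteq> closure S"
proof -
  have "\<forall>m. \<exists>k. finite k \<and> k \<subseteq> K \<and> K \<subseteq> (\<Union>x\<in>k. ball x (inverse (real (Suc m))))"
    using seq_compact_imp_totally_bounded[OF compact_imp_seq_compact[OF assms]] by simp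
  then obtain k where k: "\<And>m. finite (k m)" "\<And>m. k m \<subseteq> K"
    "\<And>m. K \<subseteq> (\<Union>x\<in>k m. ball x (inverse (real (Suc m))))" by metis
  show ?thesis
  proof
    show "countable (\<Union>m. k m)" using k(1) by (auto intro: countable_finite)
    show "(\<Union>m. k m) \<subseteq> K" using k(2) by blast
    show "K \<subseteq> closure (\<Union>m. k m)"
    proof
      fix y assume y: "y \<in> K"
      show "y \<in> closure (\<Union>m. k m)"
        unfolding closure_approachable
      proof (intro allI impI)
        fix e :: real assume "e > 0"
        then obtain m where m: "inverse (real (Suc m)) < e" using reals_Archimedean by blast
        obtain z where "z \<in> k m" "y \<in> ball z (inverse (real (Suc m)))" using k(3)[of m] y by auto
        moreover from this have "dist z y < e" using m by simp
        ultimately show "\<exists>z\<in>\<Union>m. k m. dist z y < e" by blast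
      qed
    qed
  qed
qed

text \<open>Connectedness bounds the number of cells. A family of cells grown from one cell by
  adding all cells near the closed cells already present is countable, and its union is open and
  closed, hence all of \<open>X\<close>; each closed cell is compact and so separable.\<close>

theorem CW_complex_separable:
  fixes X :: "'a::metric_space set"
  assumes CW: "CW_complex (top_of_set X)" and conn: "connected X"
  obtains S where "countable S" "S \<subseteq> X" "X \<subseteq> closure S"
proof (cases "X = {}")
  case True
  then show ?thesis using that[of "{}"] by simp
next
  case False
  obtain C where C: "CW_structure (top_of_set X) C" using CW by (auto simp: CW_complex_def)
  let ?o = "\<lambda>c. snd c ` open_unit_disc (fst c)" and ?k = "\<lambda>c. snd c ` unit_disc (fst c)"
  have cov: "(\<Union>c\<in>C. ?o c) = X" and
    cont: "\<And>c. c \<in> C \<Longrightarrow> continuous_map (subtopology (Euclidean_space (fst c)) (unit_disc (fst c))) (top_of_set X) (snd c)"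
    using C unfolding CW_structure_def by (auto simp: case_prod_beta)
  have ok: "?o c \<subseteq> ?k c" for c by (auto simp: open_unit_disc_def unit_disc_def)
  have kcomp: "compact (?k c)" "?k c \<subseteq> X" if "c \<in> C" for c
  proof -
    have "compactin (subtopology (Euclidean_space (fst c)) (unit_disc (fst c))) (unit_disc (fst c))"
      by (simp add: compactin_subtopology compact_unit_disc)
    then have "compactin (top_of_set X) (?k c)"
      using image_compactin cont[OF that] by blast
    then show "compact (?k c)" "?k c \<subseteq> X" by (auto simp: compactin_subtopology)
  qed
  have "\<forall>x\<in>X. \<exists>G. open G \<and> x \<in> G \<and> finite {c \<in> C. ?o c \<inter> (X \<inter> G) \<noteq> {}}"
  proof
    fix x assume "x \<in> X"
    obtain N where N: "openin (top_of_set X) N" "x \<in> N" "finite {c \<in> C. ?o c \<inter> N \<noteq> {}}"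
      by (rule CW_locally_finite[OF C \<open>x \<in> X\<close>])
    then obtain G where "open G" "N = X \<inter> G" by (auto simp: openin_open)
    then show "\<exists>G. open G \<and> x \<in> G \<and> finite {c \<in> C. ?o c \<inter> (X \<inter> G) \<noteq> {}}"
      using N(2,3) by (intro exI[of _ G]) simp
  qed
  from bchoice[OF this] obtain G where "\<forall>x\<in>X. open (G x) \<and> x \<in> G x \<and> finite {c \<in> C. ?o c \<inter> (X \<inter> G x) \<noteq> {}}"
    by (elim exE)
  then have G: "\<And>x. x \<in> X \<Longrightarrow> open (G x)" "\<And>x. x \<in> X \<Longrightarrow> x \<in> G x"
    "\<And>x. x \<in> X \<Longrightarrow> finite {c \<in> C. ?o c \<inter> (X \<inter> G x) \<noteq> {}}"
    by simp_all
  \<comment> \<open>Local finiteness at points passes to the closed cells because these are compact: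
    finitely many of the neighbourhoods \<open>G x\<close> cover one.\<close>
  have "\<forall>c\<in>C. \<exists>N. open N \<and> ?k c \<subseteq> N \<and> finite {d \<in> C. ?o d \<inter> (X \<inter> N) \<noteq> {}}"
  proof
    fix c assume c: "c \<in> C"
    have "open (G x)" if "x \<in> ?k c" for x
      by (rule G(1)[OF subsetD[OF kcomp(2)[OF c] that]])
    moreover have "?k c \<subseteq> (\<Union>x\<in>?k c. G x)"
    proof
      fix x assume "x \<in> ?k c"
      then show "x \<in> (\<Union>x\<in>?k c. G x)"
        using G(2)[OF subsetD[OF kcomp(2)[OF c]]] by (intro UN_I)
    qed
    ultimately obtain I where I: "I \<subseteq> ?k c" "finite I" "?k c \<subseteq> (\<Union>x\<in>I. G x)"
      by (rule compactE_image[OF kcomp(1)[OF c]])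
    have "{d \<in> C. ?o d \<inter> (X \<inter> (\<Union>x\<in>I. G x)) \<noteq> {}} = (\<Union>x\<in>I. {d \<in> C. ?o d \<inter> (X \<inter> G x) \<noteq> {}})" by blast
    moreover have "finite {d \<in> C. ?o d \<inter> (X \<inter> G x) \<noteq> {}}" if "x \<in> I" for x
      using subsetD[OF kcomp(2)[OF c] subsetD[OF I(1) that]] by (rule G(3))
    ultimately have "finite {d \<in> C. ?o d \<inter> (X \<inter> (\<Union>x\<in>I. G x)) \<noteq> {}}"
      using I(2) by simp
    moreover have "open (\<Union>x\<in>I. G x)" using I G(1) kcomp(2)[OF c] by blast
    ultimately show "\<exists>N. open N \<and> ?k c \<subseteq> N \<and> finite {d \<in> C. ?o d \<inter> (X \<inter> N) \<noteq> {}}"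
      using I(3) by blast
  qed
  from bchoice[OF this] obtain N where
    "\<forall>c\<in>C. open (N c) \<and> ?k c \<subseteq> N c \<and> finite {d \<in> C. ?o d \<inter> (X \<inter> N c) \<noteq> {}}"
    by (elim exE)
  then have N: "\<And>c. c \<in> C \<Longrightarrow> open (N c)" "\<And>c. c \<in> C \<Longrightarrow> ?k c \<subseteq> N c"
    "\<And>c. c \<in> C \<Longrightarrow> finite {d \<in> C. ?o d \<inter> (X \<inter> N c) \<noteq> {}}"
    by simp_all
  obtain c0 where c0: "c0 \<in> C" using cov False by blast
  \<comment> \<open>Each cell has only finitely many neighbours in this sense, so every stage of the
    iteration is finite and their union is countable.\<close>
  define step where "step = (\<lambda>\<K>. \<Union>c\<in>\<K>. {d \<in> C. ?o d \<inter> (X \<inter> N c) \<noteq> {}})"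
  define \<K> where "\<K> = (\<Union>m. (step ^^ m) {c0})"
  have stepm: "finite ((step ^^ m) {c0}) \<and> (step ^^ m) {c0} \<subseteq> C" for m
  proof (induction m)
    case (Suc m)
    then show ?case using N(3) by (auto simp: step_def)
  qed (simp add: c0)
  have countK: "countable \<K>" and KC: "\<K> \<subseteq> C" and c0K: "c0 \<in> \<K>"
    using stepm unfolding \<K>_def by (auto intro: countable_finite) (metis funpow_0 singletonI)
  have stepK: "d \<in> \<K>" if cd: "c \<in> \<K>" "d \<in> C" "?o d \<inter> (X \<inter> N c) \<noteq> {}" for c d
  proof -
    obtain m where "c \<in> (step ^^ m) {c0}" using cd(1) unfolding \<K>_def by blast
    then have "d \<in> (step ^^ Suc m) {c0}" using cd(2,3) unfolding funpow.simps comp_apply step_def by blast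
    then show ?thesis unfolding \<K>_def by blast
  qed
  define T where "T = (\<Union>c\<in>\<K>. ?o c)"
  \<comment> \<open>This second description shows that \<open>T\<close> is open: a cell meeting some
    \<open>N c\<close> with \<open>c\<close> in the family was itself added at the next
    stage.\<close>
  have TN: "T = (\<Union>c\<in>\<K>. X \<inter> N c)"
  proof
    show "T \<subseteq> (\<Union>c\<in>\<K>. X \<inter> N c)"
      unfolding T_def
    proof (rule UN_mono[OF order_refl])
      fix c assume "c \<in> \<K>"
      then have "c \<in> C" using KC by blast
      then show "?o c \<subseteq> X \<inter> N c"
        using ok[of c] kcomp(2)[of c] N(2)[of c] by (meson Int_greatest order_trans)
    qed
    show "(\<Union>c\<in>\<K>. X \<inter> N c) \<subseteq> T"
    proof
      fix y assume "y \<in> (\<Union>c\<in>\<K>. X \<inter> N c)"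
      then obtain c where c: "c \<in> \<K>" "y \<in> X" "y \<in> N c" by blast
      then obtain d where d: "d \<in> C" "y \<in> ?o d" using cov by blast
      then have "d \<in> \<K>" using stepK[OF c(1) d(1)] c by blast
      then show "y \<in> T" using d by (auto simp: T_def)
    qed
  qed
  have "openin (top_of_set X) T"
    unfolding TN using N(1) KC by (intro openin_Union) (auto intro: openin_open_Int)
  moreover have "closedin (top_of_set X) T"
  proof -
    have "openin (top_of_set X) (X - T)"
    proof (subst openin_subopen, intro ballI)
      fix y assume y: "y \<in> X - T"
      \<comment> \<open>Only finitely many cells of the family meet \<open>G y\<close>. Their closed
        cells are compact, so their union is closed, and they miss \<open>y\<close> because they lie
        in the sets \<open>N c\<close>, whose traces on \<open>X\<close> are contained in
        \<open>T\<close>.\<close>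
      let ?J = "{c \<in> \<K>. ?o c \<inter> (X \<inter> G y) \<noteq> {}}"
      have "finite {c \<in> C. ?o c \<inter> (X \<inter> G y) \<noteq> {}}" using G(3) y by blast
      then have "finite ?J" by (rule rev_finite_subset) (use KC in auto)
      moreover have "closed (?k c)" if "c \<in> ?J" for c
        using that subsetD[OF KC, of c] by (intro compact_imp_closed kcomp(1)) simp
      ultimately have "closed (\<Union>c\<in>?J. ?k c)"
        by (intro closed_UN ballI)
      then have "openin (top_of_set X) (X \<inter> (G y - (\<Union>c\<in>?J. ?k c)))"
        using G(1) y by (intro openin_open_Int open_Diff) auto
      moreover have "y \<in> X \<inter> (G y - (\<Union>c\<in>?J. ?k c))"
      proof -
        have "y \<notin> ?k c" if "c \<in> \<K>" for c
        proof
          assume "y \<in> ?k c"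
          then have "y \<in> N c" using N(2)[OF subsetD[OF KC that]] by (rule subsetD[rotated])
          then show False using y that unfolding TN by blast
        qed
        then show ?thesis using y G(2) by auto
      qed
      moreover have "X \<inter> (G y - (\<Union>c\<in>?J. ?k c)) \<subseteq> X - T"
      proof
        fix z assume z: "z \<in> X \<inter> (G y - (\<Union>c\<in>?J. ?k c))"
        have "z \<notin> ?o c" if "c \<in> \<K>" for c
        proof
          assume "z \<in> ?o c"
          then have "c \<in> ?J" using z that by blast
          moreover have "z \<in> ?k c" using \<open>z \<in> ?o c\<close> ok[of c] by (rule subsetD[rotated])
          ultimately show False using z by blast
        qed
        then show "z \<in> X - T" using z by (auto simp: T_def)
      qed
      ultimately show "\<exists>W. openin (top_of_set X) W \<and> y \<in> W \<and> W \<subseteq> X - T" by blast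
    qed
    moreover have "T \<subseteq> X" by (auto simp: TN)
    ultimately show ?thesis by (simp add: closedin_def)
  qed
  ultimately have "T = {} \<or> T = X" using conn by (simp add: connected_clopen)
  moreover have "?o c0 \<noteq> {}"
  proof -
    have "(\<lambda>_. 0) \<in> open_unit_disc (fst c0)"
      by (simp add: open_unit_disc_def topspace_Euclidean_space)
    then show ?thesis by blast
  qed
  ultimately have TX: "T = X" using c0K by (auto simp: T_def)
  have "\<forall>c\<in>\<K>. \<exists>S. countable S \<and> S \<subseteq> ?k c \<and> ?k c \<subseteq> closure S"
  proof
    fix c assume "c \<in> \<K>"
    then have "compact (?k c)" using kcomp KC by blast
    then show "\<exists>S. countable S \<and> S \<subseteq> ?k c \<and> ?k c \<subseteq> closure S"
      using compact_metric_separable[of "?k c"] by metis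
  qed
  from bchoice[OF this] obtain S where
    "\<forall>c\<in>\<K>. countable (S c) \<and> S c \<subseteq> ?k c \<and> ?k c \<subseteq> closure (S c)"
    by (elim exE)
  then have S: "\<And>c. c \<in> \<K> \<Longrightarrow> countable (S c)" "\<And>c. c \<in> \<K> \<Longrightarrow> S c \<subseteq> ?k c"
    "\<And>c. c \<in> \<K> \<Longrightarrow> ?k c \<subseteq> closure (S c)"
    by simp_all
  show ?thesis
  proof (rule that[of "\<Union>c\<in>\<K>. S c"])
    show "countable (\<Union>c\<in>\<K>. S c)" using countK S(1) by (rule countable_UN)
    show "(\<Union>c\<in>\<K>. S c) \<subseteq> X"
    proof (rule UN_least)
      fix c assume c: "c \<in> \<K>"
      show "S c \<subseteq> X"
        using S(2)[OF c] kcomp(2)[OF subsetD[OF KC c]] by (rule order_trans)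
    qed
    show "X \<subseteq> closure (\<Union>c\<in>\<K>. S c)"
    proof
      fix x assume "x \<in> X"
      then obtain c where c: "c \<in> \<K>" "x \<in> ?o c" unfolding TX[symmetric] T_def by (elim UN_E)
      have "x \<in> closure (S c)"
        by (rule subsetD[OF S(3)[OF c(1)] subsetD[OF ok c(2)]])
      moreover have "closure (S c) \<subseteq> closure (\<Union>c\<in>\<K>. S c)"
        by (intro closure_mono UN_upper c(1))
      ultimately show "x \<in> closure (\<Union>c\<in>\<K>. S c)" by blast
    qed
  qed
qed


section \<open>Extension of maps into a separable ANR\<close>

text \<open>The separable space \<open>X\<close> is embedded in a countable power of \<open>\<real>\<close> by its distances to a
  countable dense set, with one further coordinate, indexed by \<open>s0\<close>. The condition that this
  coordinate be nonzero outside the image of \<open>X\<close> makes the image closed, and a Tietze extension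
  becomes a map into the resulting space when the extra coordinate is the distance to \<open>A\<close>.\<close>

theorem metric_ANR_extension:
  fixes X :: "'a::metric_space set" and Z :: "'c::metric_space set"
  assumes ANR: "metric_ANR (top_of_set X)" and conn: "connected X"
    and S: "countable S" "S \<subseteq> X" "X \<subseteq> closure S"
    and A: "closedin (top_of_set Z) A" and f: "continuous_on A f" "f \<in> A \<rightarrow> X"
  obtains U g where "openin (top_of_set Z) U" "A \<subseteq> U" "continuous_on U g" "g \<in> U \<rightarrow> X"
    "\<And>x. x \<in> A \<Longrightarrow> g x = f x"
proof -
  have AZ: "A \<subseteq> Z" using A closedin_imp_subset by blast
  \<comment> \<open>For empty \<open>A\<close> the coordinate \<open>infdist z A\<close> would be 0
    everywhere by convention and could not separate points from \<open>A\<close>. For a one-point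
    \<open>X\<close> the set \<open>S - {s0}\<close> below need not be dense.\<close>
  consider "A = {}" | a where "X = {a}" | "A \<noteq> {}" "\<And>a. X \<noteq> {a}" by blast
  then show ?thesis
  proof cases
    case 1
    then show ?thesis using that[of "{}"] by simp
  next
    case 2
    then show ?thesis
      using that[of Z "\<lambda>_. a"] AZ f(2) by (auto simp: Pi_iff)
  next
    case 3
    have "X \<noteq> {}" using 3(1) f(2) by auto
    then obtain s0 where s0: "s0 \<in> X" by blast
    \<comment> \<open>The ANR condition admits only spaces of functions on the type of points of
      \<open>X\<close>, so the extra coordinate must be indexed by some point \<open>s0\<close> of
      \<open>X\<close>. The distance to \<open>s0\<close> is thereby lost, which is why density of
      \<open>S - {s0}\<close> is needed.\<close>
    define J where "J = insert s0 S"
    have dense: "\<exists>s\<in>S - {s0}. dist x s < e" if x: "x \<in> X" and e: "e > 0" for x e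
    proof -
      \<comment> \<open>A connected space with more than one point has no isolated points, so
        \<open>x\<close> can be approached by points different from \<open>s0\<close>.\<close>
      have "\<exists>y\<in>X. y \<noteq> s0 \<and> dist y x < e / 2"
      proof (cases "x = s0")
        case True
        then have "x islimpt X" using connected_imp_perfect[OF conn x 3(2)] by blast
        then show ?thesis using e True unfolding islimpt_approachable by (metis half_gt_zero)
      next
        case False
        then show ?thesis using x e by (intro bexI[of _ x]) auto
      qed
      then obtain y where y: "y \<in> X" "y \<noteq> s0" "dist y x < e / 2" by blast
      have "y \<in> closure S" using y S(3) by blast
      moreover have "min (e / 2) (dist y s0) > 0" using y e by simp
      ultimately obtain s where s: "s \<in> S" "dist s y < min (e / 2) (dist y s0)"
        unfolding closure_approachable by blast
      have "s \<noteq> s0" using s by (auto simp: dist_commute)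
      moreover have "dist x s < e" using s y dist_triangle[of x s y] by (simp add: dist_commute)
      ultimately show ?thesis using s by blast
    qed
    let ?P = "product_topology (\<lambda>_::'a. euclideanreal) J"
    define \<iota> where "\<iota> = (\<lambda>x. restrict (\<lambda>s. if s = s0 then 0 else dist x s) J)"
    define Y where "Y = subtopology ?P {\<phi>. \<phi> s0 \<noteq> 0 \<or> \<phi> \<in> \<iota> ` X}"
    have s0J: "s0 \<in> J" by (simp add: J_def)
    have \<iota>s0: "\<iota> x s0 = 0" for x by (simp add: \<iota>_def s0J)
    have \<iota>s: "\<iota> x s = dist x s" if "s \<in> S - {s0}" for x s using that by (simp add: \<iota>_def J_def)
    have "countable {i \<in> J. \<not> (\<exists>a. topspace euclideanreal \<subseteq> {a})}"
      by (rule countable_subset[of _ J]) (use S(1) in \<open>auto simp: J_def\<close>)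
    then have "metrizable_space ?P"
      by (simp add: metrizable_space_product_topology metrizable_space_euclidean)
    then have metY: "metrizable_space Y"
      unfolding Y_def by (rule metrizable_space_subtopology)
    have \<iota>P: "continuous_map (top_of_set X) ?P \<iota>"
      unfolding continuous_map_componentwise
    proof (intro conjI ballI)
      fix k assume k: "k \<in> J"
      have "continuous_on X (\<lambda>x. \<iota> x k)"
        using k by (cases "k = s0") (auto simp: \<iota>_def intro!: continuous_intros)
      then show "continuous_map (top_of_set X) euclideanreal (\<lambda>x. \<iota> x k)" by simp
    qed (auto simp: \<iota>_def)
    have topY: "topspace Y = {\<phi> \<in> topspace ?P. \<phi> s0 \<noteq> 0 \<or> \<phi> \<in> \<iota> ` X}"
      by (auto simp: Y_def)
    have \<iota>XP: "\<iota> ` X \<subseteq> topspace ?P"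
      using continuous_map_image_subset_topspace[OF \<iota>P] by simp
    have \<iota>XY: "\<iota> ` X \<subseteq> topspace Y" using \<iota>XP topY by blast
    have \<iota>Y: "continuous_map (top_of_set X) Y \<iota>"
      unfolding Y_def continuous_map_in_subtopology using \<iota>P by auto
    have projY: "continuous_map Y euclideanreal (\<lambda>\<phi>. \<phi> s)" if "s \<in> J" for s
      unfolding Y_def using that by (intro continuous_map_from_subtopology continuous_map_product_projection)
    have "\<iota> ` X = {\<phi> \<in> topspace Y. \<phi> s0 \<in> {0}}"
      using \<iota>XY topY \<iota>s0 by auto
    also have "closedin Y \<dots>"
      using projY[OF s0J] by (intro closedin_continuous_map_preimage) auto
    finally have clo: "closedin Y (\<iota> ` X)" .
    have "homeomorphic_map (top_of_set X) (subtopology Y (\<iota> ` X)) \<iota>"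
    proof (rule bijective_open_imp_homeomorphic_map)
      show "continuous_map (top_of_set X) (subtopology Y (\<iota> ` X)) \<iota>"
        using \<iota>Y by (simp add: continuous_map_in_subtopology)
      show "\<iota> ` topspace (top_of_set X) = topspace (subtopology Y (\<iota> ` X))"
        using \<iota>XY by auto
      show "inj_on \<iota> (topspace (top_of_set X))"
      proof (rule inj_onI, rule ccontr)
        fix x y assume xy: "x \<in> topspace (top_of_set X)" "y \<in> topspace (top_of_set X)" "\<iota> x = \<iota> y" "x \<noteq> y"
        then obtain s where s: "s \<in> S - {s0}" "dist x s < dist x y / 2"
          using dense[of x "dist x y / 2"] by auto
        then have "dist y s = dist x s" using xy(3) \<iota>s by metis
        then show False using s dist_triangle[of x y s] by (simp add: dist_commute)
      qed
      show "open_map (top_of_set X) (subtopology Y (\<iota> ` X)) \<iota>"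
        unfolding open_map_def
      proof (intro allI impI)
        fix V assume V: "openin (top_of_set X) V"
        show "openin (subtopology Y (\<iota> ` X)) (\<iota> ` V)"
        proof (subst openin_subopen, intro ballI)
          fix \<phi> assume "\<phi> \<in> \<iota> ` V"
          then obtain x where x: "x \<in> V" "\<phi> = \<iota> x" by blast
          then have xX: "x \<in> X" using V openin_imp_subset by blast
          obtain e where e: "e > 0" "ball x e \<inter> X \<subseteq> V"
            using V x unfolding openin_contains_ball by blast
          \<comment> \<open>One coordinate suffices for openness at \<open>x\<close>: two points at
            distance less than \<open>e / 2\<close> from the same \<open>s\<close> are less than
            \<open>e\<close> apart.\<close>
          obtain s where s: "s \<in> S - {s0}" "dist x s < e / 2" using dense[OF xX, of "e/2"] e by auto
          then have sJ: "s \<in> J" by (simp add: J_def)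
          let ?N = "\<iota> ` X \<inter> {\<phi> \<in> topspace Y. \<phi> s \<in> {..<e/2}}"
          have "openin (subtopology Y (\<iota> ` X)) ?N"
            using projY[OF sJ] by (intro openin_subtopology_Int2 openin_continuous_map_preimage) auto
          moreover have "\<phi> \<in> ?N" using x xX s \<iota>s \<iota>XY by auto
          moreover have "?N \<subseteq> \<iota> ` V"
          proof
            fix \<psi> assume "\<psi> \<in> ?N"
            then obtain y where y: "y \<in> X" "\<psi> = \<iota> y" "\<iota> y s < e / 2" by auto
            then have "dist y s < e / 2" using s \<iota>s by simp
            then have "dist x y < e" using s dist_triangle[of x y s] by (simp add: dist_commute)
            then show "\<psi> \<in> \<iota> ` V" using y e by auto
          qed
          ultimately show "\<exists>T. openin (subtopology Y (\<iota> ` X)) T \<and> \<phi> \<in> T \<and> T \<subseteq> \<iota> ` V" by blast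
        qed
      qed
    qed
    then obtain j where j: "homeomorphic_maps (top_of_set X) (subtopology Y (\<iota> ` X)) \<iota> j"
      by (auto simp: homeomorphic_map_maps)
    then have hs: "top_of_set X homeomorphic_space subtopology Y (\<iota> ` X)"
      by (auto simp: homeomorphic_space_def)
    have "\<exists>U'. openin Y U' \<and> \<iota> ` X \<subseteq> U' \<and> \<iota> ` X retract_of_space subtopology Y U'"
      using ANR[unfolded metric_ANR_def, THEN conjunct2, rule_format, of Y "\<iota> ` X"] metY clo hs
      by blast
    then obtain U' where U': "openin Y U'" "\<iota> ` X \<subseteq> U'" and ret: "\<iota> ` X retract_of_space subtopology Y U'"
      by (elim exE conjE)
    from ret have "\<exists>r. continuous_map (subtopology Y U') (subtopology (subtopology Y U') (\<iota> ` X)) r \<and>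
        (\<forall>\<phi>\<in>\<iota> ` X. r \<phi> = \<phi>)"
      unfolding retract_of_space_def by (rule conjunct2)
    then obtain r where r: "continuous_map (subtopology Y U') (subtopology (subtopology Y U') (\<iota> ` X)) r"
        "\<forall>\<phi>\<in>\<iota> ` X. r \<phi> = \<phi>"
      by (elim exE conjE)
    have "\<forall>s. \<exists>g. continuous_map (top_of_set Z) euclideanreal g \<and> (\<forall>z\<in>A. g z = dist (f z) s)"
    proof
      fix s
      have "normal_space (top_of_set Z)"
        by (intro metrizable_imp_normal_space metrizable_space_subtopology metrizable_space_euclidean)
      moreover have "continuous_map (subtopology (top_of_set Z) A) euclideanreal (\<lambda>z. dist (f z) s)"
        using AZ f(1) by (simp add: subtopology_subtopology Int_absorb1 continuous_on_dist)
      ultimately obtain g where "continuous_map (top_of_set Z) euclideanreal g" "\<And>z. z \<in> A \<Longrightarrow> g z = dist (f z) s"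
        using Tietze_extension_realinterval[OF _ A is_interval_univ UNIV_not_empty, of "\<lambda>z. dist (f z) s"]
        by (metis subset_UNIV)
      then show "\<exists>g. continuous_map (top_of_set Z) euclideanreal g \<and> (\<forall>z\<in>A. g z = dist (f z) s)" by blast
    qed
    from choice[OF this] obtain F where F: "\<And>s. continuous_map (top_of_set Z) euclideanreal (F s)"
      "\<And>s z. z \<in> A \<Longrightarrow> F s z = dist (f z) s" by blast
    define \<Phi> where "\<Phi> = (\<lambda>z. restrict (\<lambda>s. if s = s0 then infdist z A else F s z) J)"
    have \<Phi>A: "\<Phi> z = \<iota> (f z)" if "z \<in> A" for z
      using that F(2) by (auto simp: \<Phi>_def \<iota>_def fun_eq_iff)
    have "continuous_map (top_of_set Z) ?P \<Phi>"
      unfolding continuous_map_componentwise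
    proof (intro conjI ballI)
      fix k assume k: "k \<in> J"
      have "continuous_on Z (\<lambda>z. \<Phi> z k)"
        using k F(1) by (cases "k = s0") (auto simp: \<Phi>_def intro!: continuous_intros)
      then show "continuous_map (top_of_set Z) euclideanreal (\<lambda>z. \<Phi> z k)" by simp
    qed (auto simp: \<Phi>_def)
    moreover have "\<Phi> z s0 \<noteq> 0 \<or> \<Phi> z \<in> \<iota> ` X" if z: "z \<in> Z" for z
    proof (cases "z \<in> A")
      case True
      then show ?thesis using \<Phi>A f(2) by auto
    next
      case False
      obtain T where T: "closed T" "A = Z \<inter> T" using A by (auto simp: closedin_closed)
      then have "z \<notin> closure A" using False z closure_minimal[of A T] by blast
      then have "infdist z A \<noteq> 0" using 3(1) in_closure_iff_infdist_zero by blast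
      then show ?thesis by (simp add: \<Phi>_def s0J)
    qed
    ultimately have \<Phi>: "continuous_map (top_of_set Z) Y \<Phi>"
      unfolding Y_def continuous_map_in_subtopology by auto
    define U where "U = {z \<in> Z. \<Phi> z \<in> U'}"
    have UZ: "openin (top_of_set Z) U"
      using openin_continuous_map_preimage[OF \<Phi> U'(1)] by (simp add: U_def)
    have "continuous_map (top_of_set U) (subtopology Y U') \<Phi>"
      using \<Phi> unfolding continuous_map_in_subtopology
      by (auto simp: U_def intro: continuous_map_from_subtopology_mono)
    then have "continuous_map (top_of_set U) (subtopology Y (\<iota> ` X)) (r \<circ> \<Phi>)"
      using continuous_map_compose[OF _ r(1)] U'(2) by (simp add: subtopology_subtopology Int_absorb1)
    then have g: "continuous_map (top_of_set U) (top_of_set X) (j \<circ> (r \<circ> \<Phi>))"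
      by (rule continuous_map_compose) (use j in \<open>auto simp: homeomorphic_maps_def\<close>)
    show ?thesis
    proof (rule that[OF UZ])
      show "A \<subseteq> U" using AZ \<Phi>A f(2) U'(2) by (auto simp: U_def Pi_iff)
      show "continuous_on U (j \<circ> (r \<circ> \<Phi>))" "j \<circ> (r \<circ> \<Phi>) \<in> U \<rightarrow> X"
        using g by (auto simp: continuous_map_in_subtopology)
      show "(j \<circ> (r \<circ> \<Phi>)) x = f x" if "x \<in> A" for x
        using that f(2) r(2) j \<Phi>A by (auto simp: homeomorphic_maps_def Pi_iff)
    qed
  qed
qed


section \<open>Paths and homotopies\<close>

text \<open>One half of the exponential law, resting on local compactness of the unit interval:
  \<open>t\<close> has a compact neighbourhood \<open>K\<close> that the path at \<open>d\<close>
  sends into \<open>B\<close>, and sending \<open>K\<close> into \<open>B\<close> is an open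
  condition on paths.\<close>

lemma path_space_eval_continuous:
  fixes D :: "'c::topological_space set" and X :: "'a::topological_space set"
  assumes s: "continuous_map (top_of_set D) (path_space (top_of_set X)) s"
  shows "continuous_on (D \<times> {0..1}) (\<lambda>z. s (fst z) (snd z))"
    and "\<And>d t. d \<in> D \<Longrightarrow> t \<in> {0..1} \<Longrightarrow> s d t \<in> X"
proof -
  let ?G = "\<lambda>K V. {f \<in> extensional {0..1::real}. continuous_map (top_of_set {0..1}) (top_of_set X) f \<and> f ` K \<subseteq> V}"
  have open_G: "openin (path_space (top_of_set X)) (?G K V)"
    if "compactin (top_of_set {0..1}) K" "openin (top_of_set X) V" for K V
    unfolding path_space_def compact_open_topology_def topspace_euclidean_subtopology
    by (rule topology_generated_by_Basis) (use that in blast)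
  have sd: "continuous_map (top_of_set {0..1}) (top_of_set X) (s d)" "s d \<in> extensional {0..1}" if "d \<in> D" for d
  proof -
    have "s d \<in> topspace (path_space (top_of_set X))"
      using s that by (auto simp: continuous_map_def)
    then show "continuous_map (top_of_set {0..1}) (top_of_set X) (s d)" "s d \<in> extensional {0..1}"
      by (auto simp: path_space_def compact_open_topology_def topology_generated_by_topspace)
  qed
  then show "s d t \<in> X" if "d \<in> D" "t \<in> {0..1}" for d t
    using that by (fastforce simp: continuous_map_in_subtopology)
  show "continuous_on (D \<times> {0..1}) (\<lambda>z. s (fst z) (snd z))"
    unfolding continuous_on_topological
  proof (intro ballI allI impI)
    fix z B assume z: "z \<in> D \<times> {0..1::real}" and B: "open B" "s (fst z) (snd z) \<in> B"
    obtain d t where dt: "z = (d, t)" "d \<in> D" "t \<in> {0..1}" using z by auto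
    have "continuous_on {0..1} (s d)" using sd[OF dt(2)] by (simp add: continuous_map_in_subtopology)
    then obtain A where A: "open A" "t \<in> A" "\<And>y. y \<in> {0..1} \<Longrightarrow> y \<in> A \<Longrightarrow> s d y \<in> B"
      using B dt by (metis continuous_on_topological fst_conv snd_conv)
    then obtain e where e: "e > 0" "cball t e \<subseteq> A" using open_contains_cball by blast
    define K where "K = {0..1} \<inter> cball t e"
    have K: "compactin (top_of_set {0..1}) K"
      by (simp add: K_def compactin_subtopology compact_Int)
    have "s d ` K \<subseteq> X \<inter> B"
      using A(3) e(2) sd(1)[OF dt(2)] by (fastforce simp: K_def continuous_map_in_subtopology)
    then have "s d \<in> ?G K (X \<inter> B)" using sd[OF dt(2)] by blast
    moreover have "openin (top_of_set D) {d \<in> D. s d \<in> ?G K (X \<inter> B)}"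
      using openin_continuous_map_preimage[OF s open_G[OF K, of "X \<inter> B"]] B(1) by (simp add: openin_open_Int)
    ultimately obtain N where N: "open N" "{d \<in> D. s d \<in> ?G K (X \<inter> B)} = D \<inter> N" "d \<in> N"
      using dt(2) unfolding openin_open by blast
    show "\<exists>A. open A \<and> z \<in> A \<and> (\<forall>y\<in>D \<times> {0..1}. y \<in> A \<longrightarrow> s (fst y) (snd y) \<in> B)"
    proof (intro exI[of _ "N \<times> ball t e"] conjI ballI impI)
      show "open (N \<times> ball t e)" using N(1) by (intro open_Times) auto
      show "z \<in> N \<times> ball t e" using N(3) e(1) dt by simp
      fix y assume y: "y \<in> D \<times> {0..1}" "y \<in> N \<times> ball t e"
      then have "fst y \<in> {d \<in> D. s d \<in> ?G K (X \<inter> B)}" unfolding N(2) by auto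
      then have "s (fst y) \<in> ?G K (X \<inter> B)" by blast
      moreover have "snd y \<in> K" using y by (auto simp: K_def)
      ultimately show "s (fst y) (snd y) \<in> B" by blast
    qed
  qed
qed

text \<open>The converse half of the exponential law. For compact \<open>K\<close> the tube lemma
  turns the condition at all times in \<open>K\<close> into an open condition on
  \<open>d\<close>.\<close>

lemma continuous_map_into_path_space:
  fixes D :: "'c::topological_space set" and X :: "'a::topological_space set"
  assumes k: "continuous_on ({0..1} \<times> D) k" "k \<in> {0..1} \<times> D \<rightarrow> X"
  shows "continuous_map (top_of_set D) (path_space (top_of_set X)) (\<lambda>d. restrict (\<lambda>t. k (t, d)) {0..1})"
    (is "continuous_map _ _ ?s")
proof -
  have sd: "continuous_map (top_of_set {0..1}) (top_of_set X) (?s d)" if d: "d \<in> D" for d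
  proof -
    have "continuous_on {0..1} (\<lambda>t. k (t, d))"
      using d by (auto intro!: continuous_on_compose2[OF k(1)] continuous_intros)
    then have "continuous_on {0..1} (?s d)" by (rule continuous_on_eq) simp
    then show ?thesis using k(2) d by (auto simp: continuous_map_in_subtopology)
  qed
  show ?thesis
    unfolding path_space_def compact_open_topology_def
  proof (rule continuous_on_generated_topo)
    fix W assume "W \<in> {{f \<in> extensional (topspace (top_of_set {0..1::real})).
        continuous_map (top_of_set {0..1}) (top_of_set X) f \<and> f ` K \<subseteq> V} | K V.
        compactin (top_of_set {0..1}) K \<and> openin (top_of_set X) V}"
    then obtain K V where W: "W = {f \<in> extensional {0..1}. continuous_map (top_of_set {0..1}) (top_of_set X) f \<and> f ` K \<subseteq> V}"
      and K: "compactin (top_of_set {0..1}) K" and V: "openin (top_of_set X) V" by auto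
    have Kc: "compact K" "K \<subseteq> {0..1}" using K by (auto simp: compactin_subtopology)
    obtain B where B: "open B" "V = X \<inter> B" using V by (auto simp: openin_open)
    have eq: "?s -` W \<inter> topspace (top_of_set D) = {d \<in> D. \<forall>t\<in>K. k (t, d) \<in> B}"
      using sd Kc(2) k(2) by (auto simp: W B image_subset_iff) 
    show "openin (top_of_set D) (?s -` W \<inter> topspace (top_of_set D))"
      unfolding eq
    proof (subst openin_subopen, intro ballI)
      fix d assume d: "d \<in> {d \<in> D. \<forall>t\<in>K. k (t, d) \<in> B}"
      have "openin (top_of_set ({0..1} \<times> D)) (({0..1} \<times> D) \<inter> k -` B)"
        using continuous_openin_preimage_gen[OF k(1) B(1)] .
      then obtain Q where Q: "open Q" "({0..1} \<times> D) \<inter> k -` B = ({0..1} \<times> D) \<inter> Q" by (auto simp: openin_open)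
      have "{d} \<times> K \<subseteq> prod.swap -` Q" using d Kc(2) Q(2) by auto
      moreover have "open (prod.swap -` Q)"
        by (rule open_vimage[OF Q(1)]) (intro continuous_intros)
      ultimately obtain N where N: "d \<in> N" "open N" "N \<times> K \<subseteq> prod.swap -` Q"
        using Elementary_Topology.tube_lemma[OF Kc(1), of "prod.swap -` Q" d] by blast
      have "D \<inter> N \<subseteq> {d \<in> D. \<forall>t\<in>K. k (t, d) \<in> B}"
      proof
        fix d' assume d': "d' \<in> D \<inter> N"
        have "k (t, d') \<in> B" if "t \<in> K" for t
        proof -
          have "(t, d') \<in> Q" using N(3) d' that by auto
          then show ?thesis using Q(2) d' that Kc(2) by blast
        qed
        then show "d' \<in> {d \<in> D. \<forall>t\<in>K. k (t, d) \<in> B}" using d' by blast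
      qed
      then show "\<exists>T. openin (top_of_set D) T \<and> d \<in> T \<and> T \<subseteq> {d \<in> D. \<forall>t\<in>K. k (t, d) \<in> B}"
        using N d by (intro exI[of _ "D \<inter> N"]) (auto intro: openin_open_Int)
    qed
  next
    let ?G = "\<lambda>K V. {f \<in> extensional (topspace (top_of_set {0..1::real})).
        continuous_map (top_of_set {0..1}) (top_of_set X) f \<and> f ` K \<subseteq> V}"
    show "?s ` topspace (top_of_set D) \<subseteq> \<Union> {?G K V | K V. compactin (top_of_set {0..1}) K \<and> openin (top_of_set X) V}"
    proof (rule image_subsetI, rule UnionI)
      \<comment> \<open>With \<open>K\<close> and \<open>V\<close> empty the subbasic set is the
        whole path space, so the subbase covers every value of the map.\<close>
      show "?G {} {} \<in> {?G K V | K V. compactin (top_of_set {0..1}) K \<and> openin (top_of_set X) V}"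
        using compactin_empty openin_empty by blast
      fix d assume "d \<in> topspace (top_of_set D)"
      then show "?s d \<in> ?G {} {}" using sd[of d] by auto
    qed
  qed
qed


section \<open>Comparison of the two invariants\<close>

lemma top_of_set_Times: "prod_topology (top_of_set A) (top_of_set B) = top_of_set (A \<times> B)"
  by (metis euclidean_product_topology prod_topology_subtopology_eu)

text \<open>A section on the locally closed set \<open>U - V\<close> gives a homotopy between \<open>p\<close> composed with the
  first projection and the second projection on \<open>U - V\<close>; as \<open>X\<close> is an absolute neighbourhood
  extensor, it extends to a neighbourhood of \<open>U - V\<close>.\<close>

lemma homotopy_on_neighbourhood_of_section:
  fixes X :: "'a::metric_space set" and Xt :: "'b::metric_space set" and p :: "'b \<Rightarrow> 'a"
  assumes ANR: "metric_ANR (top_of_set X)" and conn: "connected X"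
    and S: "countable S" "S \<subseteq> X" "X \<subseteq> closure S"
    and p: "continuous_on Xt p" "p \<in> Xt \<rightarrow> X"
    and U: "openin (top_of_set (Xt \<times> X)) U" and V: "openin (top_of_set (Xt \<times> X)) V"
    and s: "continuous_map (top_of_set (U - V)) (path_space (top_of_set Xt)) s"
      "\<And>b. b \<in> U - V \<Longrightarrow> s b 0 = fst b \<and> p (s b 1) = snd b"
  obtains W where "openin (top_of_set (Xt \<times> X)) W" "U - V \<subseteq> W"
    "homotopic_with (\<lambda>_. True) (top_of_set W) (top_of_set X) (\<lambda>b. p (fst b)) snd"
proof -
  have UM: "U \<subseteq> Xt \<times> X" using U openin_imp_subset by blast
  let ?D = "U - V" and ?I = "{0..1::real}"
  \<comment> \<open>\<open>U - V\<close> is closed in \<open>U\<close>, though only locally closed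
    in the whole product, so the extension problem is posed on \<open>U \<times> ?I\<close>. The two
    end slices are included so that the extended homotopy has the prescribed ends over all of
    \<open>W\<close>.\<close>
  define A where "A = ?D \<times> ?I \<union> (U \<times> {0} \<union> U \<times> {1})"
  define f where "f = (\<lambda>(b, t). if b \<in> ?D then p (s b t) else if t = (0::real) then p (fst b) else snd b)"
  have f0: "f (b, 0) = p (fst b)" for b using s(2) by (simp add: f_def)
  have f1: "f (b, 1) = snd b" for b using s(2) by (simp add: f_def)
  have cl: "closedin (top_of_set (U \<times> ?I)) (?D \<times> ?I)" "closedin (top_of_set (U \<times> ?I)) (U \<times> {0})"
    "closedin (top_of_set (U \<times> ?I)) (U \<times> {1})"
  proof -
    obtain G where G: "open G" "V = Xt \<times> X \<inter> G" using V by (auto simp: openin_open)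
    then have "?D = U \<inter> (- G)" using UM by auto
    then have "closedin (top_of_set U) ?D" using G(1) by (metis closed_Compl closedin_closed_Int)
    then show "closedin (top_of_set (U \<times> ?I)) (?D \<times> ?I)" by (intro closedin_Times) auto
    have "closedin (top_of_set ?I) {0}" "closedin (top_of_set ?I) {1}"
      by (auto intro: closed_subset)
    then show "closedin (top_of_set (U \<times> ?I)) (U \<times> {0})" "closedin (top_of_set (U \<times> ?I)) (U \<times> {1})"
      by (simp_all add: closedin_Times)
  qed
  then have clA: "closedin (top_of_set (U \<times> ?I)) A"
    unfolding A_def by (intro closedin_Un)
  have sub: "closedin (top_of_set T) Q" if "closedin (top_of_set (U \<times> ?I)) Q" "Q \<subseteq> T" "T \<subseteq> U \<times> ?I" for Q T
    using that closedin_subset_trans by blast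
  have fD: "continuous_on (?D \<times> ?I) f"
  proof (rule continuous_on_eq)
    show "continuous_on (?D \<times> ?I) (\<lambda>z. p (s (fst z) (snd z)))"
      using path_space_eval_continuous[OF s(1)]
      by (intro continuous_on_compose2[OF p(1)]) auto
  qed (auto simp: f_def)
  have fst01: "continuous_on (U \<times> {0}) f" "continuous_on (U \<times> {1}) f"
  proof -
    have "continuous_on (U \<times> {0}) (\<lambda>z. p (fst (fst z)))"
      using UM by (intro continuous_on_compose2[OF p(1)] continuous_intros) auto
    then show "continuous_on (U \<times> {0}) f"
      by (rule continuous_on_eq) (auto simp: f0)
    have "continuous_on (U \<times> {1}) (\<lambda>z. snd (fst z))"
      by (intro continuous_intros)
    then show "continuous_on (U \<times> {1}) f"
      by (rule continuous_on_eq) (auto simp: f1)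
  qed
  have "closedin (top_of_set (U \<times> {0} \<union> U \<times> {1})) (U \<times> {0::real})"
    by (rule sub[OF cl(2)]) auto
  moreover have "closedin (top_of_set (U \<times> {0} \<union> U \<times> {1})) (U \<times> {1::real})"
    by (rule sub[OF cl(3)]) auto
  ultimately have f01: "continuous_on (U \<times> {0} \<union> U \<times> {1}) f"
    using fst01 by (rule continuous_on_Un_local)
  have "closedin (top_of_set A) (?D \<times> ?I)"
    by (rule sub[OF cl(1)]) (auto simp: A_def)
  moreover have "closedin (top_of_set A) (U \<times> {0} \<union> U \<times> {1})"
    by (rule sub[OF closedin_Un[OF cl(2,3)]]) (auto simp: A_def)
  ultimately have fA: "continuous_on A f"
    using fD f01 unfolding A_def by (rule continuous_on_Un_local)
  have fX: "f \<in> A \<rightarrow> X"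
  proof
    fix w assume w: "w \<in> A"
    obtain b t where bt: "w = (b, t)" by (cases w)
    have b: "b \<in> U" "t \<in> ?I" "b \<notin> ?D \<longrightarrow> t = 0 \<or> t = 1" using w by (auto simp: A_def bt)
    show "f w \<in> X"
    proof (cases "b \<in> ?D")
      case True
      then have "p (s b t) \<in> X"
        using path_space_eval_continuous(2)[OF s(1) True b(2)] p(2) by blast
      then show ?thesis using True by (simp add: f_def bt)
    next
      case False
      have "p (fst b) \<in> X" "snd b \<in> X"
        using subsetD[OF UM b(1)] p(2) by (auto simp: mem_Times_iff)
      then show ?thesis using False b(3) by (auto simp: f_def bt)
    qed
  qed
  obtain R g where R: "openin (top_of_set (U \<times> ?I)) R" "A \<subseteq> R" and g: "continuous_on R g" "g \<in> R \<rightarrow> X"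
    and gf: "\<And>z. z \<in> A \<Longrightarrow> g z = f z"
    using metric_ANR_extension[OF ANR conn S clA fA fX] by metis
  \<comment> \<open>The map extends only to the set \<open>R\<close>, which need not be a product.
    The points whose whole time interval lies in \<open>R\<close> form an open set, since projection
    along the compact interval is closed.\<close>
  define W where "W = {b \<in> U. {b} \<times> ?I \<subseteq> R}"
  have "openin (top_of_set U) W"
  proof -
    have "closedin (prod_topology (top_of_set U) (top_of_set ?I)) (U \<times> ?I - R)"
      using R(1) unfolding top_of_set_Times by auto
    moreover have "closed_map (prod_topology (top_of_set U) (top_of_set ?I)) (top_of_set U) fst"
      by (rule Abstract_Topological_Spaces.closed_map_fst) (simp add: compact_space_subtopology)
    ultimately have "closedin (top_of_set U) (fst ` (U \<times> ?I - R))"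
      by (simp add: closed_map_def)
    then have "openin (top_of_set U) (U - fst ` (U \<times> ?I - R))"
      by (simp add: openin_diff)
    also have "U - fst ` (U \<times> ?I - R) = W"
      by (force simp: W_def)
    finally show ?thesis .
  qed
  then have W: "openin (top_of_set (Xt \<times> X)) W"
    using U openin_trans by blast
  show ?thesis
  proof (rule that[OF W])
    show "U - V \<subseteq> W" using R(2) by (auto simp: W_def A_def)
    have WU: "W \<subseteq> U" by (auto simp: W_def)
    show "homotopic_with (\<lambda>_. True) (top_of_set W) (top_of_set X) (\<lambda>b. p (fst b)) snd"
    proof (subst homotopic_with)
      have "continuous_on (?I \<times> W) (\<lambda>z. g (snd z, fst z))"
        by (intro continuous_on_compose2[OF g(1)] continuous_intros) (auto simp: W_def)
      then have "continuous_map (prod_topology (top_of_set ?I) (top_of_set W)) (top_of_set X) (\<lambda>z. g (snd z, fst z))"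
        unfolding top_of_set_Times continuous_map_in_subtopology
      proof (intro conjI)
        have "(snd z, fst z) \<in> R" if "z \<in> ?I \<times> W" for z
          using that by (auto simp: W_def)
        then show "(\<lambda>z. g (snd z, fst z)) \<in> topspace (top_of_set (?I \<times> W)) \<rightarrow> X"
          using g(2) by auto
      qed simp
      moreover have "g (b, 0) = p (fst b)" "g (b, 1) = snd b" if "b \<in> W" for b
        using that WU gf[of "(b, 0)"] gf[of "(b, 1)"] f0 f1 by (auto simp: A_def)
      ultimately show "\<exists>h. continuous_map (prod_topology (top_of_set ?I) (top_of_set W)) (top_of_set X) h \<and>
          (\<forall>x\<in>topspace (top_of_set W). h (0, x) = p (fst x)) \<and>
          (\<forall>x\<in>topspace (top_of_set W). h (1, x) = snd x) \<and> (\<forall>t\<in>?I. True)"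
        by (intro exI[of _ "\<lambda>z. g (snd z, fst z)"]) auto
    qed auto
  qed
qed

text \<open>Moving only the first coordinate, the homotopy \<open>h\<close> deforms
  \<open>map_prod p id\<close> on \<open>W\<close> into the second projection followed by the
  diagonal. Evaluation on a cycle of \<open>W\<close> thus becomes evaluation of the pullback of
  \<open>z\<close> along the diagonal on a cycle of \<open>X\<close>, and that pullback is a
  coboundary.\<close>

lemma vanishes_on_cycles_of_homotopy:
  fixes X :: "'a::topological_space set" and W :: "('b::topological_space \<times> 'a) set"
  assumes hom: "homotopic_with (\<lambda>_. True) (top_of_set W) (top_of_set X) (\<lambda>b. p (fst b)) snd"
    and z: "z \<in> cocycles (top_of_set (X \<times> X))"
    and ker: "pullback (top_of_set X) (\<lambda>x. (x, x)) z \<in> coboundaries (top_of_set X)"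
    and M: "W \<subseteq> M"
  shows "vanishes_on_cycles (top_of_set W) (pullback (top_of_set M) (map_prod p id) z)"
  unfolding vanishes_on_cycles_def
proof (intro allI impI)
  fix n c assume c: "singular_relcycle n (top_of_set W) {} c"
  let ?\<Delta> = "\<lambda>x :: 'a. (x, x)"
  have cW: "singular_chain n (top_of_set W) c" using c by (simp add: singular_relcycle)
  have cM: "singular_chain n (top_of_set M) c"
    using cW M by (metis singular_chain_mono)
  have snd: "continuous_map (top_of_set W) (top_of_set X) snd"
    using homotopic_with_imp_continuous_maps[OF hom] by blast
  have \<Delta>: "continuous_map (top_of_set X) (top_of_set (X \<times> X)) ?\<Delta>"
    by (auto simp: continuous_map_in_subtopology intro!: continuous_intros)
  obtain h where h: "continuous_map (prod_topology (top_of_set {0..1}) (top_of_set W)) (top_of_set X) h"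
    "\<And>b. h (0::real, b) = p (fst b)" "\<And>b. h (1, b) = snd b"
    using hom unfolding homotopic_with_def by blast
  have "homotopic_with (\<lambda>_. True) (top_of_set W) (top_of_set (X \<times> X)) (map_prod p id) (?\<Delta> \<circ> snd)"
    unfolding homotopic_with_def
  proof (intro exI conjI allI ballI)
    have "continuous_on ({0..1} \<times> W) h" "h \<in> {0..1} \<times> W \<rightarrow> X" "snd \<in> W \<rightarrow> X"
      using h(1) snd unfolding top_of_set_Times by (auto simp: continuous_map_in_subtopology)
    then show "continuous_map (prod_topology (top_of_set {0..1}) (top_of_set W)) (top_of_set (X \<times> X))
        (\<lambda>z. (h z, snd (snd z)))"
      unfolding top_of_set_Times by (auto simp: continuous_map_in_subtopology intro!: continuous_intros)
  qed (auto simp: h(2,3) map_prod_def case_prod_beta)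
  then have hr: "homologous_rel n (top_of_set (X \<times> X)) {} (chain_map n (map_prod p id) c) (chain_map n (?\<Delta> \<circ> snd) c)"
    using c by (intro homotopic_imp_homologous_rel_chain_maps[where T = "{}" and S = "top_of_set W"]) simp_all
  have c': "singular_relcycle n (top_of_set X) {} (chain_map n snd c)"
    by (rule singular_relcycle_chain_map[OF c snd]) simp
  have "cochain_eval (pullback (top_of_set M) (map_prod p id) z) n c = cochain_eval z n (chain_map n (map_prod p id) c)"
    by (rule cochain_eval_pullback[OF cM])
  also have "\<dots> = cochain_eval z n (chain_map n (?\<Delta> \<circ> snd) c)"
    using z hr by (intro cochain_eval_homologous) (auto simp: cocycles_def)
  also have "\<dots> = cochain_eval z n (chain_map n ?\<Delta> (chain_map n snd c))"
    by (simp add: chain_map_compose)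
  also have "\<dots> = cochain_eval (pullback (top_of_set X) ?\<Delta> z) n (chain_map n snd c)"
    using c' by (intro cochain_eval_pullback[symmetric]) (simp add: singular_relcycle)
  also have "\<dots> = 0"
  proof -
    obtain v where "pullback (top_of_set X) ?\<Delta> z = coboundary (top_of_set X) v"
      using ker by (auto simp: coboundaries_def)
    then show ?thesis
      using vanishes_on_cycles_coboundary[of "top_of_set X" v] c' by (simp add: vanishes_on_cycles_def)
  qed
  finally show "cochain_eval (pullback (top_of_set M) (map_prod p id) z) n c = 0" .
qed

definition sectional_filtration ::
  "'e topology \<Rightarrow> 'b topology \<Rightarrow> ('e \<Rightarrow> 'b) \<Rightarrow> nat \<Rightarrow> (nat \<Rightarrow> 'b set) \<Rightarrow> bool" where
  "sectional_filtration E B p n U \<longleftrightarrow>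
     U 0 = {} \<and> U n = topspace B \<and> (\<forall>i\<le>n. openin B (U i)) \<and> (\<forall>i<n. U i \<subseteq> U (Suc i)) \<and>
     (\<forall>i\<in>{1..n}. \<exists>s. continuous_map (subtopology B (U i - U (i - 1))) E s \<and>
                     (\<forall>b \<in> U i - U (i - 1). p (s b) = b))"

lemma sec_eq_Inf_sectional_filtration:
  "sec E B p = Inf {enat n | n. \<exists>U. sectional_filtration E B p n U}"
  by (simp add: sec_def sectional_filtration_def)

lemma nil_index_le_TC_map:
  fixes X :: "'a::metric_space set" and Xt :: "'b::metric_space set" and p :: "'b \<Rightarrow> 'a"
  assumes CW: "CW_complex (top_of_set X)" and conn: "path_connected X"
    and ANR: "metric_ANR (top_of_set X)" and cov: "finite_sheeted_covering Xt p X"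
  shows "nil_index (rat_cohomology (prod_topology (top_of_set X) (top_of_set X))) (diagonal_kernel (top_of_set X))
    \<le> TC_map (top_of_set Xt) (top_of_set X) p"
  unfolding TC_map_def sec_eq_Inf_sectional_filtration
proof (rule Inf_greatest)
  let ?M = "top_of_set (Xt \<times> X)" and ?Q = "top_of_set (X \<times> X)"
  fix m assume "m \<in> {enat n |n. \<exists>U. sectional_filtration (path_space (top_of_set Xt))
     (prod_topology (top_of_set Xt) (top_of_set X)) (\<lambda>\<alpha>. (\<alpha> 0, p (\<alpha> 1))) n U}"
  then obtain n U where m: "m = enat n" and
    U: "sectional_filtration (path_space (top_of_set Xt)) ?M (\<lambda>\<alpha>. (\<alpha> 0, p (\<alpha> 1))) n U"
    unfolding top_of_set_Times by blast
  then have U0: "U 0 = {}" and Un: "U n = Xt \<times> X" and opU: "\<And>i. i \<le> n \<Longrightarrow> openin ?M (U i)"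
    and sU: "\<And>i. i \<in> {1..n} \<Longrightarrow> \<exists>s. continuous_map (subtopology ?M (U i - U (i - 1)))
        (path_space (top_of_set Xt)) s \<and> (\<forall>b\<in>U i - U (i - 1). (s b 0, p (s b 1)) = b)"
    unfolding sectional_filtration_def topspace_euclidean_subtopology by simp_all
  have c: "covering_space Xt p X" and fin: "\<And>b. b \<in> X \<Longrightarrow> finite {e \<in> Xt. p e = b}"
    using cov by (auto simp: finite_sheeted_covering_def)
  then have p: "continuous_on Xt p" "p \<in> Xt \<rightarrow> X" by (auto simp: covering_space_def)
  have conX: "connected X" using conn by (rule path_connected_imp_connected)
  obtain S where S: "countable S" "S \<subseteq> X" "X \<subseteq> closure S"
    using CW_complex_separable[OF CW conX] by metis
  have "\<forall>i\<in>{1..n}. \<exists>W. openin ?M W \<and> U i - U (i - 1) \<subseteq> W \<and>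
    homotopic_with (\<lambda>_. True) (top_of_set W) (top_of_set X) (\<lambda>b. p (fst b)) snd"
  proof
    fix i assume i: "i \<in> {1..n}"
    have Ui: "openin ?M (U i)" "openin ?M (U (i - 1))" using i by (auto intro: opU)
    then have "U i - U (i - 1) \<subseteq> Xt \<times> X" by (meson Diff_subset openin_imp_subset order_trans)
    then have sub: "subtopology ?M (U i - U (i - 1)) = top_of_set (U i - U (i - 1))"
      by (simp add: subtopology_subtopology Int_absorb1)
    obtain s where s: "continuous_map (top_of_set (U i - U (i - 1))) (path_space (top_of_set Xt)) s"
      "\<forall>b\<in>U i - U (i - 1). (s b 0, p (s b 1)) = b"
      using sU[OF i] unfolding sub by blast
    have "s b 0 = fst b \<and> p (s b 1) = snd b" if "b \<in> U i - U (i - 1)" for b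
      using bspec[OF s(2) that] by (metis fst_conv snd_conv)
    then show "\<exists>W. openin ?M W \<and> U i - U (i - 1) \<subseteq> W \<and>
      homotopic_with (\<lambda>_. True) (top_of_set W) (top_of_set X) (\<lambda>b. p (fst b)) snd"
      using homotopy_on_neighbourhood_of_section[OF ANR conX S p Ui s(1)] by metis
  qed
  from bchoice[OF this] obtain W where W: "\<And>i. i \<in> {1..n} \<Longrightarrow> openin ?M (W i)"
    "\<And>i. i \<in> {1..n} \<Longrightarrow> U i - U (i - 1) \<subseteq> W i"
    "\<And>i. i \<in> {1..n} \<Longrightarrow> homotopic_with (\<lambda>_. True) (top_of_set (W i)) (top_of_set X) (\<lambda>b. p (fst b)) snd"
    by blast
  let ?q = "map_prod p id :: 'b \<times> 'a \<Rightarrow> 'a \<times> 'a"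
  have cq: "covering_space (Xt \<times> X) ?q (X \<times> X)" by (rule covering_space_times[OF c])
  then have q: "continuous_map ?M ?Q ?q"
    by (auto simp: covering_space_def continuous_map_in_subtopology)
  have finq: "finite {e \<in> Xt \<times> X. ?q e = b}" if b: "b \<in> X \<times> X" for b
  proof -
    have "{e \<in> Xt \<times> X. ?q e = b} \<subseteq> {e \<in> Xt. p e = fst b} \<times> {snd b}" by auto
    moreover have "finite ({e \<in> Xt. p e = fst b} \<times> {snd b})" using fin[of "fst b"] b by auto
    ultimately show ?thesis by (rule finite_subset)
  qed
  have "nil_index (rat_cohomology (prod_topology (top_of_set X) (top_of_set X))) (diagonal_kernel (top_of_set X)) \<le> enat n"
  proof (rule nil_index_diagonal_kernel_le, unfold top_of_set_Times)
    fix zs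
    assume len: "length zs = n"
      and zs: "set zs \<subseteq> {z \<in> cocycles ?Q. pullback (top_of_set X) (\<lambda>x. (x, x)) z \<in> coboundaries (top_of_set X)}"
    let ?Ws = "map W [1..<Suc n]" and ?us = "map (pullback ?M ?q) zs"
    have zi: "zs ! i \<in> cocycles ?Q" "pullback (top_of_set X) (\<lambda>x. (x, x)) (zs ! i) \<in> coboundaries (top_of_set X)"
      if "i < n" for i
      using subsetD[OF zs nth_mem[of i zs]] len that by simp_all
    have zQ: "foldr (cup ?Q) zs (cochain_one ?Q) \<in> cocycles ?Q"
      using zs by (intro foldr_cup_in_cocycles) auto
    have "foldr (cup ?M) ?us (cochain_one ?M) \<in> coboundaries ?M"
    proof (rule cup_product_in_coboundaries)
      \<comment> \<open>The list counts from 0 and the filtration from 1, so factor \<open>i\<close>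
        is matched with \<open>W (Suc i)\<close>.\<close>
      show "list_all2 (\<lambda>z W. z \<in> cocycles ?M \<and> vanishes_on_cycles (subtopology ?M W) z) ?us ?Ws"
        unfolding list_all2_conv_all_nth
      proof (intro conjI allI impI)
        fix i assume "i < length ?us"
        then have i: "i < n" using len by simp
        then have Wi: "?Ws ! i = W (Suc i)" by (simp del: upt_Suc add: nth_map)
        have us: "?us ! i = pullback ?M ?q (zs ! i)" using i len by simp
        show "?us ! i \<in> cocycles ?M"
          unfolding us by (rule pullback_in_cocycles[OF q zi(1)[OF i]])
        have sub: "W (Suc i) \<subseteq> Xt \<times> X" using W(1)[of "Suc i"] i openin_imp_subset by auto
        then have eq: "subtopology ?M (W (Suc i)) = top_of_set (W (Suc i))"
          by (simp add: subtopology_subtopology Int_absorb1)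
        show "vanishes_on_cycles (subtopology ?M (?Ws ! i)) (?us ! i)"
          unfolding us Wi eq
          by (rule vanishes_on_cycles_of_homotopy[OF W(3) zi[OF i] sub]) (use i in simp)
      qed (simp add: len)
      show "openin ?M V" if "V \<in> set ?Ws" for V using that W(1) by auto
      show "topspace ?M \<subseteq> \<Union>(set ?Ws)"
      proof
        fix b assume "b \<in> topspace ?M"
        then have bn: "b \<in> U n" by (simp add: Un)
        \<comment> \<open>The first filtration level containing \<open>b\<close>: it is nonzero
          because \<open>U 0\<close> is empty, and by minimality \<open>b\<close> lies in the
          difference on which a section was given.\<close>
        define i where "i = (LEAST i. b \<in> U i)"
        have bi: "b \<in> U i" "i \<le> n" unfolding i_def using bn by (auto intro: LeastI Least_le)
        have "i \<noteq> 0" using bi U0 by (metis empty_iff)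
        then have "b \<notin> U (i - 1)" using not_less_Least[of "i - 1" "\<lambda>i. b \<in> U i"] by (simp add: i_def)
        then have "b \<in> W i" using W(2)[of i] bi \<open>i \<noteq> 0\<close> by auto
        then show "b \<in> \<Union>(set ?Ws)" using bi \<open>i \<noteq> 0\<close> by (auto simp del: upt_Suc intro!: bexI[of _ i])
      qed
    qed
    then have "pullback ?M ?q (foldr (cup ?Q) zs (cochain_one ?Q)) \<in> coboundaries ?M"
      by (simp add: pullback_foldr_cup[OF q])
    then show "foldr (cup ?Q) zs (cochain_one ?Q) \<in> coboundaries ?Q"
      using zQ by (intro coboundaries_if_pullback_coboundaries[OF cq finq]) (auto simp: cocycles_def)
  qed
  then show "nil_index (rat_cohomology (prod_topology (top_of_set X) (top_of_set X))) (diagonal_kernel (top_of_set X)) \<le> m"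
    by (simp add: m)
qed

text \<open>The section over each difference, pulled back along \<open>map_prod p id\<close>, is
  read as a homotopy with that preimage as parameter space, so homotopy lifting lifts all paths at
  once and continuously. The path from \<open>p e\<close> to \<open>x\<close> lifts to one that
  starts at \<open>e\<close> and ends over \<open>x\<close>.\<close>

lemma TC_map_covering_le_TC:
  fixes X :: "'a::topological_space set" and Xt :: "'b::topological_space set" and p :: "'b \<Rightarrow> 'a"
  assumes cov: "covering_space Xt p X"
  shows "TC_map (top_of_set Xt) (top_of_set X) p \<le> TC (top_of_set X)"
  unfolding TC_def TC_map_def sec_eq_Inf_sectional_filtration
proof (rule Inf_superset_mono, rule subsetI)
  let ?M = "top_of_set (Xt \<times> X)" and ?Q = "top_of_set (X \<times> X)"
  fix m assume "m \<in> {enat n |n. \<exists>U. sectional_filtration (path_space (top_of_set X))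
     (prod_topology (top_of_set X) (top_of_set X)) (\<lambda>\<alpha>. (\<alpha> 0, id (\<alpha> 1))) n U}"
  then obtain n U where m: "m = enat n" and
    U: "sectional_filtration (path_space (top_of_set X)) ?Q (\<lambda>\<alpha>. (\<alpha> 0, id (\<alpha> 1))) n U"
    unfolding top_of_set_Times by blast
  then have U0: "U 0 = {}" and Un: "U n = X \<times> X" and opU: "\<And>i. i \<le> n \<Longrightarrow> openin ?Q (U i)"
    and mono: "\<And>i. i < n \<Longrightarrow> U i \<subseteq> U (Suc i)"
    and sU: "\<And>i. i \<in> {1..n} \<Longrightarrow> \<exists>s. continuous_map (subtopology ?Q (U i - U (i - 1)))
        (path_space (top_of_set X)) s \<and> (\<forall>b\<in>U i - U (i - 1). (s b 0, s b 1) = b)"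
    unfolding sectional_filtration_def topspace_euclidean_subtopology by simp_all
  let ?q = "map_prod p id :: 'b \<times> 'a \<Rightarrow> 'a \<times> 'a"
  have q: "continuous_on (Xt \<times> X) ?q" "?q ` (Xt \<times> X) = X \<times> X"
    using covering_space_times[OF cov, of X] by (auto simp: covering_space_def)
  define V where "V = (\<lambda>i. (Xt \<times> X) \<inter> ?q -` U i)"
  have "\<exists>s. continuous_map (subtopology ?M (V i - V (i - 1))) (path_space (top_of_set Xt)) s \<and>
      (\<forall>b\<in>V i - V (i - 1). (s b 0, p (s b 1)) = b)" if i: "i \<in> {1..n}" for i
  proof -
    let ?D = "U i - U (i - 1)" and ?E = "V i - V (i - 1)"
    have "?D \<subseteq> X \<times> X" using opU[of i] i openin_imp_subset by auto
    then have "subtopology ?Q ?D = top_of_set ?D"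
      by (simp add: subtopology_subtopology Int_absorb1)
    then obtain s where s: "continuous_map (top_of_set ?D) (path_space (top_of_set X)) s"
      "\<And>b. b \<in> ?D \<Longrightarrow> s b 0 = fst b \<and> s b 1 = snd b"
      using sU[OF i] by (metis fst_conv snd_conv)
    note ev = path_space_eval_continuous[OF s(1)]
    have ED: "?q b \<in> ?D" "b \<in> Xt \<times> X" if "b \<in> ?E" for b using that by (auto simp: V_def)
    define h where "h = (\<lambda>z. s (?q (snd z)) (fst z))"
    have "continuous_on ({0..1} \<times> ?E) (\<lambda>z. (?q (snd z), fst z))"
      by (intro continuous_intros continuous_on_compose2[OF q(1)]) (auto simp: V_def)
    then have h: "continuous_on ({0..1} \<times> ?E) h"
      unfolding h_def using continuous_on_compose2[OF ev(1), of "{0..1} \<times> ?E" "\<lambda>z. (?q (snd z), fst z)"] ED(1)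
      by force
    have hX: "h \<in> {0..1} \<times> ?E \<rightarrow> X"
      using ev(2) ED(1) by (auto simp: h_def)
    have h0: "h (0, b) = p (fst b)" if "b \<in> ?E" for b
      using s(2)[OF ED(1)[OF that]] by (simp add: h_def)
    obtain k where k: "continuous_on ({0..1} \<times> ?E) k" "k \<in> {0..1} \<times> ?E \<rightarrow> Xt"
      "\<And>b. b \<in> ?E \<Longrightarrow> k (0, b) = fst b" "\<And>z. z \<in> {0..1} \<times> ?E \<Longrightarrow> p (k z) = h z"
    proof (rule covering_lift_homotopy[OF cov h hX])
      show "continuous_on ?E fst" by (intro continuous_intros)
      show "fst \<in> ?E \<rightarrow> Xt" using ED(2) by auto
    qed (use h0 in blast)+
    let ?s = "\<lambda>b. restrict (\<lambda>t. k (t, b)) {0..1}"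
    have "?E \<subseteq> Xt \<times> X" by (auto simp: V_def)
    then have "subtopology ?M ?E = top_of_set ?E"
      by (simp add: subtopology_subtopology Int_absorb1)
    then have "continuous_map (subtopology ?M ?E) (path_space (top_of_set Xt)) ?s"
      using continuous_map_into_path_space[OF k(1,2)] by simp
    moreover have "(?s b 0, p (?s b 1)) = b" if "b \<in> ?E" for b
    proof -
      have "p (k (1, b)) = s (?q b) 1" using k(4)[of "(1, b)"] that by (simp add: h_def)
      also have "\<dots> = snd b" using s(2)[OF ED(1)[OF that]] by simp
      finally show ?thesis using k(3)[OF that] by simp
    qed
    ultimately show ?thesis by blast
  qed
  moreover have "openin ?M (V i)" if "i \<le> n" for i
    unfolding V_def using q by (intro continuous_openin_preimage[OF _ _ opU[OF that]]) auto
  moreover have "V i \<subseteq> V (Suc i)" if "i < n" for i using mono[OF that] by (auto simp: V_def)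
  moreover have "V 0 = {}" "V n = Xt \<times> X" using q(2) by (auto simp: V_def U0 Un)
  ultimately have "sectional_filtration (path_space (top_of_set Xt)) ?M (\<lambda>\<alpha>. (\<alpha> 0, p (\<alpha> 1))) n V"
    unfolding sectional_filtration_def by simp
  then show "m \<in> {enat n |n. \<exists>U. sectional_filtration (path_space (top_of_set Xt))
     (prod_topology (top_of_set Xt) (top_of_set X)) (\<lambda>\<alpha>. (\<alpha> 0, p (\<alpha> 1))) n U}"
    unfolding m top_of_set_Times by blast
qed

theorem theorem4p18:
  fixes X :: "'a::metric_space set" and x0 :: 'a
    and Xt :: "'b::metric_space set" and p :: "'b \<Rightarrow> 'a"
  assumes "CW_complex (top_of_set X)" and "x0 \<in> X"
    and "path_connected X" and "metric_ANR (top_of_set X)"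
    and "TC (top_of_set X) =
           nil_index (rat_cohomology (prod_topology (top_of_set X) (top_of_set X)))
                     (diagonal_kernel (top_of_set X))"
    and "path_connected Xt" and "metric_ANR (top_of_set Xt)"
    and "finite_sheeted_covering Xt p X"
  shows "TC_map (top_of_set Xt) (top_of_set X) p = TC (top_of_set X)"
proof (rule antisym)
  show "TC_map (top_of_set Xt) (top_of_set X) p \<le> TC (top_of_set X)"
    using assms(8) by (intro TC_map_covering_le_TC) (simp add: finite_sheeted_covering_def)
  show "TC (top_of_set X) \<le> TC_map (top_of_set Xt) (top_of_set X) p"
    unfolding assms(5) by (rule nil_index_le_TC_map[OF assms(1,3,4,8)])
qed

end
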